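(* Let $\Phi$ be the $L$-periodic solution of the Cahn-Hilliard problem $\partial_t\Phi=\Delta[F'(\Phi)-\epsilon^2\Delta\Phi]$ on $\Omega=(0,L)^2$, $0<t\le T$, with $F(\Phi)=\frac14(\Phi^2-1)^2$ and initial data $\Phi^0$. Assume that there are integers $m\ge 1$, $p\ge 1$ and a constant $C_0>0$ such that $$\|\Phi^0\|_{H^{m+4}}+\sum_{k=0}^{2}\|\partial_t^{(k)}\Phi(t)\|_{H^{m+4-k}}+\sum_{k=3}^{p+1}\|\partial_t^{(k)}\Phi(t)\|_{L^2}\le C_0\quad\text{for } 0<t<T.$$ Assume that the differentiation matrix $D_{\mathrm R}=A_{\mathrm E}^{-1}E_{s_{\mathrm I}}$ of the R-IERK method and its inverse $D_{\mathrm R}^{-1}$ are positive definite. Assume that, with constants $K_1,K_2,K_T$ independent of the meshes, $N\tau\le K_TT$ where $\tau=\max_n\tau_n$, and the temporal stage defects satisfy $\|\zeta_{\mathrm R}^{n,i+1}\|_{L^2}\le K_1\tau_n$ for $1\le i\le s_{\mathrm I}$ and, moreover, $$\zeta_{\mathrm R}^{n,i+1}=0\ \text{ for }1\le i\le s_{\mathrm I}-1,\qquad \|\zeta_{\mathrm R}^{n,s}\|\le K_2\tau^p,\qquad 1\le n\le N.$$ Let $\hat K_4^*:=K_\phi+\epsilon^2$, where $K_\phi$ is a constant independent of $\tau_n$ and $h$ with $\|P_MU^{n,i}\|_\infty\le K_\phi/\epsilon^2$ for all $1\le n\le N$, $1\le i\le s$. If the spatial length $h$ and the maximum step size $\tau$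 are sufficiently small, and the stabilization parameter $\kappa$ is chosen such that $$\kappa\ge\max_{\|\xi\|_\infty\le \hat K_4^*/\epsilon^2}\|F''(\xi)\|_\infty ,$$ then the solution $\phi_h^n:=u_h^{n,s}$ of the fully discrete R-IERK method converges in the discrete $L^2$ norm with order $\mathcal O(\tau^p+h^m)$; that is, there is a constant $C>0$ independent of $h$ and the time-steps $\tau_n$ such that $$\|\Phi(\cdot,t_n)-\phi^n\|\le C(\tau^p+h^m)\quad\text{for }1\le n\le N.$$
   Context: Let $\Omega=(0,L)^2$ and $0<\epsilon<1$; all functions are $L$-periodic in each direction, and $H^q$ denotes the periodic Sobolev space $H^q_{per}(\Omega)$. For $\kappa\ge0$ put $L_\kappa v=-\epsilon^2\Delta v+\kappa v$ and $f_\kappa(v)=\kappa v-F'(v)$. Space discretization (Fourier pseudo-spectral): $M$ is an even positive integer, $h=L/M$, $\Omega_h=\{(ih,jh):1\le i,j\le M\}$. For an $L$-periodic grid function $v$, let $\tilde v_{\ell,m}$, $-M/2\le\ell,m\le M/2-1$, be its discrete Fourier (trigonometric interpolation) coefficients with respect to $e_{\ell,m}(x,y)=e^{\mathrm i\nu(\ell x+my)}$, $\nu=2\pi/L$. Define $\mathcal D_x^2v_h=\sum_{\ell,m}(\mathrm i\nu\ell)^2\tilde v_{\ell,m}e_{\ell,m}(\boldsymbol x_h)$, similarly $\mathcal D_y^2$, and $\Delta_h=\mathcal D_x^2+\mathcal D_y^2$, $L_{\kappa,h}=-\epsilon^2\Delta_h+\kappa$. Discrete inner product $\langle v,w\rangle=h^2\sum_{\boldsymbol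 x_h\in\Omega_h}v_hw_h$, discrete $L^2$ norm $\|v\|=\sqrt{\langle v,v\rangle}$, $\|v\|_\infty=\max_{\boldsymbol x_h\in\Omega_h}|v_h|$ (applied to functions on $\Omega$ via their grid values). $P_M$ is the $L^2(\Omega)$-orthogonal projection onto the span of the $e_{\ell,m}$, $-M/2\le\ell,m\le M/2-1$. Time mesh: $0=t_0<t_1<\dots<t_N=T$, $\tau_n=t_n-t_{n-1}$, $\tau=\max_n\tau_n$. Method: $s\ge2$ stages, $s_{\mathrm I}:=s-1$; real coefficients $\hat a_{i+1,j}$ ($1\le j\le i\le s_{\mathrm I}$) with $\hat a_{k+1,k}\ne0$; abscissas $c_1=0$, $c_{i+1}=\sum_{j=1}^{i}\hat a_{i+1,j}$, $c_i>0$ for $2\le i\le s-1$, $c_s=1$. $A_{\mathrm E}:=(\hat a_{i+1,j})_{i,j=1}^{s_{\mathrm I}}$ (lower triangular), and $E_{s_{\mathrm I}}$ is the lower triangular matrix with all entries on and below the diagonal equal to $1$. A (not necessarily symmetric) real matrix $D$ is positive definite if $(D+D^T)/2$ is positive definite. Write $v^{n,j+\frac12}=\frac12(v^{n,j}+v^{n,j+1})$. Fully discrete R-IERK (refined implicit-explicit Runge-Kutta) method: $$u_h^{n,i+1}=u_h^{n,1}+\tau_n\sum_{j=1}^{i}\hat a_{i+1,j}\Delta_h\big[L_{\kappa,h}u_h^{n,j+\frac12}-f_\kappa(u_h^{n,j})\big],\quad 1\le n\le N,\ 1\le i\le s_{\mathrm I},$$ with $u_h^{1,1}=P_M\Phi^0$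 on the grid and $u_h^{n+1,1}=u_h^{n,s}=:\phi_h^n$. Time-discrete solutions $U^{n,i}$: defined by $U^{n,i+1}=U^{n,1}+\tau_n\sum_{j=1}^{i}\hat a_{i+1,j}\Delta[L_\kappa U^{n,j+\frac12}-f_\kappa(U^{n,j})]$, $U^{1,1}=\Phi^0$, $U^{n+1,1}=U^{n,s}$. Temporal defects $\zeta_{\mathrm R}^{n,i+1}$: with $\Phi^{n,i}:=\Phi(\cdot,t_{n-1}+c_i\tau_n)$, they are defined by $\Phi^{n,i+1}=\Phi^{n,1}+\tau_n\sum_{j=1}^{i}\hat a_{i+1,j}\Delta[L_\kappa\Phi^{n,j+\frac12}-f_\kappa(\Phi^{n,j})]+\tau_n\zeta_{\mathrm R}^{n,i+1}$. Constants, and the thresholds in "sufficiently small", may depend on $\epsilon,\kappa,T,\Omega$, the exact solution, the method coefficients, $K_1$, $K_2$ and $K_T$, but not on $h$, the time-steps $\tau_n$ or $N$. *)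

theory Defs
  imports "HOL-Analysis.Analysis" "Jordan_Normal_Form.Gauss_Jordan_Elimination"
begin

section \<open>Periodic functions on the square\<close>

definition omega :: "real \<Rightarrow> (real \<times> real) set" where
  "omega L = {0<..<L} \<times> {0<..<L}"

definition periodic2 :: "real \<Rightarrow> (real \<times> real \<Rightarrow> 'a) \<Rightarrow> bool" where
  "periodic2 L v \<longleftrightarrow> (\<forall>x y. v (x + L, y) = v (x, y) \<and> v (x, y + L) = v (x, y))"

definition emode :: "real \<Rightarrow> int \<times> int \<Rightarrow> real \<times> real \<Rightarrow> complex" where
  "emode L k z = cis (2 * pi / L * (of_int (fst k) * fst z + of_int (snd k) * snd z))"

definition L2per :: "real \<Rightarrow> (real \<times> real \<Rightarrow> real) \<Rightarrow> bool" where
  "L2per L v \<longleftrightarrow> periodic2 L v \<and> v \<in> borel_measurable borel \<and>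
     set_integrable lborel (omega L) (\<lambda>z. (v z)\<^sup>2)"

definition L2norm :: "real \<Rightarrow> (real \<times> real \<Rightarrow> real) \<Rightarrow> real" where
  "L2norm L v = sqrt (LINT z:omega L|lborel. (v z)\<^sup>2)"

definition fcoef :: "real \<Rightarrow> (real \<times> real \<Rightarrow> real) \<Rightarrow> int \<times> int \<Rightarrow> complex" where
  "fcoef L v k = (LINT z:omega L|lborel. complex_of_real (v z) * cnj (emode L k z)) / of_real (L\<^sup>2)"

definition freq2 :: "real \<Rightarrow> int \<times> int \<Rightarrow> real" where
  "freq2 L k = (2 * pi / L)\<^sup>2 * ((of_int (fst k))\<^sup>2 + (of_int (snd k))\<^sup>2)"

text \<open>
  The periodic Sobolev space of order \<open>q\<close> and its norm, by Fourier coefficients.  The factor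
  \<open>L\<^sup>2\<close> makes the norm of order 0 the \<open>L\<^sup>2\<close> norm over the square (Parseval).
\<close>

definition Hper :: "real \<Rightarrow> nat \<Rightarrow> (real \<times> real \<Rightarrow> real) \<Rightarrow> bool" where
  "Hper L q v \<longleftrightarrow> L2per L v \<and>
     (\<lambda>k. (1 + freq2 L k) ^ q * (norm (fcoef L v k))\<^sup>2) summable_on UNIV"

definition Hnorm :: "real \<Rightarrow> nat \<Rightarrow> (real \<times> real \<Rightarrow> real) \<Rightarrow> real" where
  "Hnorm L q v = sqrt (L\<^sup>2 * (\<Sum>\<^sub>\<infinity>k. (1 + freq2 L k) ^ q * (norm (fcoef L v k))\<^sup>2))"

text \<open>
  The weak periodic Laplacian, tested against the trigonometric basis.  It exists exactly for
  \<open>v\<close> in the periodic Sobolev space of order 2 and is unique up to null sets, so identities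
  involving \<open>laplacian\<close> are stated almost everywhere.
\<close>

definition is_laplacian :: "real \<Rightarrow> (real \<times> real \<Rightarrow> real) \<Rightarrow> (real \<times> real \<Rightarrow> real) \<Rightarrow> bool" where
  "is_laplacian L v w \<longleftrightarrow> L2per L w \<and> (\<forall>k. fcoef L w k = - of_real (freq2 L k) * fcoef L v k)"

definition laplacian :: "real \<Rightarrow> (real \<times> real \<Rightarrow> real) \<Rightarrow> real \<times> real \<Rightarrow> real" where
  "laplacian L v = (SOME w. is_laplacian L v w)"

text \<open>Strong derivative at time \<open>t\<close>, relative to \<open>S\<close>, of a curve with values in \<open>L\<^sup>2\<close>.\<close>

definition has_L2_deriv ::
  "real \<Rightarrow> (real \<Rightarrow> real \<times> real \<Rightarrow> real) \<Rightarrow> (real \<times> real \<Rightarrow> real) \<Rightarrow> real \<Rightarrow> real set \<Rightarrow> bool" where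
  "has_L2_deriv L \<Phi> g t S \<longleftrightarrow> (\<forall>r\<in>S. L2per L (\<Phi> r)) \<and> L2per L g \<and>
     ((\<lambda>r. L2norm L (\<lambda>z. (\<Phi> r z - \<Phi> t z) / (r - t) - g z)) \<longlongrightarrow> 0) (at t within S)"


section \<open>The Cahn-Hilliard problem\<close>

text \<open>Polymorphic because the discrete solution is complex valued, see below.\<close>

definition F :: "'a::real_normed_field \<Rightarrow> 'a" where
  "F v = (v\<^sup>2 - 1)\<^sup>2 / 4"

definition f_kappa :: "real \<Rightarrow> 'a::real_normed_field \<Rightarrow> 'a" where
  "f_kappa \<kappa> v = of_real \<kappa> * v - deriv F v"

definition ch_solution ::
  "real \<Rightarrow> real \<Rightarrow> real \<Rightarrow> (real \<times> real \<Rightarrow> real) \<Rightarrow> (real \<Rightarrow> real \<times> real \<Rightarrow> real) \<Rightarrow> bool" where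
  "ch_solution L T \<epsilon> \<Phi>0 \<Phi> \<longleftrightarrow>
     \<Phi> 0 = \<Phi>0 \<and>
     (\<forall>t\<in>{0..T}. continuous_on UNIV (\<Phi> t) \<and> periodic2 L (\<Phi> t)) \<and>
     ((\<lambda>t. L2norm L (\<lambda>z. \<Phi> t z - \<Phi>0 z)) \<longlongrightarrow> 0) (at_right 0) \<and>
     (\<forall>t\<in>{0<..T}. Hper L 4 (\<Phi> t) \<and>
        has_L2_deriv L \<Phi> (laplacian L (\<lambda>z. deriv F (\<Phi> t z) - \<epsilon>\<^sup>2 * laplacian L (\<Phi> t) z)) t {0..T})"

text \<open>\<open>G k t\<close> is the time derivative of order \<open>k\<close> of \<open>\<Phi>\<close> at time \<open>t\<close>.\<close>

definition ch_regular ::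
  "real \<Rightarrow> real \<Rightarrow> nat \<Rightarrow> nat \<Rightarrow> real \<Rightarrow> (real \<times> real \<Rightarrow> real) \<Rightarrow> (real \<Rightarrow> real \<times> real \<Rightarrow> real) \<Rightarrow> bool" where
  "ch_regular L T m p C0 \<Phi>0 \<Phi> \<longleftrightarrow>
     Hper L (m + 4) \<Phi>0 \<and>
     (\<exists>G. (\<forall>t\<in>{0<..<T}. G 0 t = \<Phi> t) \<and>
        (\<forall>k < max 2 (p + 1). \<forall>t\<in>{0<..<T}. has_L2_deriv L (G k) (G (Suc k) t) t {0<..<T}) \<and>
        (\<forall>t\<in>{0<..<T}.
           (\<forall>k\<le>2. Hper L (m + 4 - k) (G k t)) \<and>
           Hnorm L (m + 4) \<Phi>0 + (\<Sum>k\<le>2. Hnorm L (m + 4 - k) (G k t))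
             + (\<Sum>k=3..p+1. L2norm L (G k t)) \<le> C0))"


section \<open>Fourier pseudo-spectral discretization\<close>

definition grid :: "real \<Rightarrow> nat \<Rightarrow> (real \<times> real) set" where
  "grid L M = (\<lambda>(i, j). (real i * (L / real M), real j * (L / real M))) ` ({1..M} \<times> {1..M})"

definition modes :: "nat \<Rightarrow> (int \<times> int) set" where
  "modes M = {- (int M div 2) .. int M div 2 - 1} \<times> {- (int M div 2) .. int M div 2 - 1}"

text \<open>
  Grid functions are functions on the plane of which only the values on \<open>grid L M\<close> matter.
  They are complex valued: the modes contain \<open>- M/2\<close> but not \<open>M/2\<close>, so the orthogonal
  projection of a real function need not be real, not even on the grid.
\<close>

definition dnorm :: "real \<Rightarrow> nat \<Rightarrow> (real \<times> real \<Rightarrow> 'a::real_normed_vector) \<Rightarrow> real" where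
  "dnorm L M v = sqrt ((L / real M)\<^sup>2 * (\<Sum>z\<in>grid L M. (norm (v z))\<^sup>2))"

definition dsup :: "real \<Rightarrow> nat \<Rightarrow> (real \<times> real \<Rightarrow> 'a::real_normed_vector) \<Rightarrow> real" where
  "dsup L M v = Max ((\<lambda>z. norm (v z)) ` grid L M)"

definition proj :: "real \<Rightarrow> nat \<Rightarrow> (real \<times> real \<Rightarrow> real) \<Rightarrow> real \<times> real \<Rightarrow> complex" where
  "proj L M v z = (\<Sum>k\<in>modes M. fcoef L v k * emode L k z)"

definition dcoef :: "real \<Rightarrow> nat \<Rightarrow> (real \<times> real \<Rightarrow> complex) \<Rightarrow> int \<times> int \<Rightarrow> complex" where
  "dcoef L M v k = (\<Sum>z\<in>grid L M. v z * cnj (emode L k z)) / of_nat (M\<^sup>2)"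

definition Dx2 :: "real \<Rightarrow> nat \<Rightarrow> (real \<times> real \<Rightarrow> complex) \<Rightarrow> real \<times> real \<Rightarrow> complex" where
  "Dx2 L M v z =
     (\<Sum>k\<in>modes M. (\<i> * of_real (2 * pi / L) * of_int (fst k))\<^sup>2 * dcoef L M v k * emode L k z)"

definition Dy2 :: "real \<Rightarrow> nat \<Rightarrow> (real \<times> real \<Rightarrow> complex) \<Rightarrow> real \<times> real \<Rightarrow> complex" where
  "Dy2 L M v z =
     (\<Sum>k\<in>modes M. (\<i> * of_real (2 * pi / L) * of_int (snd k))\<^sup>2 * dcoef L M v k * emode L k z)"

definition dlap :: "real \<Rightarrow> nat \<Rightarrow> (real \<times> real \<Rightarrow> complex) \<Rightarrow> real \<times> real \<Rightarrow> complex" where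
  "dlap L M v z = Dx2 L M v z + Dy2 L M v z"


section \<open>Time mesh and coefficients of the method\<close>

definition time_mesh :: "real \<Rightarrow> nat \<Rightarrow> (nat \<Rightarrow> real) \<Rightarrow> bool" where
  "time_mesh T N t \<longleftrightarrow> t 0 = 0 \<and> t N = T \<and> (\<forall>n<N. t n < t (Suc n))"

definition step :: "(nat \<Rightarrow> real) \<Rightarrow> nat \<Rightarrow> real" where
  "step t n = t n - t (n - 1)"

definition max_step :: "nat \<Rightarrow> (nat \<Rightarrow> real) \<Rightarrow> real" where
  "max_step N t = Max (step t ` {1..N})"

text \<open>
  A method with \<open>s\<close> stages is given by numbers \<open>a (i + 1) j\<close> for \<open>1 \<le> j \<le> i \<le> s - 1\<close>; the
  sum below is empty for \<open>i = 1\<close>.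
\<close>

definition abscissa :: "(nat \<Rightarrow> nat \<Rightarrow> real) \<Rightarrow> nat \<Rightarrow> real" where
  "abscissa a i = (\<Sum>j=1..<i. a i j)"

definition ierk_coeffs :: "nat \<Rightarrow> (nat \<Rightarrow> nat \<Rightarrow> real) \<Rightarrow> bool" where
  "ierk_coeffs s a \<longleftrightarrow> 2 \<le> s \<and> (\<forall>k\<in>{1..s-1}. a (k + 1) k \<noteq> 0) \<and>
     (\<forall>i\<in>{2..s-1}. 0 < abscissa a i) \<and> abscissa a s = 1"

text \<open>Matrix entries are indexed from 0.\<close>

definition A_E :: "nat \<Rightarrow> (nat \<Rightarrow> nat \<Rightarrow> real) \<Rightarrow> real mat" where
  "A_E s a = Matrix.mat (s - 1) (s - 1) (\<lambda>(i, j). if j \<le> i then a (i + 2) (j + 1) else 0)"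

definition E_low :: "nat \<Rightarrow> real mat" where
  "E_low s = Matrix.mat (s - 1) (s - 1) (\<lambda>(i, j). if j \<le> i then 1 else 0)"

definition D_R :: "nat \<Rightarrow> (nat \<Rightarrow> nat \<Rightarrow> real) \<Rightarrow> real mat" where
  "D_R s a = the (mat_inverse (A_E s a)) * E_low s"

definition pos_def_mat :: "nat \<Rightarrow> real mat \<Rightarrow> bool" where
  "pos_def_mat n D \<longleftrightarrow> D \<in> carrier_mat n n \<and>
     (\<forall>x\<in>carrier_vec n. x \<noteq> 0\<^sub>v n \<longrightarrow>
        0 < scalar_prod x (((1 / 2) \<cdot>\<^sub>m (D + transpose_mat D)) *\<^sub>v x))"


section \<open>The schemes\<close>

definition half :: "(nat \<Rightarrow> real \<times> real \<Rightarrow> 'a::real_normed_field) \<Rightarrow> nat \<Rightarrow> real \<times> real \<Rightarrow> 'a" where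
  "half v j z = (v j z + v (j + 1) z) / 2"

text \<open>\<open>\<Delta>[L\<^sub>\<kappa> v - f\<^sub>\<kappa>(w)]\<close> and its discrete counterpart.\<close>

definition ch_rhs :: "real \<Rightarrow> real \<Rightarrow> real \<Rightarrow>
    (real \<times> real \<Rightarrow> real) \<Rightarrow> (real \<times> real \<Rightarrow> real) \<Rightarrow> real \<times> real \<Rightarrow> real" where
  "ch_rhs L \<epsilon> \<kappa> v w =
     laplacian L (\<lambda>z. - \<epsilon>\<^sup>2 * laplacian L v z + \<kappa> * v z - f_kappa \<kappa> (w z))"

definition ch_rhs_h :: "real \<Rightarrow> nat \<Rightarrow> real \<Rightarrow> real \<Rightarrow>
    (real \<times> real \<Rightarrow> complex) \<Rightarrow> (real \<times> real \<Rightarrow> complex) \<Rightarrow> real \<times> real \<Rightarrow> complex" where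
  "ch_rhs_h L M \<epsilon> \<kappa> v w =
     dlap L M (\<lambda>z. - of_real (\<epsilon>\<^sup>2) * dlap L M v z + of_real \<kappa> * v z - f_kappa \<kappa> (w z))"

definition fully_discrete :: "real \<Rightarrow> nat \<Rightarrow> real \<Rightarrow> real \<Rightarrow> nat \<Rightarrow> (nat \<Rightarrow> nat \<Rightarrow> real) \<Rightarrow>
    nat \<Rightarrow> (nat \<Rightarrow> real) \<Rightarrow> (real \<times> real \<Rightarrow> real) \<Rightarrow> (nat \<Rightarrow> nat \<Rightarrow> real \<times> real \<Rightarrow> complex) \<Rightarrow> bool" where
  "fully_discrete L M \<epsilon> \<kappa> s a N t \<Phi>0 u \<longleftrightarrow>
     (\<forall>z\<in>grid L M.
        u 1 1 z = proj L M \<Phi>0 z \<and>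
        (\<forall>n\<in>{1..<N}. u (n + 1) 1 z = u n s z) \<and>
        (\<forall>n\<in>{1..N}. \<forall>i\<in>{1..s-1}. u n (i + 1) z = u n 1 z + of_real (step t n) *
           (\<Sum>j=1..i. of_real (a (i + 1) j) * ch_rhs_h L M \<epsilon> \<kappa> (half (u n) j) (u n j) z)))"

definition time_discrete :: "real \<Rightarrow> real \<Rightarrow> real \<Rightarrow> nat \<Rightarrow> (nat \<Rightarrow> nat \<Rightarrow> real) \<Rightarrow>
    nat \<Rightarrow> (nat \<Rightarrow> real) \<Rightarrow> (real \<times> real \<Rightarrow> real) \<Rightarrow> (nat \<Rightarrow> nat \<Rightarrow> real \<times> real \<Rightarrow> real) \<Rightarrow> bool" where
  "time_discrete L \<epsilon> \<kappa> s a N t \<Phi>0 U \<longleftrightarrow>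
     U 1 1 = \<Phi>0 \<and>
     (\<forall>n\<in>{1..<N}. U (n + 1) 1 = U n s) \<and>
     (\<forall>n\<in>{1..N}. \<forall>i\<in>{1..s}. Hper L 4 (U n i)) \<and>
     (\<forall>n\<in>{1..N}. \<forall>i\<in>{1..s-1}. AE z in lborel. U n (i + 1) z = U n 1 z + step t n *
        (\<Sum>j=1..i. a (i + 1) j * ch_rhs L \<epsilon> \<kappa> (half (U n) j) (U n j) z))"

definition stage_exact ::
    "(nat \<Rightarrow> nat \<Rightarrow> real) \<Rightarrow> (nat \<Rightarrow> real) \<Rightarrow> (real \<Rightarrow> real \<times> real \<Rightarrow> real) \<Rightarrow> nat \<Rightarrow> nat \<Rightarrow> real \<times> real \<Rightarrow> real" where
  "stage_exact a t \<Phi> n i = \<Phi> (t (n - 1) + abscissa a i * step t n)"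

text \<open>
  The defects: the first condition says that the exact stage values are defined, as \<open>\<Phi>\<close> is
  only given on \<open>[0, T]\<close>; the defects are the continuous representatives, because their values
  on the grid enter the discrete norm.
\<close>

definition stage_defects :: "real \<Rightarrow> real \<Rightarrow> real \<Rightarrow> real \<Rightarrow> nat \<Rightarrow> (nat \<Rightarrow> nat \<Rightarrow> real) \<Rightarrow>
    nat \<Rightarrow> (nat \<Rightarrow> real) \<Rightarrow> (real \<Rightarrow> real \<times> real \<Rightarrow> real) \<Rightarrow>
    (nat \<Rightarrow> nat \<Rightarrow> real \<times> real \<Rightarrow> real) \<Rightarrow> bool" where
  "stage_defects L T \<epsilon> \<kappa> s a N t \<Phi> \<zeta> \<longleftrightarrow>
     (\<forall>n\<in>{1..N}. \<forall>i\<in>{1..s}. t (n - 1) + abscissa a i * step t n \<le> T) \<and>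
     (\<forall>n\<in>{1..N}. \<forall>i\<in>{1..s-1}.
        continuous_on UNIV (\<zeta> n (i + 1)) \<and> periodic2 L (\<zeta> n (i + 1)) \<and>
        (AE z in lborel. stage_exact a t \<Phi> n (i + 1) z = stage_exact a t \<Phi> n 1 z + step t n *
           (\<Sum>j=1..i. a (i + 1) j *
              ch_rhs L \<epsilon> \<kappa> (half (stage_exact a t \<Phi> n) j) (stage_exact a t \<Phi> n j) z)
           + step t n * \<zeta> n (i + 1) z))"

end

theory Submission
  imports Defs "Jordan_Normal_Form.Determinant"
begin

text \<open>
  The discrete solution is compared directly with the grid values of the exact solution.  In
  discrete Fourier space the error \<open>e\<close> satisfies, mode by mode,
  \<open>e\<^sub>i\<^sub>+\<^sub>1 - e\<^sub>i = \<tau> \<Sum>\<^sub>j b\<^sub>i\<^sub>j (- \<mu> (e\<^sub>j + e\<^sub>j\<^sub>+\<^sub>1) / 2 + \<lambda> g\<^sub>j + r\<^sub>j) + \<tau> \<zeta>\<^sub>i\<close>, where \<open>b\<close> is the inverse of the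
  differentiation matrix.  Testing with \<open>(e\<^sub>i + e\<^sub>i\<^sub>+\<^sub>1) / 2\<close> telescopes on the left, and positive
  definiteness of \<open>b\<close> turns the fourth-order term into dissipation.  Done with the weight
  \<open>(1 + \<lambda>)\<^sup>2\<close>, this estimate needs the defects only in the discrete \<open>L\<^sup>2\<close> norm but controls the error
  in the discrete \<open>H\<^sup>2\<close> norm.  That space is an algebra, so the cubic nonlinearity is Lipschitz near the exact
  solution, and the a priori bound closes by induction over stages and steps without an inverse
  inequality.

  The spatial residual \<open>r\<close> is an aliasing sum.  For \<open>m = 1\<close> the assumed regularity is too low to
  bound it directly, but the equation itself yields two further orders of regularity of the exact solution.
\<close>

text \<open>The Lipschitz bound for the nonlinearity holds only while the error is at most 1, so
  smallness has to be recovered before each new stage. The energy argument can do this because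
  differences of consecutive stages are governed by the inverse of \<open>D_R\<close>, every leading
  block of which inherits coercivity: the estimate closes after each stage and not only at the end
  of a step. The order 2 of the weight is pinched from both sides. In two dimensions it is the first
  integer order at which the reciprocal weights are summable, which makes the space an algebra; and
  it is the largest order at which the fourth-order dissipation still absorbs an unweighted defect.
  An identity almost everywhere says nothing about grid points. It is carried over through Fourier
  coefficients: their sums over all frequencies that coincide on the grid are the discrete
  coefficients. This covers the defects too, whose coefficients are absolutely summable because the
  stage equation expresses them by summable ones.\<close>

section \<open>Coercive forms, convolutions, the energy estimate and growth bounds\<close>

text \<open>Both sides are homogeneous of degree 2, so the constant is the minimum of the form on
  the unit sphere, which is attained by compactness.\<close>

lemma coercive_form:
  fixes B :: "nat \<Rightarrow> nat \<Rightarrow> real"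
  assumes pos: "\<And>x. (\<exists>i<n. x i \<noteq> 0) \<Longrightarrow> 0 < (\<Sum>i<n. \<Sum>j<n. B i j * x i * x j)"
  shows "\<exists>\<beta>>0. \<forall>x. \<beta> * (\<Sum>i<n. (x i)\<^sup>2) \<le> (\<Sum>i<n. \<Sum>j<n. B i j * x i * x j)"
proof (cases "n = 0")
  case True
  then show ?thesis by (intro exI[of _ 1]) auto
next
  case False
  define q where "q = (\<lambda>x::nat \<Rightarrow> real. \<Sum>i<n. \<Sum>j<n. B i j * x i * x j)"
  \<comment> \<open>The dimension \<open>n\<close> is a variable, so vectors are sequences.
    Coordinates from \<open>n\<close> on are frozen at 0, which makes the sphere a closed subset of
    a product that is compact by Tychonoff's theorem.\<close>
  define K where "K = PiE UNIV (\<lambda>i::nat. if i < n then {-1..1::real} else {0})"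
  define S where "S = K \<inter> {x. (\<Sum>i<n. (x i)\<^sup>2) = 1}"
  have coord: "continuous_on UNIV (\<lambda>x::nat \<Rightarrow> real. x i)" for i
    by (rule continuous_on_product_coordinates)
  have "compact K"
    unfolding K_def using compactin_PiE[of "\<lambda>i. euclidean" UNIV "\<lambda>i::nat. if i < n then {-1..1::real} else {0}"]
    by (auto simp: euclidean_product_topology compactin_euclidean_iff)
  moreover have "closed {x::nat \<Rightarrow> real. (\<Sum>i<n. (x i)\<^sup>2) = 1}"
    by (intro closed_Collect_eq continuous_on_sum continuous_on_power coord continuous_on_const)
  ultimately have "compact S" unfolding S_def by (rule compact_Int_closed)
  have "(\<lambda>i. if i = 0 then 1 else 0) \<in> S"
    unfolding S_def K_def using False by (auto simp: PiE_iff if_distrib[of "\<lambda>x. x\<^sup>2"] sum.delta cong: if_cong)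
  then have "S \<noteq> {}" by blast
  have "continuous_on S q"
    unfolding q_def
    by (intro continuous_on_sum continuous_on_mult continuous_on_const)
       (blast intro: continuous_on_subset[OF coord])+
  from continuous_attains_inf[OF \<open>compact S\<close> \<open>S \<noteq> {}\<close> this]
  obtain x0 where x0: "x0 \<in> S" and min: "\<And>x. x \<in> S \<Longrightarrow> q x0 \<le> q x" by blast
  have "\<exists>i<n. x0 i \<noteq> 0"
  proof (rule ccontr)
    assume "\<not> ?thesis"
    then have "(\<Sum>i<n. (x0 i)\<^sup>2) = 0" by (intro sum.neutral) auto
    then show False using x0 unfolding S_def by simp
  qed
  then have "0 < q x0" unfolding q_def by (rule pos)
  moreover have "q x0 * (\<Sum>i<n. (x i)\<^sup>2) \<le> q x" for x
  proof (cases "(\<Sum>i<n. (x i)\<^sup>2) = 0")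
    case True
    then have "\<And>i. i < n \<Longrightarrow> x i = 0" by (subst (asm) sum_nonneg_eq_0_iff) auto
    then show ?thesis by (simp add: True q_def)
  next
    case False
    define r where "r = (\<Sum>i<n. (x i)\<^sup>2)"
    have r: "0 < r" using False sum_nonneg[of "{..<n}" "\<lambda>i. (x i)\<^sup>2"] unfolding r_def by simp
    define y where "y = (\<lambda>i. if i < n then x i / sqrt r else 0)"
    have y2: "(y i)\<^sup>2 = (x i)\<^sup>2 / r" if "i < n" for i
      using that r by (simp add: y_def power_divide)
    have sy: "(\<Sum>i<n. (y i)\<^sup>2) = 1"
      using r by (simp add: y2 flip: sum_divide_distrib) (simp add: r_def)
    have "\<bar>y i\<bar> \<le> 1" if "i < n" for i
    proof -
      have "(y i)\<^sup>2 \<le> (\<Sum>i<n. (y i)\<^sup>2)"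
        using that by (intro member_le_sum) auto
      then show ?thesis by (simp add: sy abs_square_le_1)
    qed
    then have "y \<in> S" unfolding S_def K_def using sy
      by (auto simp: PiE_iff abs_le_iff) (auto simp: y_def)
    then have "q x0 \<le> q y" by (rule min)
    also have "q y = q x / r"
    proof -
      have "B i j * y i * y j = B i j * x i * x j / r" if "i < n" "j < n" for i j
        using that r by (simp add: y_def)
      then show ?thesis unfolding q_def by (simp add: sum_divide_distrib)
    qed
    finally show ?thesis using r by (simp add: field_simps r_def)
  qed
  ultimately show ?thesis unfolding q_def by blast
qed

text \<open>Cauchy-Schwarz with the weight \<open>W p * W (\<psi> k p)\<close> leaves the factor
  \<open>W k / (W p * W (\<psi> k p))\<close>, which \<open>sub\<close> bounds by
  \<open>c * (1 / W (\<psi> k p) + 1 / W p)\<close>; its sum over \<open>p\<close> is at most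
  \<open>2 * c * \<sigma>\<close>, uniformly in \<open>k\<close>. The map \<open>\<psi>\<close> is
  left open so that one argument covers ordinary convolution and cyclic convolution on the
  grid.\<close>

lemma weighted_convolution_bound:
  fixes W :: "'a \<Rightarrow> real"
  assumes W: "\<And>k. 0 < W k" and c: "0 \<le> c"
    and sub: "\<And>k p. k \<in> K \<Longrightarrow> p \<in> P \<Longrightarrow> W k \<le> c * (W p + W (\<psi> k p))"
    and \<sigma>1: "(\<Sum>p\<in>P. 1 / W p) \<le> \<sigma>" and \<sigma>2: "\<And>k. k \<in> K \<Longrightarrow> (\<Sum>p\<in>P. 1 / W (\<psi> k p)) \<le> \<sigma>"
    and X: "(\<Sum>p\<in>P. W p * (A p)\<^sup>2) \<le> X" and Y: "\<And>p. p \<in> P \<Longrightarrow> (\<Sum>k\<in>K. W (\<psi> k p) * (B (\<psi> k p))\<^sup>2) \<le> Y"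
    and "0 \<le> Y"
  shows "(\<Sum>k\<in>K. W k * (\<Sum>p\<in>P. A p * B (\<psi> k p))\<^sup>2) \<le> 2 * c * \<sigma> * X * Y"
proof -
  have \<sigma>0: "0 \<le> \<sigma>" using \<sigma>1 W by (meson less_imp_le order_trans sum_nonneg zero_le_divide_1_iff)
  have "W k * (\<Sum>p\<in>P. A p * B (\<psi> k p))\<^sup>2 \<le>
      2 * c * \<sigma> * (\<Sum>p\<in>P. W p * (A p)\<^sup>2 * (W (\<psi> k p) * (B (\<psi> k p))\<^sup>2))" if k: "k \<in> K" for k
  proof -
    let ?s = "\<lambda>p. sqrt (W p * W (\<psi> k p))"
    have s: "0 < ?s p" for p using W by simp
    have "(\<Sum>p\<in>P. A p * B (\<psi> k p))\<^sup>2 = (\<Sum>p\<in>P. (1 / ?s p) * (?s p * (A p * B (\<psi> k p))))\<^sup>2"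
      by (rule arg_cong[where f="\<lambda>x. x\<^sup>2"], rule sum.cong[OF refl]) (use s in \<open>simp add: less_le\<close>)
    also have "\<dots> \<le> (\<Sum>p\<in>P. (1 / ?s p)\<^sup>2) * (\<Sum>p\<in>P. (?s p * (A p * B (\<psi> k p)))\<^sup>2)"
      by (rule Cauchy_Schwarz_ineq_sum)
    also have "(\<Sum>p\<in>P. (?s p * (A p * B (\<psi> k p)))\<^sup>2) = (\<Sum>p\<in>P. W p * (A p)\<^sup>2 * (W (\<psi> k p) * (B (\<psi> k p))\<^sup>2))"
      using W by (intro sum.cong) (auto simp: power_mult_distrib less_imp_le)
    also have "(\<Sum>p\<in>P. (1 / ?s p)\<^sup>2) = (\<Sum>p\<in>P. 1 / (W p * W (\<psi> k p)))"
      using W by (intro sum.cong) (auto simp: power_divide less_imp_le)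
    finally have 1: "(\<Sum>p\<in>P. A p * B (\<psi> k p))\<^sup>2 \<le> (\<Sum>p\<in>P. 1 / (W p * W (\<psi> k p))) *
      (\<Sum>p\<in>P. W p * (A p)\<^sup>2 * (W (\<psi> k p) * (B (\<psi> k p))\<^sup>2))" (is "_ \<le> _ * ?R") .
    have R: "0 \<le> ?R" using W by (intro sum_nonneg mult_nonneg_nonneg) (auto simp: less_imp_le)
    have "W k * (\<Sum>p\<in>P. 1 / (W p * W (\<psi> k p))) = (\<Sum>p\<in>P. W k / (W p * W (\<psi> k p)))"
      by (simp add: sum_distrib_left)
    also have "\<dots> \<le> (\<Sum>p\<in>P. c * (1 / W (\<psi> k p) + 1 / W p))"
    proof (rule sum_mono)
      fix p assume p: "p \<in> P"
      have "W k / (W p * W (\<psi> k p)) \<le> c * (W p + W (\<psi> k p)) / (W p * W (\<psi> k p))"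
        using sub[OF k p] W by (intro divide_right_mono) (auto simp: less_imp_le)
      also have "\<dots> = c * (1 / W (\<psi> k p) + 1 / W p)"
        using W[of p] W[of "\<psi> k p"] by (simp add: field_simps)
      finally show "W k / (W p * W (\<psi> k p)) \<le> c * (1 / W (\<psi> k p) + 1 / W p)" .
    qed
    also have "\<dots> = c * ((\<Sum>p\<in>P. 1 / W (\<psi> k p)) + (\<Sum>p\<in>P. 1 / W p))"
      by (simp add: sum.distrib flip: sum_distrib_left)
    also have "\<dots> \<le> c * (\<sigma> + \<sigma>)" using \<sigma>1 \<sigma>2[OF k] c by (intro mult_left_mono add_mono)
    finally have 2: "W k * (\<Sum>p\<in>P. 1 / (W p * W (\<psi> k p))) \<le> 2 * c * \<sigma>" by simp
    have "W k * (\<Sum>p\<in>P. A p * B (\<psi> k p))\<^sup>2 \<le> W k * (\<Sum>p\<in>P. 1 / (W p * W (\<psi> k p))) * ?R"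
      using 1 W[of k] by (simp add: mult.assoc)
    also have "\<dots> \<le> 2 * c * \<sigma> * ?R" using 2 R by (rule mult_right_mono)
    finally show ?thesis .
  qed
  then have "(\<Sum>k\<in>K. W k * (\<Sum>p\<in>P. A p * B (\<psi> k p))\<^sup>2) \<le>
     (\<Sum>k\<in>K. 2 * c * \<sigma> * (\<Sum>p\<in>P. W p * (A p)\<^sup>2 * (W (\<psi> k p) * (B (\<psi> k p))\<^sup>2)))"
    by (rule sum_mono)
  also have "\<dots> = 2 * c * \<sigma> * (\<Sum>p\<in>P. W p * (A p)\<^sup>2 * (\<Sum>k\<in>K. W (\<psi> k p) * (B (\<psi> k p))\<^sup>2))"
    by (simp add: sum_distrib_left sum.swap[of _ P K])
  also have "\<dots> \<le> 2 * c * \<sigma> * (\<Sum>p\<in>P. W p * (A p)\<^sup>2 * Y)"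
    using Y W c \<sigma>0 by (intro mult_left_mono sum_mono) (auto simp: less_imp_le)
  also have "\<dots> = 2 * c * \<sigma> * ((\<Sum>p\<in>P. W p * (A p)\<^sup>2) * Y)" by (simp add: sum_distrib_right)
  also have "\<dots> \<le> 2 * c * \<sigma> * (X * Y)"
    using X \<open>0 \<le> Y\<close> c \<sigma>0 by (intro mult_left_mono mult_right_mono) auto
  finally show ?thesis by (simp add: mult.assoc)
qed

lemma two_mult_le_weighted:
  fixes x y \<eta> :: real
  assumes "0 < \<eta>" shows "2 * x * y \<le> \<eta> * x\<^sup>2 + y\<^sup>2 / \<eta>"
proof -
  have "0 \<le> (\<eta> * x - y)\<^sup>2 / \<eta>" using assms by simp
  also have "\<dots> = \<eta> * x\<^sup>2 + y\<^sup>2 / \<eta> - 2 * x * y"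
    using assms by (simp add: power2_eq_square field_simps)
  finally show ?thesis by simp
qed

text \<open>The weight is the symbol of \<open>(1 - \<Delta>)\<^sup>2\<close>; the dissipation \<open>lam\<^sup>2 w \<bar>y\<bar>\<^sup>2\<close> absorbs the factor
  \<open>lam\<close> in front of the nonlinearity, and it also absorbs \<open>w\<^sup>2 \<bar>y\<bar>\<^sup>2\<close>, so that the residual
  \<open>R\<close> enters without weight.\<close>

lemma mode_term_bound:
  fixes y G R :: complex and lam \<delta> w :: real
  assumes "0 < \<delta>" and "0 \<le> lam" and w: "w = (1 + lam)\<^sup>2"
  shows "2 * w * Re (cnj y * (lam * G + R)) \<le> 2 * \<delta> * lam\<^sup>2 * w * (norm y)\<^sup>2
     + \<delta> * w * (norm y)\<^sup>2 + w * (norm G)\<^sup>2 / \<delta> + 2 * (norm R)\<^sup>2 / \<delta>"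
proof -
  have w0: "0 \<le> w" by (simp add: w)
  have w2: "w \<le> 2 + 2 * lam\<^sup>2" unfolding w using sum_squares_bound[of 1 lam] by (simp add: power2_sum)
  have "Re (cnj y * (lam * G + R)) \<le> norm (cnj y * (lam * G + R))" by (rule complex_Re_le_cmod)
  also have "\<dots> = norm y * norm (lam * G + R)" by (simp add: norm_mult)
  also have "\<dots> \<le> norm y * (lam * norm G + norm R)"
    using assms norm_triangle_ineq[of "lam * G" R] by (intro mult_left_mono) (auto simp: norm_mult)
  finally have "2 * w * Re (cnj y * (lam * G + R)) \<le> 2 * w * (norm y * (lam * norm G + norm R))"
    using w0 by (intro mult_left_mono) auto
  also have "\<dots> = w * (2 * (lam * norm y) * norm G) + 2 * (w * norm y) * norm R" by (simp add: algebra_simps)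
  \<comment> \<open>The second product is split with \<open>\<delta> / 2\<close> because
    \<open>w2\<close> costs a factor 2 afterwards. Both products then contribute the same multiple
    of \<open>lam\<^sup>2 * w\<close>, in total what the dissipation offers.\<close>
  also have "\<dots> \<le> w * (\<delta> * (lam * norm y)\<^sup>2 + (norm G)\<^sup>2 / \<delta>) + ((\<delta> / 2) * (w * norm y)\<^sup>2 + (norm R)\<^sup>2 / (\<delta> / 2))"
    using assms w0 by (intro add_mono mult_left_mono two_mult_le_weighted) auto
  also have "(\<delta> / 2) * (w * norm y)\<^sup>2 = (\<delta> / 2) * w * (norm y)\<^sup>2 * w" by (simp add: power2_eq_square)
  also have "\<dots> \<le> (\<delta> / 2) * w * (norm y)\<^sup>2 * (2 + 2 * lam\<^sup>2)"
    using w2 w0 assms by (intro mult_left_mono) auto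
  also have "\<dots> = \<delta> * w * (norm y)\<^sup>2 + \<delta> * lam\<^sup>2 * w * (norm y)\<^sup>2" by (simp add: algebra_simps)
  finally have "2 * w * Re (cnj y * (lam * G + R)) \<le>
     w * (\<delta> * (lam * norm y)\<^sup>2 + (norm G)\<^sup>2 / \<delta>)
     + (\<delta> * w * (norm y)\<^sup>2 + \<delta> * lam\<^sup>2 * w * (norm y)\<^sup>2 + (norm R)\<^sup>2 / (\<delta> / 2))" by simp
  also have "\<dots> = 2 * \<delta> * lam\<^sup>2 * w * (norm y)\<^sup>2
     + \<delta> * w * (norm y)\<^sup>2 + w * (norm G)\<^sup>2 / \<delta> + 2 * (norm R)\<^sup>2 / \<delta>"
    by (simp add: algebra_simps power_mult_distrib)
  finally show ?thesis .
qed

text \<open>Since \<open>k\<close> is arbitrary, coercivity of the leading block of size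
  \<open>k\<close> controls the error after each stage. \<open>G\<close> and \<open>R\<close>
  already contain the combination by \<open>b\<close> of nonlinear differences and residuals; only
  the dissipative term keeps \<open>b\<close> explicit, because its sign comes from
  coercivity.\<close>

lemma mode_energy:
  fixes e y G R :: "nat \<Rightarrow> complex" and b :: "nat \<Rightarrow> nat \<Rightarrow> real"
    and \<epsilon> \<beta> lam \<tau> \<mu> w :: real
  assumes "0 < \<epsilon>" and "0 < \<beta>" and "0 \<le> lam" and "0 \<le> \<tau>" and \<mu>: "\<epsilon>\<^sup>2 * lam\<^sup>2 \<le> \<mu>"
    and w: "w = (1 + lam)\<^sup>2"
    and y: "\<And>i. y i = (e i + e (Suc i)) / 2"
    and eq: "\<And>i. i < k \<Longrightarrow> e (Suc i) - e i = \<tau> * (\<Sum>j<k. b i j * (- \<mu> * y j)) + \<tau> * (lam * G i + R i)"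
    and coer: "\<And>x. \<beta> * (\<Sum>i<k. (x i)\<^sup>2) \<le> (\<Sum>i<k. \<Sum>j<k. b i j * x i * x j)"
  shows "w * (norm (e k))\<^sup>2 \<le> w * (norm (e 0))\<^sup>2 + \<tau> * (\<epsilon>\<^sup>2 * \<beta> * (\<Sum>i\<le>k. w * (norm (e i))\<^sup>2)
     + (\<Sum>i<k. w * (norm (G i))\<^sup>2) / (\<epsilon>\<^sup>2 * \<beta>) + 2 * (\<Sum>i<k. (norm (R i))\<^sup>2) / (\<epsilon>\<^sup>2 * \<beta>))"
proof -
  \<comment> \<open>With this value the term \<open>2 * \<delta> * lam\<^sup>2 * w\<close> of
    \<open>mode_term_bound\<close> is exactly what the dissipation
    \<open>2 * w * (\<mu> * Q)\<close> can pay for.\<close>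
  define \<delta> where "\<delta> = \<epsilon>\<^sup>2 * \<beta>"
  have \<delta>: "0 < \<delta>" using assms by (simp add: \<delta>_def)
  have w0: "0 \<le> w" by (simp add: w)
  \<comment> \<open>This identity is the reason for testing with the midpoint: the squared norms
    telescope without a remainder.\<close>
  have tel: "(norm (e (Suc i)))\<^sup>2 - (norm (e i))\<^sup>2 = 2 * Re (cnj (y i) * (e (Suc i) - e i))" for i
    unfolding y cmod_power2 by (simp add: power2_eq_square algebra_simps)
  define Q where "Q = (\<Sum>i<k. \<Sum>j<k. b i j * Re (cnj (y i) * y j))"
  \<comment> \<open>The error is complex while coercivity is real: real and imaginary parts give two
    separate real forms.\<close>
  have "Q = (\<Sum>i<k. \<Sum>j<k. b i j * Re (y i) * Re (y j)) + (\<Sum>i<k. \<Sum>j<k. b i j * Im (y i) * Im (y j))"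
    unfolding Q_def by (simp add: sum.distrib[symmetric] algebra_simps)
  then have Q: "\<beta> * (\<Sum>i<k. (norm (y i))\<^sup>2) \<le> Q"
    using coer[of "\<lambda>i. Re (y i)"] coer[of "\<lambda>i. Im (y i)"]
    by (simp add: cmod_power2 sum.distrib algebra_simps)
  have "0 \<le> \<beta> * (\<Sum>i<k. (norm (y i))\<^sup>2)" using assms by (intro mult_nonneg_nonneg sum_nonneg) auto
  with Q have Q0: "0 \<le> Q" by linarith
  have step1: "2 * Re (cnj (y i) * (e (Suc i) - e i)) =
      - 2 * \<tau> * \<mu> * (\<Sum>j<k. b i j * Re (cnj (y i) * y j)) + 2 * \<tau> * Re (cnj (y i) * (lam * G i + R i))"
    if "i < k" for i
  proof -
    have "cnj (y i) * (e (Suc i) - e i) =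
      of_real (- \<tau> * \<mu>) * (\<Sum>j<k. of_real (b i j) * (cnj (y i) * y j)) + of_real \<tau> * (cnj (y i) * (lam * G i + R i))"
      unfolding eq[OF that] by (simp add: algebra_simps sum_distrib_left sum_negf)
    then show ?thesis by (simp add: sum_distrib_left algebra_simps)
  qed
  have "(norm (e k))\<^sup>2 - (norm (e 0))\<^sup>2 = (\<Sum>i<k. (norm (e (Suc i)))\<^sup>2 - (norm (e i))\<^sup>2)"
    by (rule sum_lessThan_telescope[symmetric])
  also have "\<dots> = (\<Sum>i<k. - 2 * \<tau> * \<mu> * (\<Sum>j<k. b i j * Re (cnj (y i) * y j)) + 2 * \<tau> * Re (cnj (y i) * (lam * G i + R i)))"
    unfolding tel by (intro sum.cong refl step1) auto
  also have "\<dots> = - 2 * \<tau> * \<mu> * Q + 2 * \<tau> * (\<Sum>i<k. Re (cnj (y i) * (lam * G i + R i)))"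
    unfolding Q_def by (simp only: sum.distrib sum_distrib_left)
  finally have main: "(norm (e k))\<^sup>2 = (norm (e 0))\<^sup>2 - 2 * \<tau> * \<mu> * Q + 2 * \<tau> * (\<Sum>i<k. Re (cnj (y i) * (lam * G i + R i)))"
    by simp
  have "\<epsilon>\<^sup>2 * lam\<^sup>2 * (\<beta> * (\<Sum>i<k. (norm (y i))\<^sup>2)) \<le> \<epsilon>\<^sup>2 * lam\<^sup>2 * Q"
    using Q by (intro mult_left_mono) auto
  also have "\<dots> \<le> \<mu> * Q" using \<mu> Q0 by (rule mult_right_mono)
  finally have diss: "\<delta> * lam\<^sup>2 * (\<Sum>i<k. (norm (y i))\<^sup>2) \<le> \<mu> * Q" by (simp add: \<delta>_def algebra_simps)
  have "w * (2 * (\<Sum>i<k. Re (cnj (y i) * (lam * G i + R i)))) = (\<Sum>i<k. 2 * w * Re (cnj (y i) * (lam * G i + R i)))"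
    by (simp add: sum_distrib_left mult_ac)
  also have "\<dots> \<le> (\<Sum>i<k. 2 * \<delta> * lam\<^sup>2 * w * (norm (y i))\<^sup>2
     + \<delta> * w * (norm (y i))\<^sup>2 + w * (norm (G i))\<^sup>2 / \<delta> + 2 * (norm (R i))\<^sup>2 / \<delta>)"
    by (intro sum_mono mode_term_bound[OF \<delta> \<open>0 \<le> lam\<close> w])
  also have "\<dots> = 2 * w * (\<delta> * lam\<^sup>2 * (\<Sum>i<k. (norm (y i))\<^sup>2)) + \<delta> * w * (\<Sum>i<k. (norm (y i))\<^sup>2)
     + (\<Sum>i<k. w * (norm (G i))\<^sup>2) / \<delta> + 2 * (\<Sum>i<k. (norm (R i))\<^sup>2) / \<delta>"
    by (simp add: sum.distrib sum_distrib_left sum_divide_distrib mult_ac)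
  also have "\<dots> \<le> 2 * w * (\<mu> * Q) + \<delta> * w * (\<Sum>i<k. (norm (y i))\<^sup>2)
     + (\<Sum>i<k. w * (norm (G i))\<^sup>2) / \<delta> + 2 * (\<Sum>i<k. (norm (R i))\<^sup>2) / \<delta>"
    using diss w0 by (intro add_right_mono mult_left_mono) auto
  finally have A: "w * (2 * (\<Sum>i<k. Re (cnj (y i) * (lam * G i + R i)))) - 2 * w * (\<mu> * Q) \<le>
     \<delta> * w * (\<Sum>i<k. (norm (y i))\<^sup>2) + (\<Sum>i<k. w * (norm (G i))\<^sup>2) / \<delta> + 2 * (\<Sum>i<k. (norm (R i))\<^sup>2) / \<delta>"
    by simp
  have "(\<Sum>i<k. (norm (y i))\<^sup>2) \<le> (\<Sum>i<k. ((norm (e i))\<^sup>2 + (norm (e (Suc i)))\<^sup>2) / 2)"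
  proof (rule sum_mono)
    fix i
    have "norm (y i) \<le> (norm (e i) + norm (e (Suc i))) / 2"
      unfolding y using norm_triangle_ineq[of "e i" "e (Suc i)"] by (simp add: norm_divide)
    then have "(norm (y i))\<^sup>2 \<le> ((norm (e i) + norm (e (Suc i))) / 2)\<^sup>2" by (rule power_mono) simp
    also have "\<dots> \<le> ((norm (e i))\<^sup>2 + (norm (e (Suc i)))\<^sup>2) / 2"
      using sum_squares_bound[of "norm (e i)" "norm (e (Suc i))"]
      by (simp add: power_divide power2_sum)
    finally show "(norm (y i))\<^sup>2 \<le> ((norm (e i))\<^sup>2 + (norm (e (Suc i)))\<^sup>2) / 2" .
  qed
  also have "\<dots> = (\<Sum>i<k. (norm (e i))\<^sup>2) / 2 + (\<Sum>i<k. (norm (e (Suc i)))\<^sup>2) / 2"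
    by (simp add: sum.distrib add_divide_distrib sum_divide_distrib)
  also have "\<dots> \<le> (\<Sum>i\<le>k. (norm (e i))\<^sup>2)"
  proof -
    have "(\<Sum>i<k. (norm (e i))\<^sup>2) \<le> (\<Sum>i\<le>k. (norm (e i))\<^sup>2)" by (intro sum_mono2) auto
    moreover have "(\<Sum>i<k. (norm (e (Suc i)))\<^sup>2) \<le> (\<Sum>i\<le>k. (norm (e i))\<^sup>2)"
      unfolding lessThan_Suc_atMost[symmetric] sum.lessThan_Suc_shift by simp
    ultimately show ?thesis by simp
  qed
  finally have ysum: "(\<Sum>i<k. (norm (y i))\<^sup>2) \<le> (\<Sum>i\<le>k. (norm (e i))\<^sup>2)" .
  have "\<delta> * w * (\<Sum>i<k. (norm (y i))\<^sup>2) \<le> \<delta> * w * (\<Sum>i\<le>k. (norm (e i))\<^sup>2)"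
    using \<delta> w0 by (intro mult_left_mono[OF ysum]) auto
  also have "\<dots> = \<delta> * (\<Sum>i\<le>k. w * (norm (e i))\<^sup>2)" by (simp only: sum_distrib_left mult.assoc)
  finally have B: "w * (2 * (\<Sum>i<k. Re (cnj (y i) * (lam * G i + R i)))) - 2 * w * (\<mu> * Q) \<le>
     \<delta> * (\<Sum>i\<le>k. w * (norm (e i))\<^sup>2) + (\<Sum>i<k. w * (norm (G i))\<^sup>2) / \<delta> + 2 * (\<Sum>i<k. (norm (R i))\<^sup>2) / \<delta>"
    using A by linarith
  have "w * (norm (e k))\<^sup>2 = w * (norm (e 0))\<^sup>2 +
     \<tau> * (w * (2 * (\<Sum>i<k. Re (cnj (y i) * (lam * G i + R i)))) - 2 * w * (\<mu> * Q))"
    unfolding main by (simp add: algebra_simps)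
  also have "\<dots> \<le> w * (norm (e 0))\<^sup>2 + \<tau> * (\<delta> * (\<Sum>i\<le>k. w * (norm (e i))\<^sup>2) + (\<Sum>i<k. w * (norm (G i))\<^sup>2) / \<delta> + 2 * (\<Sum>i<k. (norm (R i))\<^sup>2) / \<delta>)"
    by (intro add_left_mono mult_left_mono[OF B] \<open>0 \<le> \<tau>\<close>)
  finally show ?thesis by (simp add: \<delta>_def)
qed

text \<open>The recursion is implicit: \<open>E (Suc k)\<close> also stands on the right, and
  \<open>C * \<tau> \<le> 1 / 2\<close> moves it to the left. It holds only while the earlier stages
  stay below 1, which \<open>init\<close> guarantees inductively. The ratio 4 is chosen so that the
  geometric sum over earlier stages and the initial terms fit into the next power.\<close>

lemma stage_growth:
  fixes E :: "nat \<Rightarrow> real" and \<tau> C \<delta> :: real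
  assumes nn: "\<And>i. 0 \<le> E i" and "0 \<le> \<delta>" and "0 \<le> C" and "0 \<le> \<tau>" and small: "C * \<tau> \<le> 1 / 2"
    and rec: "\<And>k. k < n \<Longrightarrow> (\<forall>i\<le>k. E i \<le> 1) \<Longrightarrow> E (Suc k) \<le> E 0 + \<tau> * (C * ((\<Sum>i\<le>Suc k. E i) + \<delta>))"
    and init: "4 ^ n * (E 0 + \<delta>) \<le> 1"
  shows "(\<forall>k\<le>n. E k \<le> 4 ^ k * (E 0 + \<delta>)) \<and> E n \<le> E 0 + \<tau> * (C * (n + 2) * 4 ^ n * (E 0 + \<delta>))"
proof -
  define X where "X = E 0 + \<delta>"
  have X: "0 \<le> X" using nn assms by (simp add: X_def)
  have mono: "4 ^ i * X \<le> 4 ^ n * X" if "i \<le> n" for i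
    using that X by (intro mult_right_mono power_increasing) auto
  have geo: "(\<Sum>i\<le>k. (4::real) ^ i) \<le> 2 * 4 ^ k" for k
  proof (induction k)
    case (Suc k)
    then show ?case unfolding sum.atMost_Suc power_Suc using zero_le_power[of "4::real" k] by linarith
  qed simp
  have bound: "E k \<le> 4 ^ k * X" if "k \<le> n" for k
    using that
  proof (induction k rule: less_induct)
    case (less k)
    show ?case
    proof (cases k)
      case 0
      then show ?thesis using assms by (simp add: X_def)
    next
      case (Suc l)
      have IH: "E i \<le> 4 ^ i * X" if "i \<le> l" for i using less that Suc by auto
      have "E i \<le> 1" if "i \<le> l" for i
        using IH[OF that] mono[of i] init that less.prems Suc unfolding X_def by linarith
      then have "E k \<le> E 0 + \<tau> * (C * ((\<Sum>i\<le>Suc l. E i) + \<delta>))"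
        using rec[of l] less.prems Suc by auto
      also have "\<dots> = E 0 + (C * \<tau>) * ((\<Sum>i\<le>l. E i) + E k + \<delta>)" by (simp add: Suc algebra_simps)
      also have "\<dots> \<le> E 0 + (1 / 2) * ((\<Sum>i\<le>l. E i) + E k + \<delta>)"
        using small nn assms by (intro add_left_mono mult_right_mono add_nonneg_nonneg sum_nonneg) auto
      finally have "E k \<le> 2 * E 0 + (\<Sum>i\<le>l. E i) + \<delta>"
        by (simp add: field_simps)
      also have "\<dots> \<le> 2 * X + (\<Sum>i\<le>l. 4 ^ i * X)"
        using IH assms sum_mono[of "{..l}" E "\<lambda>i. 4 ^ i * X"] by (simp add: X_def)
      also have "\<dots> = 2 * X + (\<Sum>i\<le>l. 4 ^ i) * X" by (simp add: sum_distrib_right)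
      also have "\<dots> \<le> 2 * X + 2 * 4 ^ l * X" using geo X by (intro add_left_mono mult_right_mono) auto
      also have "\<dots> \<le> 2 * 4 ^ l * X + 2 * 4 ^ l * X"
        using X one_le_power[of "4::real" l] by (intro add_right_mono mult_right_mono) auto
      finally show ?thesis by (simp add: Suc mult_ac)
    qed
  qed
  \<comment> \<open>Inserting the crude bounds once more into the recursion restores the factor 1 in
    front of \<open>E 0\<close>. A factor \<open>4 ^ n\<close> for each time step could not be
    iterated.\<close>
  moreover have "E n \<le> E 0 + \<tau> * (C * (n + 2) * 4 ^ n * X)"
  proof (cases n)
    case 0
    then show ?thesis using assms X by simp
  next
    case (Suc l)
    have "E i \<le> 1" if "i \<le> l" for i
      using bound[of i] mono[of i] init that Suc unfolding X_def by simp
    then have "E n \<le> E 0 + \<tau> * (C * ((\<Sum>i\<le>n. E i) + \<delta>))" using rec[of l] Suc by auto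
    also have "\<dots> \<le> E 0 + \<tau> * (C * ((\<Sum>i\<le>n. 4 ^ n * X) + 4 ^ n * X))"
    proof -
      have "(\<Sum>i\<le>n. E i) \<le> (\<Sum>i\<le>n. 4 ^ n * X)"
        using bound mono by (intro sum_mono) (auto intro: order_trans)
      moreover have "\<delta> \<le> 4 ^ n * X"
        using mono[of 0] nn[of 0] unfolding X_def by simp
      ultimately show ?thesis using assms by (intro add_left_mono mult_left_mono add_mono) auto
    qed
    finally show ?thesis by (simp add: algebra_simps)
  qed
  ultimately show ?thesis by (simp add: X_def)
qed

text \<open>A Gronwall argument for variable steps in which the recursion is available only below
  \<open>\<theta>\<close>. The bound being proved keeps \<open>X n\<close> below
  \<open>\<theta>\<close> by \<open>init\<close>, so the recursion always applies; the growth
  factors multiply to at most an exponential of the elapsed time, whatever the number of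
  steps.\<close>

lemma discrete_growth:
  fixes X t :: "nat \<Rightarrow> real" and C \<theta> :: real
  assumes "0 \<le> C" and t: "\<And>n. n < N \<Longrightarrow> t n \<le> t (Suc n)"
    and rec: "\<And>n. n < N \<Longrightarrow> X n \<le> \<theta> \<Longrightarrow> X (Suc n) \<le> (1 + C * (t (Suc n) - t n)) * X n"
    and "0 \<le> X 0" and init: "exp (C * (t N - t 0)) * X 0 \<le> \<theta>" and nn: "\<And>n. n \<le> N \<Longrightarrow> 0 \<le> X n"
  shows "n \<le> N \<Longrightarrow> X n \<le> exp (C * (t n - t 0)) * X 0"
proof (induction n)
  case 0
  then show ?case by simp
next
  case (Suc n)
  have tm: "i \<le> j \<Longrightarrow> j \<le> N \<Longrightarrow> t i \<le> t j" for i j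
    by (induction j rule: dec_induct) (use t in \<open>auto intro: order_trans Suc_leD\<close>)
  have IH: "X n \<le> exp (C * (t n - t 0)) * X 0" using Suc by simp
  also have "\<dots> \<le> exp (C * (t N - t 0)) * X 0"
    using assms tm[of n N] Suc.prems by (intro mult_right_mono) (auto intro!: mult_left_mono)
  finally have "X n \<le> \<theta>" using init by simp
  then have "X (Suc n) \<le> (1 + C * (t (Suc n) - t n)) * X n" using rec Suc.prems by simp
  also have "\<dots> \<le> exp (C * (t (Suc n) - t n)) * (exp (C * (t n - t 0)) * X 0)"
    using IH nn[of n] Suc.prems by (intro mult_mono exp_ge_add_one_self) auto
  also have "\<dots> = exp (C * (t (Suc n) - t 0)) * X 0"
    by (simp add: algebra_simps flip: exp_add)
  finally show ?case .
qed

section \<open>Fourier modes and summable frequency weights\<close>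

lemma emode_add: "emode L (p + q) z = emode L p z * emode L q z"
  by (simp add: emode_def cis_mult algebra_simps)

lemma emode_uminus: "emode L (- p) z = cnj (emode L p z)"
  by (simp add: emode_def cis_cnj algebra_simps)

lemma emode_diff: "emode L (p - q) z = emode L p z * cnj (emode L q z)"
  using emode_add[of L p "- q"] by (simp add: emode_uminus)

lemma norm_emode [simp]: "norm (emode L k z) = 1"
  by (simp add: emode_def)

lemma emode_zero [simp]: "emode L 0 z = 1"
  by (simp add: emode_def)

lemma freq2_nonneg [simp]: "0 \<le> freq2 L k"
  by (simp add: freq2_def)

lemma freq2_uminus [simp]: "freq2 L (- k) = freq2 L k"
  by (simp add: freq2_def)

lemma one_add_freq2_pos [simp]: "0 < 1 + freq2 L k"
  using freq2_nonneg[of L k] by linarith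

lemma one_add_freq2_neq_0 [simp]: "1 + freq2 L k \<noteq> 0"
  using one_add_freq2_pos[of L k] by linarith

text \<open>The larger of \<open>x\<close> and \<open>y\<close> carries the estimate:
  \<open>1 + z \<le> 4 * (1 + max x y)\<close>. With \<open>freq2_add_le\<close> this supplies the
  hypothesis \<open>sub\<close> of the convolution bound, with \<open>c = 4 ^ q\<close>.\<close>

lemma weight_subadditive:
  fixes x y z :: real
  assumes "0 \<le> x" "0 \<le> y" "0 \<le> z" and "z \<le> 2 * x + 2 * y"
  shows "(1 + z) ^ q \<le> 4 ^ q * ((1 + x) ^ q + (1 + y) ^ q)"
proof -
  let ?m = "max x y"
  have "(1 + z) ^ q \<le> (4 * (1 + ?m)) ^ q" using assms by (intro power_mono) (auto simp: max_def)
  also have "\<dots> = 4 ^ q * (1 + ?m) ^ q" by (rule power_mult_distrib)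
  also have "(1 + ?m) ^ q \<le> (1 + x) ^ q + (1 + y) ^ q" using assms by (auto simp: max_def)
  finally show ?thesis by simp
qed

lemma freq2_add_le: "freq2 L (p + r) \<le> 2 * freq2 L p + 2 * freq2 L r"
proof -
  have *: "(a + b)\<^sup>2 \<le> 2 * a\<^sup>2 + 2 * b\<^sup>2" for a b :: real
    using sum_squares_bound[of a b] by (simp add: power2_sum)
  have "freq2 L (p + r) \<le> (2 * pi / L)\<^sup>2 * ((2 * (of_int (fst p))\<^sup>2 + 2 * (of_int (fst r))\<^sup>2) + (2 * (of_int (snd p))\<^sup>2 + 2 * (of_int (snd r))\<^sup>2))"
    unfolding freq2_def using *[of "of_int (fst p)" "of_int (fst r)"] *[of "of_int (snd p)" "of_int (snd r)"]
    by (intro mult_left_mono add_mono) auto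
  then show ?thesis by (simp add: freq2_def algebra_simps)
qed

text \<open>The induction needs the sharper bound \<open>5 - 4 / (n + 1)\<close>: the two new terms
  are together at most \<open>4 / (x * (x + 1))\<close>, which telescopes, and 5 makes the case
  \<open>n = 0\<close> an equality.\<close>

lemma sum_inverse_square_int_bound: "(\<Sum>k\<in>{-int n..int n}. 1 / (1 + (real_of_int k)\<^sup>2)) \<le> 5"
proof -
  have "(\<Sum>k\<in>{-int n..int n}. 1 / (1 + (real_of_int k)\<^sup>2)) \<le> 5 - 4 / (real n + 1)"
  proof (induction n)
    case 0
    then show ?case by simp
  next
    case (Suc n)
    define x where "x = real n + 1"
    have x: "1 \<le> x" by (simp add: x_def)
    have "{-int (Suc n)..int (Suc n)} = insert (int (Suc n)) (insert (- int (Suc n)) {-int n..int n})" by auto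
    then have "(\<Sum>k\<in>{-int (Suc n)..int (Suc n)}. 1 / (1 + (real_of_int k)\<^sup>2)) =
       2 / (1 + x\<^sup>2) + (\<Sum>k\<in>{-int n..int n}. 1 / (1 + (real_of_int k)\<^sup>2))"
      by (simp add: x_def power2_eq_square algebra_simps)
    moreover have "2 / (1 + x\<^sup>2) \<le> 4 / (x * (x + 1))"
    proof -
      have "2 * (x * (x + 1)) \<le> 4 * (1 + x\<^sup>2)"
      proof -
        have "2 * (x * (x + 1)) = 2 * x\<^sup>2 + 2 * x * 1" by (simp add: power2_eq_square algebra_simps)
        also have "\<dots> \<le> 2 * x\<^sup>2 + (x\<^sup>2 + 1\<^sup>2)" by (intro add_left_mono sum_squares_bound)
        also have "\<dots> \<le> 4 * (1 + x\<^sup>2)" by simp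
        finally show ?thesis .
      qed
      moreover have "0 < x * (x + 1)" "0 < 1 + x\<^sup>2" using x by (auto simp: add_pos_nonneg)
      ultimately show ?thesis by (simp add: divide_simps)
    qed
    moreover have "4 / (x * (x + 1)) = 4 / x - 4 / (x + 1)" using x by (simp add: field_simps)
    ultimately show ?case using Suc by (simp add: x_def)
  qed
  moreover have "0 \<le> 4 / (real n + 1)" by simp
  ultimately show ?thesis by linarith
qed

text \<open>Since \<open>(1 + x) * (1 + y) \<le> (1 + (x + y))\<^sup>2\<close> for nonnegative
  \<open>x\<close> and \<open>y\<close>, the square splits the lattice sum into a product of two
  one-dimensional sums, each at most 5. The number \<open>\<alpha>\<close> compensates the scaling
  of the frequencies by \<open>2 * pi / L\<close>.\<close>

lemma ex_weight_sum_bound: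
  assumes "0 < L"
  shows "\<exists>\<sigma>>0. \<forall>K. finite K \<longrightarrow> (\<Sum>k\<in>K. 1 / (1 + freq2 L k) ^ 2) \<le> \<sigma>"
proof -
  define \<alpha> where "\<alpha> = min 1 ((2 * pi / L)\<^sup>2)"
  have \<alpha>: "0 < \<alpha>" "\<alpha> \<le> 1" "\<alpha> \<le> (2 * pi / L)\<^sup>2" using assms by (auto simp: \<alpha>_def)
  let ?f = "\<lambda>k. 1 / (1 + (real_of_int k)\<^sup>2)"
  have le: "1 / (1 + freq2 L k) ^ 2 \<le> 1 / \<alpha>\<^sup>2 * (?f (fst k) * ?f (snd k))" for k
  proof -
    let ?x = "(real_of_int (fst k))\<^sup>2" and ?y = "(real_of_int (snd k))\<^sup>2"
    have "\<alpha> * (1 + (?x + ?y)) \<le> 1 + (2 * pi / L)\<^sup>2 * (?x + ?y)"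
      using \<alpha> mult_right_mono[OF \<alpha>(3), of "?x + ?y"] by (simp add: distrib_left)
    then have "(\<alpha> * (1 + (?x + ?y)))\<^sup>2 \<le> (1 + freq2 L k)\<^sup>2"
      unfolding freq2_def using \<alpha> by (intro power_mono) auto
    moreover have "(1 + ?x) * (1 + ?y) \<le> (1 + (?x + ?y))\<^sup>2"
    proof -
      have "(1 + (?x + ?y))\<^sup>2 = (1 + ?x) * (1 + ?y) + (?x + ?y + ?x\<^sup>2 + ?y\<^sup>2 + ?x * ?y)"
        by (simp add: power2_eq_square algebra_simps)
      then show ?thesis by (simp add: add_nonneg_nonneg)
    qed
    then have "\<alpha>\<^sup>2 * ((1 + ?x) * (1 + ?y)) \<le> (\<alpha> * (1 + (?x + ?y)))\<^sup>2"
      by (simp add: power_mult_distrib mult_left_mono)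
    ultimately have "\<alpha>\<^sup>2 * ((1 + ?x) * (1 + ?y)) \<le> (1 + freq2 L k)\<^sup>2" by linarith
    moreover have "0 < \<alpha>\<^sup>2 * ((1 + ?x) * (1 + ?y))" using \<alpha> by (simp add: add_pos_nonneg)
    ultimately have "1 / (1 + freq2 L k) ^ 2 \<le> 1 / (\<alpha>\<^sup>2 * ((1 + ?x) * (1 + ?y)))"
      by (intro frac_le) auto
    then show ?thesis by simp
  qed
  have "(\<Sum>k\<in>K. 1 / (1 + freq2 L k) ^ 2) \<le> 25 / \<alpha>\<^sup>2" if "finite K" for K
  proof -
    obtain n where n: "K \<subseteq> {-int n..int n} \<times> {-int n..int n}"
    proof -
      define n where "n = Max (insert 0 ((\<lambda>k. nat \<bar>fst k\<bar> + nat \<bar>snd k\<bar>) ` K))"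
      have "nat \<bar>fst k\<bar> + nat \<bar>snd k\<bar> \<le> n" if "k \<in> K" for k
        unfolding n_def using \<open>finite K\<close> that by (intro Max_ge) auto
      then have "K \<subseteq> {-int n..int n} \<times> {-int n..int n}" by fastforce
      then show ?thesis by (rule that)
    qed
    have "(\<Sum>k\<in>K. 1 / (1 + freq2 L k) ^ 2) \<le> (\<Sum>k\<in>K. 1 / \<alpha>\<^sup>2 * (?f (fst k) * ?f (snd k)))"
      by (intro sum_mono le)
    also have "\<dots> \<le> (\<Sum>k\<in>{-int n..int n} \<times> {-int n..int n}. 1 / \<alpha>\<^sup>2 * (?f (fst k) * ?f (snd k)))"
      using n by (intro sum_mono2) auto
    also have "\<dots> = 1 / \<alpha>\<^sup>2 * ((\<Sum>k\<in>{-int n..int n}. ?f k) * (\<Sum>k\<in>{-int n..int n}. ?f k))"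
      unfolding sum_distrib_left[symmetric] by (simp only: sum_product sum.cartesian_product case_prod_unfold)
    also have "\<dots> \<le> 1 / \<alpha>\<^sup>2 * (5 * 5)"
      by (intro mult_left_mono mult_mono sum_inverse_square_int_bound sum_nonneg) auto
    finally show ?thesis by simp
  qed
  then show ?thesis using \<alpha> by (intro exI[of _ "25 / \<alpha>\<^sup>2"]) auto
qed

text \<open>Fixed by choice as a number depending on \<open>L\<close> alone: it enters the later
  constants, which must not depend on the grid.\<close>

definition weight_sum :: "real \<Rightarrow> real" where
  "weight_sum L = (SOME \<sigma>. \<sigma> > 0 \<and> (\<forall>K. finite K \<longrightarrow> (\<Sum>k\<in>K. 1 / (1 + freq2 L k) ^ 2) \<le> \<sigma>))"

lemma
  assumes "0 < L"
  shows weight_sum_pos: "0 < weight_sum L"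
    and weight_sum_bound: "finite K \<Longrightarrow> (\<Sum>k\<in>K. 1 / (1 + freq2 L k) ^ 2) \<le> weight_sum L"
proof -
  have "weight_sum L > 0 \<and> (\<forall>K. finite K \<longrightarrow> (\<Sum>k\<in>K. 1 / (1 + freq2 L k) ^ 2) \<le> weight_sum L)"
    unfolding weight_sum_def
    by (rule someI_ex) (use ex_weight_sum_bound[OF assms] in blast)
  then show "0 < weight_sum L"
    and "finite K \<Longrightarrow> (\<Sum>k\<in>K. 1 / (1 + freq2 L k) ^ 2) \<le> weight_sum L" by auto
qed

lemma weight_sum_bound_image:
  assumes "0 < L" and "finite P" and "inj_on f P" and "2 \<le> q"
  shows "(\<Sum>p\<in>P. 1 / (1 + freq2 L (f p)) ^ q) \<le> weight_sum L"
proof -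
  have "(\<Sum>p\<in>P. 1 / (1 + freq2 L (f p)) ^ q) \<le> (\<Sum>p\<in>P. 1 / (1 + freq2 L (f p)) ^ 2)"
    using \<open>2 \<le> q\<close> by (intro sum_mono frac_le power_increasing zero_less_power) auto
  also have "\<dots> = (\<Sum>k\<in>f ` P. 1 / (1 + freq2 L k) ^ 2)"
    using assms by (simp add: sum.reindex)
  also have "\<dots> \<le> weight_sum L" using assms by (intro weight_sum_bound) auto
  finally show ?thesis .
qed

section \<open>The discrete Fourier transform on the grid\<close>

lemma cis_eq_1_imp:
  assumes "cis x = 1"
  obtains n :: int where "x = 2 * pi * of_int n"
proof -
  have "cos x = 1" using assms by (metis cis.sel(1) one_complex.sel(1))
  then show ?thesis using that unfolding cos_one_2pi_int by (metis mult.commute mult.assoc)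
qed

text \<open>Multiplying the sum by the root of unity shifts the range by one, which periodicity
  undoes; so the sum vanishes unless that root is 1. The start \<open>a\<close> is free because grid
  indices begin at 1 and modes at \<open>- M / 2\<close>.\<close>

lemma sum_roots_of_unity:
  assumes "0 < M"
  shows "(\<Sum>k\<in>{a..<a + int M}. cis (2 * pi * of_int k * of_int d / M)) = (if int M dvd d then of_nat M else 0)"
proof (cases "int M dvd d")
  case True
  then obtain c where c: "d = int M * c" by auto
  have "cis (2 * pi * of_int k * of_int d / M) = 1" for k
  proof -
    have "2 * pi * of_int k * of_int d / M = 2 * pi * of_int (k * c)" using assms by (simp add: c)
    then show ?thesis by (metis Ints_of_int cis_multiple_2pi)
  qed
  then show ?thesis using True by simp
next
  case False
  let ?g = "\<lambda>k::int. cis (2 * pi * of_int k * of_int d / M)"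
  let ?\<omega> = "cis (2 * pi * of_int d / M)"
  have g: "?g (k + 1) = ?g k * ?\<omega>" for k
    by (simp add: cis_mult add_divide_distrib[symmetric] distrib_left distrib_right)
  have per: "?g (a + int M) = ?g a"
  proof -
    have "2 * pi * of_int (a + int M) * of_int d / M = 2 * pi * of_int a * of_int d / M + 2 * pi * of_int d"
      using assms by (simp add: field_simps)
    then show ?thesis by (simp flip: cis_mult)
  qed
  let ?S = "\<Sum>k\<in>{a..<a + int M}. ?g k"
  have "?S * ?\<omega> = (\<Sum>k\<in>{a..<a + int M}. ?g (k + 1))"
    by (simp only: g sum_distrib_right)
  also have "\<dots> = (\<Sum>k\<in>{a+1..<a + 1 + int M}. ?g k)"
    by (rule sum.reindex_bij_witness[of _ "\<lambda>k. k - 1" "\<lambda>k. k + 1"]) auto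
  also have "\<dots> = ?S"
  proof -
    have 1: "{a..<a + int M} = insert a {a+1..<a + int M}" using assms by auto
    have 2: "{a+1..<a + 1 + int M} = insert (a + int M) {a+1..<a + int M}" using assms by auto
    show ?thesis unfolding 1 2 using per by (subst (1 2) sum.insert) auto
  qed
  finally have "?S * (?\<omega> - 1) = 0" by (simp add: algebra_simps)
  moreover have "?\<omega> \<noteq> 1"
  proof
    assume "?\<omega> = 1"
    then obtain n :: int where "2 * pi * of_int d / M = 2 * pi * of_int n" by (rule cis_eq_1_imp)
    then have "of_int d = (of_int n * real M)" using assms by (simp add: field_simps)
    then have "d = n * int M" by (metis of_int_eq_iff of_int_mult of_int_of_nat_eq)
    with False show False by simp
  qed
  ultimately show ?thesis using False by simp
qed

text \<open>The residue class of \<open>k\<close> modulo \<open>M\<close> in each component, that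
  is, the frequencies whose modes agree with that of \<open>k\<close> on the grid.\<close>

definition aliases :: "nat \<Rightarrow> int \<times> int \<Rightarrow> (int \<times> int) set" where
  "aliases M k = {q. int M dvd fst q - fst k \<and> int M dvd snd q - snd k}"

lemma aliases_refl [simp]: "k \<in> aliases M k"
  by (simp add: aliases_def)

lemma aliases_sym: "q \<in> aliases M k \<Longrightarrow> k \<in> aliases M q"
  by (auto simp: aliases_def dvd_diff_commute)

lemma aliases_trans: "q \<in> aliases M k \<Longrightarrow> k \<in> aliases M j \<Longrightarrow> q \<in> aliases M j"
  unfolding aliases_def mem_Collect_eq
  by (metis (no_types, lifting) diff_add_cancel add_diff_eq dvd_add)

text \<open>The representative of the class of \<open>k\<close> that lies in \<open>modes M\<close>;
  the shift by half of \<open>M\<close> centres the residues.\<close>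

definition fold_mode :: "nat \<Rightarrow> int \<times> int \<Rightarrow> int \<times> int" where
  "fold_mode M k = ((fst k + int M div 2) mod int M - int M div 2, (snd k + int M div 2) mod int M - int M div 2)"

lemma fold_mode_in_aliases: "fold_mode M k \<in> aliases M k"
proof -
  have "int M dvd (x + c) mod int M - c - x" for x c
    by (simp add: mod_eq_dvd_iff[symmetric] algebra_simps flip: mod_eq_dvd_iff)
  then show ?thesis by (simp add: aliases_def fold_mode_def)
qed

lemma dvd_less_imp_eq:
  fixes x y :: int
  assumes "int M dvd x - y" and "\<bar>x - y\<bar> < int M"
  shows "x = y"
  using assms dvd_imp_le_int[of "x - y" "int M"] by auto

lemma modes_eq:
  assumes "even M"
  shows "modes M = {- (int M div 2)..<- (int M div 2) + int M} \<times> {- (int M div 2)..<- (int M div 2) + int M}"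
proof -
  have "{a..b - 1} = {a..<b}" for a b :: int by auto
  moreover have "int M div 2 = - (int M div 2) + int M" using assms by auto
  ultimately show ?thesis unfolding modes_def by metis
qed

lemma finite_modes [simp]: "finite (modes M)"
  by (simp add: modes_def)

lemma fold_mode_in_modes:
  assumes "even M" and "0 < M"
  shows "fold_mode M k \<in> modes M"
  unfolding modes_eq[OF assms(1)] fold_mode_def using assms by auto

lemma modes_aliases_unique:
  assumes "even M" and "k \<in> modes M" and "q \<in> modes M" and "q \<in> aliases M k"
  shows "q = k"
  using assms unfolding modes_eq[OF assms(1)] aliases_def
  by (intro prod_eqI dvd_less_imp_eq[of M]) auto

lemma aliases_disjoint:
  assumes "even M" and "i \<in> modes M" and "j \<in> modes M" and "i \<noteq> j"
  shows "aliases M i \<inter> aliases M j = {}"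
proof (rule ccontr)
  assume "\<not> ?thesis"
  then obtain q where "q \<in> aliases M i" "q \<in> aliases M j" by blast
  then have "j \<in> aliases M i" using aliases_trans aliases_sym by blast
  then show False using modes_aliases_unique[OF assms(1-3)] assms(4) by simp
qed

text \<open>The representative satisfies \<open>2 * \<bar>x\<bar> \<le> M\<close>, and another
  member of its class is at least \<open>M\<close> away from it, hence at least \<open>M / 2\<close>
  in modulus.\<close>

lemma aliases_abs_le:
  fixes x y :: int
  assumes "even M" and "x \<in> {- (int M div 2)..<- (int M div 2) + int M}" and "int M dvd y - x"
  shows "\<bar>x\<bar> \<le> \<bar>y\<bar>" and "y \<noteq> x \<Longrightarrow> int M \<le> 2 * \<bar>y\<bar>"
proof -
  have "2 * \<bar>x\<bar> \<le> int M" using assms by auto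
  moreover have "int M \<le> \<bar>y - x\<bar>" if "y \<noteq> x"
    using that assms(3) dvd_imp_le_int[of "y - x" "int M"] by simp
  ultimately show "\<bar>x\<bar> \<le> \<bar>y\<bar>" and "y \<noteq> x \<Longrightarrow> int M \<le> 2 * \<bar>y\<bar>"
    by (cases "y = x"; linarith)+
qed

lemma freq2_mono_aliases:
  assumes "even M" and "k \<in> modes M" and "q \<in> aliases M k"
  shows "freq2 L k \<le> freq2 L q"
proof -
  have "\<bar>fst k\<bar> \<le> \<bar>fst q\<bar>" "\<bar>snd k\<bar> \<le> \<bar>snd q\<bar>"
    using assms unfolding modes_eq[OF assms(1)] aliases_def by (auto intro!: aliases_abs_le(1)[of M])
  then have "(real_of_int (fst k))\<^sup>2 \<le> (real_of_int (fst q))\<^sup>2" "(real_of_int (snd k))\<^sup>2 \<le> (real_of_int (snd q))\<^sup>2"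
    by (simp_all add: abs_le_square_iff[symmetric])
  then show ?thesis unfolding freq2_def by (intro mult_left_mono add_mono) auto
qed

text \<open>Some component of a proper alias has modulus at least \<open>M / 2\<close>, so its
  frequency is at least \<open>(pi * M / L)\<^sup>2\<close>. Every power of the mesh width
  \<open>L / M\<close> in the error bound originates here.\<close>

lemma freq2_alias_ge:
  assumes "even M" and "0 < M" and "0 < L" and "k \<in> modes M" and "q \<in> aliases M k" and "q \<noteq> k"
  shows "1 / (1 + freq2 L q) \<le> (L / M)\<^sup>2"
proof -
  have *: "int M \<le> 2 * \<bar>fst q\<bar> \<or> int M \<le> 2 * \<bar>snd q\<bar>"
    using assms(4-) aliases_abs_le(2)[OF assms(1), of "fst k" "fst q"] aliases_abs_le(2)[OF assms(1), of "snd k" "snd q"]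
    unfolding modes_eq[OF assms(1)] aliases_def by (auto simp: prod_eq_iff)
  have sq: "(real M / 2)\<^sup>2 \<le> (real_of_int x)\<^sup>2" if "int M \<le> 2 * \<bar>x\<bar>" for x
  proof -
    have "\<bar>real M / 2\<bar> \<le> \<bar>real_of_int x\<bar>" using that by linarith
    then show ?thesis by (simp only: abs_le_square_iff)
  qed
  have "(real M / 2)\<^sup>2 \<le> (of_int (fst q))\<^sup>2 + (of_int (snd q))\<^sup>2"
    using * sq[of "fst q"] sq[of "snd q"] by (smt (verit) zero_le_power2)
  then have "(2 * pi / L)\<^sup>2 * (real M / 2)\<^sup>2 \<le> freq2 L q"
    unfolding freq2_def by (rule mult_left_mono) simp
  moreover have "(real M / L)\<^sup>2 \<le> (2 * pi / L)\<^sup>2 * (real M / 2)\<^sup>2"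
  proof -
    have "1 * (real M / L)\<^sup>2 \<le> pi\<^sup>2 * (real M / L)\<^sup>2"
      using pi_ge_two by (intro mult_right_mono one_le_power) auto
    then show ?thesis by (simp add: power_divide power_mult_distrib)
  qed
  ultimately have "(real M / L)\<^sup>2 \<le> 1 + freq2 L q" by linarith
  moreover have "0 < (real M / L)\<^sup>2" using assms by simp
  ultimately have "1 / (1 + freq2 L q) \<le> 1 / (real M / L)\<^sup>2" by (intro frac_le) auto
  then show ?thesis by (simp add: power_divide)
qed

lemma finite_grid [simp]: "finite (grid L M)"
  by (simp add: grid_def)

lemma grid_cases:
  assumes "z \<in> grid L M"
  obtains i j where "z = (real i * (L / M), real j * (L / M))" and "i \<in> {1..M}" and "j \<in> {1..M}"
proof -
  from assms obtain p where "p \<in> {1..M} \<times> {1..M}" "z = (\<lambda>(i, j). (real i * (L / M), real j * (L / M))) p"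
    unfolding grid_def by blast
  then show ?thesis using that[of "fst p" "snd p"] by (simp add: case_prod_unfold mem_Times_iff)
qed

lemma sum_grid:
  assumes "0 < L" and "0 < M"
  shows "(\<Sum>z\<in>grid L M. f z) = (\<Sum>i=1..M. \<Sum>j=1..M. f (real i * (L / M), real j * (L / M)))"
proof -
  have inj: "inj_on (\<lambda>(i, j). (real i * (L / real M), real j * (L / real M))) ({1..M} \<times> {1..M})"
    using assms by (auto simp: inj_on_def)
  show ?thesis unfolding grid_def sum.reindex[OF inj] sum.cartesian_product
    by (intro sum.cong) auto
qed

lemma emode_grid:
  assumes "0 < L"
  shows "emode L k (real i * (L / M), real j * (L / M)) =
    cis (2 * pi * of_int (int i) * of_int (fst k) / M) * cis (2 * pi * of_int (int j) * of_int (snd k) / M)"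
  unfolding emode_def cis_mult using assms
  by (intro arg_cong[where f=cis]) (cases "M = 0"; simp add: field_simps)

lemma sum_emode_grid:
  assumes "0 < L" and "0 < M"
  shows "(\<Sum>z\<in>grid L M. emode L k z) = (if 0 \<in> aliases M k then of_nat (M\<^sup>2) else 0)"
proof -
  have *: "(\<Sum>i=1..M. cis (2 * pi * of_int (int i) * of_int d / M)) = (if int M dvd d then of_nat M else 0)" for d
  proof -
    have "(\<Sum>i=1..M. cis (2 * pi * of_int (int i) * of_int d / M)) = (\<Sum>k\<in>{1..<1 + int M}. cis (2 * pi * of_int k * of_int d / M))"
      by (rule sum.reindex_bij_witness[of _ nat int]) auto
    then show ?thesis using sum_roots_of_unity[OF \<open>0 < M\<close>] by simp
  qed
  have "(\<Sum>z\<in>grid L M. emode L k z) = (\<Sum>i=1..M. cis (2 * pi * of_int (int i) * of_int (fst k) / M)) * (\<Sum>j=1..M. cis (2 * pi * of_int (int j) * of_int (snd k) / M))"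
    unfolding sum_grid[OF assms] emode_grid[OF assms(1)] by (rule sum_product[symmetric])
  then show ?thesis unfolding * by (simp add: aliases_def power2_eq_square)
qed

text \<open>The counterpart of \<open>sum_emode_grid\<close> with frequencies and grid points
  exchanged; it yields the inversion formula.\<close>

lemma sum_emode_modes:
  assumes "0 < L" and "0 < M" and "even M" and "z \<in> grid L M" and "z' \<in> grid L M"
  shows "(\<Sum>k\<in>modes M. emode L k z * cnj (emode L k z')) = (if z = z' then of_nat (M\<^sup>2) else 0)"
proof -
  obtain i j where z: "z = (real i * (L / M), real j * (L / M))" and ij: "i \<in> {1..M}" "j \<in> {1..M}"
    using assms(4) by (rule grid_cases)
  obtain i' j' where z': "z' = (real i' * (L / M), real j' * (L / M))" and ij': "i' \<in> {1..M}" "j' \<in> {1..M}"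
    using assms(5) by (rule grid_cases)
  let ?I = "{- (int M div 2)..<- (int M div 2) + int M}"
  have em: "emode L k z * cnj (emode L k z') =
     cis (2 * pi * of_int (fst k) * of_int (int i - int i') / M) * cis (2 * pi * of_int (snd k) * of_int (int j - int j') / M)" for k
    unfolding z z' emode_grid[OF assms(1)] complex_cnj_mult cis_cnj cis_mult
    by (rule arg_cong[where f=cis]) (simp add: diff_divide_distrib algebra_simps)
  have "(\<Sum>k\<in>modes M. emode L k z * cnj (emode L k z')) =
     (\<Sum>k\<in>?I. cis (2 * pi * of_int k * of_int (int i - int i') / M)) * (\<Sum>k\<in>?I. cis (2 * pi * of_int k * of_int (int j - int j') / M))"
    unfolding em modes_eq[OF assms(3)] sum_product sum.cartesian_product by (simp add: case_prod_unfold)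
  also have "\<dots> = (if int M dvd int i - int i' then of_nat M else 0) * (if int M dvd int j - int j' then of_nat M else 0)"
    unfolding sum_roots_of_unity[OF assms(2)] ..
  also have "int M dvd int i - int i' \<longleftrightarrow> i = i'"
    using ij ij' dvd_less_imp_eq[of M "int i" "int i'"] by auto
  also have "int M dvd int j - int j' \<longleftrightarrow> j = j'"
    using ij ij' dvd_less_imp_eq[of M "int j" "int j'"] by auto
  finally show ?thesis using assms(1,2) by (auto simp: z z' power2_eq_square)
qed

lemma dcoef_cong: "(\<And>z. z \<in> grid L M \<Longrightarrow> v z = w z) \<Longrightarrow> dcoef L M v k = dcoef L M w k"
  unfolding dcoef_def by (simp cong: sum.cong)

lemma dcoef_add: "dcoef L M (\<lambda>z. v z + w z) k = dcoef L M v k + dcoef L M w k"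
  by (simp add: dcoef_def distrib_right sum.distrib add_divide_distrib)

lemma dcoef_cmult: "dcoef L M (\<lambda>z. c * v z) k = c * dcoef L M v k"
  by (simp add: dcoef_def sum_distrib_left mult.assoc)

lemma dcoef_diff: "dcoef L M (\<lambda>z. v z - w z) k = dcoef L M v k - dcoef L M w k"
  by (simp add: dcoef_def left_diff_distrib sum_subtractf diff_divide_distrib)

lemma dcoef_sum: "dcoef L M (\<lambda>z. \<Sum>j\<in>J. v j z) k = (\<Sum>j\<in>J. dcoef L M (v j) k)"
  by (simp add: dcoef_def sum_distrib_right sum.swap[of _ _ J] sum_divide_distrib)

lemma dcoef_emode:
  assumes "0 < L" and "0 < M"
  shows "dcoef L M (emode L q) k = (if q \<in> aliases M k then 1 else 0)"
proof -
  have "0 \<in> aliases M (q - k) \<longleftrightarrow> q \<in> aliases M k"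
    by (auto simp: aliases_def dvd_diff_commute)
  then show ?thesis unfolding dcoef_def emode_diff[symmetric] sum_emode_grid[OF assms] using assms by simp
qed

lemma dcoef_trig_poly:
  assumes "0 < L" and "0 < M" and "even M" and "k \<in> modes M"
  shows "dcoef L M (\<lambda>z. \<Sum>q\<in>modes M. c q * emode L q z) k = c k"
proof -
  have "dcoef L M (\<lambda>z. \<Sum>q\<in>modes M. c q * emode L q z) k = (\<Sum>q\<in>modes M. c q * (if q = k then 1 else 0))"
    unfolding dcoef_sum dcoef_cmult dcoef_emode[OF assms(1,2)]
    using modes_aliases_unique[OF assms(3,4)] by (intro sum.cong) auto
  then show ?thesis using assms by (simp add: if_distrib cong: if_cong)
qed

lemma dcoef_inversion:
  assumes "0 < L" and "0 < M" and "even M" and "z \<in> grid L M"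
  shows "v z = (\<Sum>k\<in>modes M. dcoef L M v k * emode L k z)"
proof -
  have "(\<Sum>k\<in>modes M. dcoef L M v k * emode L k z) =
     (\<Sum>k\<in>modes M. \<Sum>z'\<in>grid L M. v z' * (emode L k z * cnj (emode L k z')) / of_nat (M\<^sup>2))"
    by (simp add: dcoef_def sum_distrib_left sum_distrib_right sum_divide_distrib mult_ac)
  also have "\<dots> = (\<Sum>z'\<in>grid L M. v z' * (\<Sum>k\<in>modes M. emode L k z * cnj (emode L k z')) / of_nat (M\<^sup>2))"
    by (simp add: sum.swap[of _ _ "modes M"] sum_distrib_left sum_divide_distrib)
  also have "\<dots> = (\<Sum>z'\<in>grid L M. if z = z' then v z' else 0)"
    using assms by (intro sum.cong) (auto simp: sum_emode_modes)
  finally show ?thesis using assms by simp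
qed

lemma dcoef_parseval:
  assumes "0 < L" and "0 < M" and "even M"
  shows "(\<Sum>k\<in>modes M. (norm (dcoef L M v k))\<^sup>2) = (\<Sum>z\<in>grid L M. (norm (v z))\<^sup>2) / (real M)\<^sup>2"
proof -
  have "complex_of_real (\<Sum>z\<in>grid L M. (norm (v z))\<^sup>2) = (\<Sum>z\<in>grid L M. v z * cnj (v z))"
    by (simp flip: complex_norm_square)
  also have "\<dots> = (\<Sum>z\<in>grid L M. v z * cnj (\<Sum>k\<in>modes M. dcoef L M v k * emode L k z))"
    using dcoef_inversion[OF assms, of _ v] by (intro sum.cong) auto
  also have "\<dots> = (\<Sum>k\<in>modes M. cnj (dcoef L M v k) * (\<Sum>z\<in>grid L M. v z * cnj (emode L k z)))"
    by (simp add: sum_distrib_left sum.swap[of _ _ "modes M"] mult_ac)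
  also have "\<dots> = (\<Sum>k\<in>modes M. of_nat (M\<^sup>2) * (dcoef L M v k * cnj (dcoef L M v k)))"
  proof (rule sum.cong[OF refl])
    fix k
    have "(\<Sum>z\<in>grid L M. v z * cnj (emode L k z)) = of_nat (M\<^sup>2) * dcoef L M v k"
      using assms by (simp add: dcoef_def)
    then show "cnj (dcoef L M v k) * (\<Sum>z\<in>grid L M. v z * cnj (emode L k z)) =
        of_nat (M\<^sup>2) * (dcoef L M v k * cnj (dcoef L M v k))"
      by (simp only: mult_ac)
  qed
  also have "\<dots> = complex_of_real ((real M)\<^sup>2 * (\<Sum>k\<in>modes M. (norm (dcoef L M v k))\<^sup>2))"
    by (simp add: sum_distrib_left flip: complex_norm_square)
  finally have "(\<Sum>z\<in>grid L M. (norm (v z))\<^sup>2) = (real M)\<^sup>2 * (\<Sum>k\<in>modes M. (norm (dcoef L M v k))\<^sup>2)"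
    by (simp only: of_real_eq_iff)
  then show ?thesis using assms by simp
qed

lemma dnorm_eq:
  assumes "0 < L" and "0 < M" and "even M"
  shows "(dnorm L M v)\<^sup>2 = L\<^sup>2 * (\<Sum>k\<in>modes M. (norm (dcoef L M v k))\<^sup>2)"
  unfolding dcoef_parseval[OF assms] dnorm_def
  by (subst real_sqrt_pow2) (auto simp: power_divide intro!: divide_nonneg_nonneg mult_nonneg_nonneg sum_nonneg)

lemma dcoef_dlap:
  assumes "0 < L" and "0 < M" and "even M" and "k \<in> modes M"
  shows "dcoef L M (dlap L M v) k = - of_real (freq2 L k) * dcoef L M v k"
proof -
  have *: "(\<i> * of_real (2 * pi / L) * of_int x)\<^sup>2 = - complex_of_real ((2 * pi / L)\<^sup>2 * (of_int x)\<^sup>2)" for x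
    by (simp add: power_mult_distrib power_divide)
  have "dlap L M v = (\<lambda>z. \<Sum>k\<in>modes M. (- of_real (freq2 L k) * dcoef L M v k) * emode L k z)"
    unfolding dlap_def[abs_def] Dx2_def Dy2_def sum.distrib[symmetric] *
    by (intro ext sum.cong) (simp_all add: freq2_def distrib_right distrib_left left_diff_distrib)
  then show ?thesis by (simp only: dcoef_trig_poly[OF assms])
qed

lemma dcoef_alias:
  assumes "0 < L" and "0 < M" and "q \<in> aliases M k"
  shows "dcoef L M v q = dcoef L M v k"
proof -
  have "emode L q z = emode L k z" if "z \<in> grid L M" for z
  proof -
    obtain i j where z: "z = (real i * (L / M), real j * (L / M))"
      using \<open>z \<in> grid L M\<close> by (rule grid_cases)
    have *: "cis (2 * pi * of_int (int i) * of_int x / M) = cis (2 * pi * of_int (int i) * of_int y / M)" if "int M dvd x - y" for i x y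
    proof -
      obtain c where "x = y + int M * c" using \<open>int M dvd x - y\<close> by (metis add.commute diff_eq_eq dvd_def)
      then have "2 * pi * of_int (int i) * of_int x / M = 2 * pi * of_int (int i) * of_int y / M + 2 * pi * of_int (int i * c)"
        using assms by (simp add: field_simps)
      then show ?thesis by (simp flip: cis_mult)
    qed
    show ?thesis using assms(3) unfolding z emode_grid[OF assms(1)] aliases_def
      by (intro arg_cong2[where f="(*)"] *) auto
  qed
  then show ?thesis unfolding dcoef_def by (simp cong: sum.cong)
qed

text \<open>The convolution is cyclic because frequencies \<open>k - p\<close> outside
  \<open>modes M\<close> are aliased back. Expanding one factor by the inversion formula is enough:
  the remaining grid sum is a discrete coefficient of the other.\<close>

lemma dcoef_mult:
  assumes "0 < L" and "0 < M" and "even M"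
  shows "dcoef L M (\<lambda>z. v z * w z) k = (\<Sum>p\<in>modes M. dcoef L M v p * dcoef L M w (fold_mode M (k - p)))"
proof -
  have "dcoef L M (\<lambda>z. v z * w z) k = (\<Sum>z\<in>grid L M. (\<Sum>p\<in>modes M. dcoef L M v p * emode L p z) * w z * cnj (emode L k z)) / of_nat (M\<^sup>2)"
    unfolding dcoef_def[of L M "\<lambda>z. v z * w z"] using dcoef_inversion[OF assms, of _ v] by (simp cong: sum.cong)
  also have "\<dots> = (\<Sum>p\<in>modes M. dcoef L M v p * ((\<Sum>z\<in>grid L M. w z * (emode L p z * cnj (emode L k z))) / of_nat (M\<^sup>2)))"
    by (simp add: sum_distrib_left sum_distrib_right sum_divide_distrib sum.swap[of _ _ "modes M"] mult_ac)
  also have "\<dots> = (\<Sum>p\<in>modes M. dcoef L M v p * dcoef L M w (k - p))"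
    unfolding dcoef_def[of L M w] emode_diff by (simp add: mult_ac)
  also have "\<dots> = (\<Sum>p\<in>modes M. dcoef L M v p * dcoef L M w (fold_mode M (k - p)))"
    using dcoef_alias[OF assms(1,2) fold_mode_in_aliases] by simp
  finally show ?thesis .
qed

text \<open>Up to the factor \<open>L\<^sup>2\<close>, the square of the discrete
  \<open>H\<^sup>2\<close> norm, with symbol \<open>(1 - \<Delta>\<^sub>h)\<^sup>2\<close>. Keeping
  the square avoids roots in the energy recursion.\<close>

definition dnorm2_sq :: "real \<Rightarrow> nat \<Rightarrow> (real \<times> real \<Rightarrow> complex) \<Rightarrow> real" where
  "dnorm2_sq L M v = (\<Sum>k\<in>modes M. (1 + freq2 L k)\<^sup>2 * (norm (dcoef L M v k))\<^sup>2)"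

lemma dnorm2_sq_nonneg [simp]: "0 \<le> dnorm2_sq L M v"
  by (simp add: dnorm2_sq_def sum_nonneg)

lemma dnorm2_sq_cong: "(\<And>z. z \<in> grid L M \<Longrightarrow> v z = w z) \<Longrightarrow> dnorm2_sq L M v = dnorm2_sq L M w"
  unfolding dnorm2_sq_def using dcoef_cong[of L M v w] by simp

lemma dnorm2_sq_cmult: "dnorm2_sq L M (\<lambda>z. c * v z) = (norm c)\<^sup>2 * dnorm2_sq L M v"
  by (simp add: dnorm2_sq_def dcoef_cmult norm_mult power_mult_distrib sum_distrib_left mult_ac)

lemma norm_add_sq_le: "(norm (x + y))\<^sup>2 \<le> 2 * (norm x)\<^sup>2 + 2 * (norm y)\<^sup>2" for x y :: "'a :: real_normed_vector"
proof -
  have "(norm (x + y))\<^sup>2 \<le> (norm x + norm y)\<^sup>2" by (intro power_mono norm_triangle_ineq) simp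
  also have "\<dots> \<le> 2 * (norm x)\<^sup>2 + 2 * (norm y)\<^sup>2"
    using sum_squares_bound[of "norm x" "norm y"] by (simp add: power2_sum)
  finally show ?thesis .
qed

lemma dnorm2_sq_add: "dnorm2_sq L M (\<lambda>z. v z + w z) \<le> 2 * dnorm2_sq L M v + 2 * dnorm2_sq L M w"
proof -
  have "dnorm2_sq L M (\<lambda>z. v z + w z) \<le>
    (\<Sum>k\<in>modes M. (1 + freq2 L k)\<^sup>2 * (2 * (norm (dcoef L M v k))\<^sup>2 + 2 * (norm (dcoef L M w k))\<^sup>2))"
    unfolding dnorm2_sq_def dcoef_add by (intro sum_mono mult_left_mono norm_add_sq_le) simp
  also have "\<dots> = 2 * dnorm2_sq L M v + 2 * dnorm2_sq L M w"
    by (simp add: dnorm2_sq_def distrib_left sum.distrib sum_distrib_left mult_ac)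
  finally show ?thesis .
qed

lemma dnorm_le_dnorm2_sq:
  assumes "0 < L" and "0 < M" and "even M"
  shows "(dnorm L M v)\<^sup>2 \<le> L\<^sup>2 * dnorm2_sq L M v"
  unfolding dnorm_eq[OF assms] dnorm2_sq_def
proof (intro mult_left_mono sum_mono)
  fix k
  have "1 * (norm (dcoef L M v k))\<^sup>2 \<le> (1 + freq2 L k)\<^sup>2 * (norm (dcoef L M v k))\<^sup>2"
    by (intro mult_right_mono one_le_power) auto
  then show "(norm (dcoef L M v k))\<^sup>2 \<le> (1 + freq2 L k)\<^sup>2 * (norm (dcoef L M v k))\<^sup>2" by simp
qed simp

text \<open>Equal folded values mean that the arguments are aliases, and \<open>modes M\<close>
  contains at most one member of each class. Translations and reflections modulo \<open>M\<close>
  are therefore injective on the modes, which the two sums of the convolution bound require.\<close>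

lemma
  assumes "even M"
  shows inj_on_fold_mode_left: "inj_on (\<lambda>k. fold_mode M (k - p)) (modes M)"
    and inj_on_fold_mode_right: "inj_on (\<lambda>p. fold_mode M (k - p)) (modes M)"
proof -
  have al: "k \<in> aliases M k'" if "fold_mode M k = fold_mode M k'" for k k'
  proof -
    have "int M dvd x' - x" if "int M dvd y - x" "int M dvd y - x'" for x x' y :: int
      using dvd_diff[OF that] by simp
    then show ?thesis using fold_mode_in_aliases[of M k] fold_mode_in_aliases[of M k']
      unfolding that aliases_def by blast
  qed
  show "inj_on (\<lambda>k. fold_mode M (k - p)) (modes M)"
  proof (rule inj_onI)
    fix k k' assume "k \<in> modes M" "k' \<in> modes M" "fold_mode M (k - p) = fold_mode M (k' - p)"
    then show "k = k'" using al[of "k - p" "k' - p"]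
      by (intro modes_aliases_unique[OF assms, of k' k]) (auto simp: aliases_def)
  qed
  show "inj_on (\<lambda>p. fold_mode M (k - p)) (modes M)"
  proof (rule inj_onI)
    fix p p' assume "p \<in> modes M" "p' \<in> modes M" "fold_mode M (k - p) = fold_mode M (k - p')"
    then show "p = p'" using al[of "k - p'" "k - p"]
      by (intro modes_aliases_unique[OF assms, of p' p]) (auto simp: aliases_def)
  qed
qed

text \<open>Folding does not increase frequencies (\<open>freq2_mono_aliases\<close>), so the
  weights stay subadditive under cyclic convolution and the constant does not depend on
  \<open>M\<close>. The 32 is \<open>2 * 4\<^sup>2\<close>.\<close>

lemma dnorm2_sq_mult:
  assumes "0 < L" and "0 < M" and "even M"
  shows "dnorm2_sq L M (\<lambda>z. v z * w z) \<le> 32 * weight_sum L * dnorm2_sq L M v * dnorm2_sq L M w"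
proof -
  let ?W = "\<lambda>k. (1 + freq2 L k)\<^sup>2"
  let ?f = "\<lambda>k p. fold_mode M (k - p)"
  have "dnorm2_sq L M (\<lambda>z. v z * w z) \<le>
     (\<Sum>k\<in>modes M. ?W k * (\<Sum>p\<in>modes M. norm (dcoef L M v p) * norm (dcoef L M w (?f k p)))\<^sup>2)"
    unfolding dnorm2_sq_def dcoef_mult[OF assms]
    by (intro sum_mono mult_left_mono power_mono)
       (auto intro!: order_trans[OF norm_sum] simp: norm_mult)
  also have "\<dots> \<le> 2 * 4\<^sup>2 * weight_sum L * dnorm2_sq L M v * dnorm2_sq L M w"
  proof (rule weighted_convolution_bound)
    fix k p assume k: "k \<in> modes M" and p: "p \<in> modes M"
    have "fold_mode M (k - p) + p \<in> aliases M k"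
      using fold_mode_in_aliases[of M "k - p"] by (simp add: aliases_def algebra_simps)
    then have "freq2 L k \<le> freq2 L (p + fold_mode M (k - p))"
      using freq2_mono_aliases[OF assms(3) k] by (simp add: add.commute)
    also have "\<dots> \<le> 2 * freq2 L p + 2 * freq2 L (?f k p)" by (rule freq2_add_le)
    finally show "?W k \<le> 4\<^sup>2 * (?W p + ?W (?f k p))" by (intro weight_subadditive) auto
  next
    show "(\<Sum>p\<in>modes M. 1 / ?W p) \<le> weight_sum L" by (intro weight_sum_bound assms) simp
    show "(\<Sum>p\<in>modes M. 1 / ?W (?f k p)) \<le> weight_sum L" for k
      by (intro weight_sum_bound_image inj_on_fold_mode_right assms) auto
    show "(\<Sum>p\<in>modes M. ?W p * (norm (dcoef L M v p))\<^sup>2) \<le> dnorm2_sq L M v"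
      by (simp add: dnorm2_sq_def)
    show "(\<Sum>k\<in>modes M. ?W (?f k p) * (norm (dcoef L M w (?f k p)))\<^sup>2) \<le> dnorm2_sq L M w" for p
    proof -
      have "(\<Sum>k\<in>modes M. ?W (?f k p) * (norm (dcoef L M w (?f k p)))\<^sup>2) =
        (\<Sum>k\<in>(\<lambda>k. ?f k p) ` modes M. ?W k * (norm (dcoef L M w k))\<^sup>2)"
        by (subst sum.reindex[OF inj_on_fold_mode_left[OF assms(3)]]) simp
      also have "\<dots> \<le> dnorm2_sq L M w" unfolding dnorm2_sq_def
      proof (rule sum_mono2)
        show "(\<lambda>k. ?f k p) ` modes M \<subseteq> modes M" using fold_mode_in_modes[OF assms(3,2)] by blast
      qed auto
      finally show ?thesis .
    qed
  qed auto
  finally show ?thesis by simp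
qed

section \<open>The nonlinearity\<close>

lemma deriv_F: "deriv F v = v ^ 3 - v"
proof -
  have "(F has_field_derivative (2 * (v\<^sup>2 - 1) * (2 * v) / 4)) (at v)"
    unfolding F_def[abs_def] by (auto intro!: derivative_eq_intros)
  also have "2 * (v\<^sup>2 - 1) * (2 * v) / 4 = v ^ 3 - v"
    by (simp add: field_simps power2_eq_square power3_eq_cube)
  finally have "(F has_field_derivative (v ^ 3 - v)) (at v)" .
  then show ?thesis by (rule DERIV_imp_deriv)
qed

lemma f_kappa_eq: "f_kappa \<kappa> v = of_real (\<kappa> + 1) * v - v ^ 3"
  by (simp add: f_kappa_def deriv_F algebra_simps)

lemma of_real_f_kappa: "of_real (f_kappa \<kappa> (x::real)) = f_kappa \<kappa> (of_real x)"
  by (simp add: f_kappa_eq)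

text \<open>With \<open>e = w - u\<close> the difference of the cubes is
  \<open>3 * w\<^sup>2 * e - 3 * w * e\<^sup>2 + e ^ 3\<close>, an expansion around \<open>w\<close>
  alone. Later \<open>w\<close> is the exact solution, so no bound on the discrete solution
  \<open>u\<close> has to be known in advance; smallness of \<open>e\<close> replaces it.\<close>

lemma dnorm2_sq_f_kappa_diff:
  assumes "0 < L" and "0 < B"
  shows "\<exists>C>0. \<forall>M u w. even M \<and> 0 < M \<and> dnorm2_sq L M w \<le> B \<and> dnorm2_sq L M (\<lambda>z. w z - u z) \<le> 1 \<longrightarrow>
     dnorm2_sq L M (\<lambda>z. f_kappa \<kappa> (w z) - f_kappa \<kappa> (u z)) \<le> C * dnorm2_sq L M (\<lambda>z. w z - u z)"
proof -
  define A where "A = 32 * weight_sum L"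
  have A: "0 < A" using weight_sum_pos[OF assms(1)] by (simp add: A_def)
  \<comment> \<open>The coefficients come from three nested applications of
    \<open>dnorm2_sq_add\<close> to the four terms of the expansion; the final 1 secures
    positivity.\<close>
  let ?C = "2 * \<bar>\<kappa> + 1\<bar>\<^sup>2 + 2 * (18 * A\<^sup>2 * B\<^sup>2 + 4 * (9 * A\<^sup>2 * B + A\<^sup>2)) + 1"
  have "dnorm2_sq L M (\<lambda>z. f_kappa \<kappa> (w z) - f_kappa \<kappa> (u z)) \<le> ?C * dnorm2_sq L M (\<lambda>z. w z - u z)"
    if M: "even M" "0 < M" and w: "dnorm2_sq L M w \<le> B" and e1: "dnorm2_sq L M (\<lambda>z. w z - u z) \<le> 1" for M u w
  proof -
    let ?n = "dnorm2_sq L M"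
    define e where "e = (\<lambda>z. w z - u z)"
    define E where "E = ?n e"
    have E: "0 \<le> E" "E \<le> 1" using e1 by (simp_all add: E_def e_def)
    have mult: "?n (\<lambda>z. v z * v' z) \<le> A * ?n v * ?n v'" for v v'
      using dnorm2_sq_mult[OF assms(1) M(2,1)] by (simp add: A_def)
    have mult3: "?n (\<lambda>z. v z * (v' z * v'' z)) \<le> A\<^sup>2 * (?n v * ?n v' * ?n v'')" for v v' v''
    proof -
      have "?n (\<lambda>z. v z * (v' z * v'' z)) \<le> A * ?n v * ?n (\<lambda>z. v' z * v'' z)" by (rule mult)
      also have "\<dots> \<le> A * ?n v * (A * ?n v' * ?n v'')" using A by (intro mult_left_mono mult) auto
      finally show ?thesis by (simp add: power2_eq_square mult_ac)
    qed
    have 1: "?n (\<lambda>z. w z * (w z * e z)) \<le> A\<^sup>2 * B\<^sup>2 * E"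
    proof -
      have "?n w * ?n w * ?n e \<le> B * B * E"
        unfolding E_def using w assms by (intro mult_mono) auto
      then have "A\<^sup>2 * (?n w * ?n w * ?n e) \<le> A\<^sup>2 * (B * B * E)" by (intro mult_left_mono) auto
      then show ?thesis using mult3[of w w e] by (simp add: power2_eq_square mult_ac)
    qed
    have 2: "?n (\<lambda>z. w z * (e z * e z)) \<le> A\<^sup>2 * B * E"
    proof -
      have "?n w * ?n e * ?n e \<le> B * 1 * E"
        unfolding E_def using w assms E by (intro mult_mono) (auto simp: E_def)
      then have "A\<^sup>2 * (?n w * ?n e * ?n e) \<le> A\<^sup>2 * (B * 1 * E)" by (intro mult_left_mono) auto
      then show ?thesis using mult3[of w e e] by (simp add: mult_ac)
    qed
    have 3: "?n (\<lambda>z. e z * (e z * e z)) \<le> A\<^sup>2 * E"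
    proof -
      have "?n e * ?n e * ?n e \<le> 1 * 1 * E"
        unfolding E_def using assms E by (intro mult_mono) (auto simp: E_def)
      then have "A\<^sup>2 * (?n e * ?n e * ?n e) \<le> A\<^sup>2 * (1 * 1 * E)" by (intro mult_left_mono) auto
      then show ?thesis using mult3[of e e e] by (simp add: mult_ac)
    qed
    have eq: "f_kappa \<kappa> (w z) - f_kappa \<kappa> (u z) =
       of_real (\<kappa> + 1) * e z + ((- 3) * (w z * (w z * e z)) + (3 * (w z * (e z * e z)) + (- 1) * (e z * (e z * e z))))" for z
      by (simp add: f_kappa_eq e_def power3_eq_cube algebra_simps)
    have "?n (\<lambda>z. f_kappa \<kappa> (w z) - f_kappa \<kappa> (u z)) \<le>
       2 * ?n (\<lambda>z. of_real (\<kappa> + 1) * e z) + 2 * (2 * ?n (\<lambda>z. (- 3) * (w z * (w z * e z))) +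
         2 * (2 * ?n (\<lambda>z. 3 * (w z * (e z * e z))) + 2 * ?n (\<lambda>z. (- 1) * (e z * (e z * e z)))))"
    proof -
      let ?a = "\<lambda>z. of_real (\<kappa> + 1) * e z" and ?b = "\<lambda>z. (- 3) * (w z * (w z * e z))"
        and ?c = "\<lambda>z. 3 * (w z * (e z * e z))" and ?d = "\<lambda>z. (- 1) * (e z * (e z * e z))"
      have "?n (\<lambda>z. ?c z + ?d z) \<le> 2 * ?n ?c + 2 * ?n ?d" by (rule dnorm2_sq_add)
      moreover have "?n (\<lambda>z. ?b z + (?c z + ?d z)) \<le> 2 * ?n ?b + 2 * ?n (\<lambda>z. ?c z + ?d z)"
        by (rule dnorm2_sq_add)
      moreover have "?n (\<lambda>z. ?a z + (?b z + (?c z + ?d z))) \<le> 2 * ?n ?a + 2 * ?n (\<lambda>z. ?b z + (?c z + ?d z))"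
        by (rule dnorm2_sq_add)
      ultimately show ?thesis unfolding eq distrib_left by linarith
    qed
    also have "\<dots> = 2 * (\<bar>\<kappa> + 1\<bar>\<^sup>2 * E) + 2 * (2 * (9 * ?n (\<lambda>z. w z * (w z * e z))) +
         2 * (2 * (9 * ?n (\<lambda>z. w z * (e z * e z))) + 2 * ?n (\<lambda>z. e z * (e z * e z))))"
      unfolding dnorm2_sq_cmult E_def[symmetric] norm_of_real by simp
    also have "\<dots> \<le> 2 * (\<bar>\<kappa> + 1\<bar>\<^sup>2 * E) + 2 * (2 * (9 * (A\<^sup>2 * B\<^sup>2 * E)) +
         2 * (2 * (9 * (A\<^sup>2 * B * E)) + 2 * (A\<^sup>2 * E)))"
      using 1 2 3 by (intro add_mono mult_left_mono) auto
    also have "\<dots> = (?C - 1) * E" by (simp add: algebra_simps)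
    also have "\<dots> \<le> ?C * E" using E by (intro mult_right_mono) auto
    finally show ?thesis by (simp add: E_def e_def)
  qed
  moreover have "0 < ?C" using A assms by (simp add: add_nonneg_pos)
  ultimately show ?thesis by (intro exI[of _ ?C]) blast
qed

section \<open>Fourier series on the square\<close>

text \<open>A finite measure space of its own, onto which the set integrals of the given definitions
  are transferred.\<close>

definition Om :: "real \<Rightarrow> (real \<times> real) measure" where
  "Om L = restrict_space lborel (omega L)"

lemma sets_omega [measurable]: "omega L \<in> sets borel"
  unfolding omega_def by (intro borel_open open_Times) auto

lemma emeasure_omega: "0 < L \<Longrightarrow> emeasure lborel (omega L) = ennreal (L\<^sup>2)"
  unfolding omega_def lborel_prod[symmetric]
  by (subst lborel.emeasure_pair_measure_Times) (auto simp: power2_eq_square ennreal_mult)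

lemma space_Om [simp]: "space (Om L) = omega L"
  by (simp add: Om_def space_restrict_space)

lemma emeasure_Om: "0 < L \<Longrightarrow> emeasure (Om L) (omega L) = ennreal (L\<^sup>2)"
  unfolding Om_def by (subst emeasure_restrict_space) (auto simp: emeasure_omega)

lemma finite_measure_Om: "0 < L \<Longrightarrow> finite_measure (Om L)"
  by (rule finite_measureI) (simp add: emeasure_Om)

lemma measure_Om: "0 < L \<Longrightarrow> measure (Om L) (omega L) = L\<^sup>2"
  unfolding measure_def by (simp add: emeasure_Om)

lemma measurable_Om: "f \<in> borel_measurable borel \<Longrightarrow> f \<in> borel_measurable (Om L)"
  unfolding Om_def by (rule measurable_restrict_space1) simp

lemma continuous_measurable_Om: "continuous_on UNIV f \<Longrightarrow> f \<in> borel_measurable (Om L)"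
  by (rule measurable_Om) (rule borel_measurable_continuous_onI)

lemma set_integral_omega:
  fixes f :: "real \<times> real \<Rightarrow> 'a :: {banach, second_countable_topology}"
  shows "(LINT z:omega L|lborel. f z) = integral\<^sup>L (Om L) f"
  unfolding set_lebesgue_integral_def Om_def by (subst integral_restrict_space) auto

lemma set_integrable_omega:
  fixes f :: "real \<times> real \<Rightarrow> 'a :: {banach, second_countable_topology}"
  shows "set_integrable lborel (omega L) f \<longleftrightarrow> integrable (Om L) f"
  unfolding set_integrable_def Om_def by (subst integrable_restrict_space) auto

lemma AE_Om: "AE z in lborel. P z \<Longrightarrow> AE z in Om L. P z"
  unfolding Om_def by (subst AE_restrict_space_iff) auto

lemma continuous_emode: "continuous_on A (emode L k)"
  unfolding emode_def[abs_def] by (intro continuous_intros)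

lemma emode_measurable [measurable]: "emode L k \<in> borel_measurable (Om L)"
  by (intro continuous_measurable_Om continuous_emode)

lemma integrable_Om_bounded:
  fixes f :: "real \<times> real \<Rightarrow> 'a :: {banach, second_countable_topology}"
  assumes "0 < L" and "f \<in> borel_measurable (Om L)" and "\<And>z. z \<in> omega L \<Longrightarrow> norm (f z) \<le> B"
  shows "integrable (Om L) f"
proof -
  interpret finite_measure "Om L" using assms(1) by (rule finite_measure_Om)
  show ?thesis using assms by (intro integrable_const_bound[of _ B] AE_I2) auto
qed

lemma integrable_mult_cnj_emode:
  assumes "integrable (Om L) f"
  shows "integrable (Om L) (\<lambda>z. f z * cnj (emode L k z))"
  unfolding emode_uminus[symmetric]
  by (rule Bochner_Integration.integrable_bound[OF assms])
     (use assms in \<open>auto simp: norm_mult intro!: AE_I2\<close>)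

text \<open>The coefficient \<open>fcoef\<close> for complex functions, needed because
  multiplication by a mode leaves the real functions.\<close>

definition ccoef :: "real \<Rightarrow> (real \<times> real \<Rightarrow> complex) \<Rightarrow> int \<times> int \<Rightarrow> complex" where
  "ccoef L v k = (\<integral>z. v z * cnj (emode L k z) \<partial>Om L) / of_real (L\<^sup>2)"

lemma fcoef_eq_ccoef: "fcoef L v k = ccoef L (\<lambda>z. of_real (v z)) k"
  unfolding fcoef_def ccoef_def set_integral_omega ..

lemma ccoef_add:
  assumes "integrable (Om L) v" and "integrable (Om L) w"
  shows "ccoef L (\<lambda>z. v z + w z) k = ccoef L v k + ccoef L w k"
  unfolding ccoef_def distrib_right
  using assms by (subst Bochner_Integration.integral_add) (auto intro: integrable_mult_cnj_emode simp: add_divide_distrib)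

lemma ccoef_cmult: "ccoef L (\<lambda>z. c * v z) k = c * ccoef L v k"
  unfolding ccoef_def by (simp add: mult.assoc)

lemma ccoef_diff:
  assumes "integrable (Om L) v" and "integrable (Om L) w"
  shows "ccoef L (\<lambda>z. v z - w z) k = ccoef L v k - ccoef L w k"
  unfolding ccoef_def left_diff_distrib
  using assms by (subst Bochner_Integration.integral_diff) (auto intro: integrable_mult_cnj_emode simp: diff_divide_distrib)

lemma ccoef_sum:
  assumes "\<And>j. j \<in> J \<Longrightarrow> integrable (Om L) (v j)"
  shows "ccoef L (\<lambda>z. \<Sum>j\<in>J. v j z) k = (\<Sum>j\<in>J. ccoef L (v j) k)"
  unfolding ccoef_def sum_distrib_right
  using assms by (subst Bochner_Integration.integral_sum) (auto intro: integrable_mult_cnj_emode simp: sum_divide_distrib)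

lemma ccoef_emode_mult: "ccoef L (\<lambda>z. emode L q z * v z) k = ccoef L v (k - q)"
  unfolding ccoef_def emode_diff by (simp add: mult_ac)

lemma ccoef_cnj: "ccoef L (\<lambda>z. cnj (v z)) k = cnj (ccoef L v (- k))"
proof -
  have "(\<integral>z. cnj (v z) * cnj (emode L k z) \<partial>Om L) = cnj (\<integral>z. v z * cnj (emode L (- k) z) \<partial>Om L)"
  proof -
    have "(\<integral>z. cnj (v z) * cnj (emode L k z) \<partial>Om L) = (\<integral>z. cnj (v z * cnj (emode L (- k) z)) \<partial>Om L)"
      by (simp add: emode_uminus)
    also have "\<dots> = cnj (\<integral>z. v z * cnj (emode L (- k) z) \<partial>Om L)" by (rule Bochner_Integration.integral_cnj)
    finally show ?thesis .
  qed
  then show ?thesis unfolding ccoef_def by (simp only: complex_cnj_divide complex_cnj_complex_of_real)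
qed

lemma fcoef_uminus: "fcoef L v (- k) = cnj (fcoef L v k)"
  using ccoef_cnj[of L "\<lambda>z. of_real (v z)" "- k"] by (simp add: fcoef_eq_ccoef)

lemma norm_ccoef_le:
  assumes "0 < L"
  shows "norm (ccoef L v k) \<le> (\<integral>z. norm (v z) \<partial>Om L) / L\<^sup>2"
proof -
  have "norm (\<integral>z. v z * cnj (emode L k z) \<partial>Om L) \<le> (\<integral>z. norm (v z * cnj (emode L k z)) \<partial>Om L)"
    by (rule integral_norm_bound)
  then show ?thesis unfolding ccoef_def using assms
    by (simp add: norm_divide norm_mult divide_right_mono power2_eq_square)
qed

lemma integral_cis_zero:
  assumes "0 < L" and "n \<noteq> 0"
  shows "(\<integral>x. indicator {0<..<L} x *\<^sub>R cis (2 * pi / L * of_int n * x) \<partial>lborel) = 0"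
proof -
  define c where "c = 2 * pi / L * of_int n"
  have c: "c \<noteq> 0" using assms by (simp add: c_def)
  let ?F = "\<lambda>x. cis (c * x) / (\<i> * of_real c)"
  have "(LBINT x=ereal 0..ereal L. cis (c * x)) = ?F L - ?F 0"
  proof (rule interval_integral_FTC_finite)
    fix x
    have "((\<lambda>x. cis (c * x)) has_vector_derivative c *\<^sub>R (\<i> * cis (c * x))) (at x within {min 0 L..max 0 L})"
    proof -
      have "((\<lambda>x. exp (\<i> * of_real (c * x))) has_vector_derivative c *\<^sub>R (\<i> * exp (\<i> * of_real (c * x)))) (at x within {min 0 L..max 0 L})"
        by (rule has_vector_derivative_real_field | rule derivative_eq_intros refl | simp add: scaleR_conv_of_real)+
      then show ?thesis by (simp add: cis_conv_exp)
    qed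
    then have "((\<lambda>x. cis (c * x) / (\<i> * of_real c)) has_vector_derivative (c *\<^sub>R (\<i> * cis (c * x))) / (\<i> * of_real c)) (at x within {min 0 L..max 0 L})"
      by (rule has_vector_derivative_divide)
    moreover have "(c *\<^sub>R (\<i> * cis (c * x))) / (\<i> * of_real c) = cis (c * x)"
      using c by (simp add: scaleR_conv_of_real)
    ultimately show "(?F has_vector_derivative cis (c * x)) (at x within {min 0 L..max 0 L})" by simp
  qed (intro continuous_intros)
  moreover have "cis (c * L) = 1"
  proof -
    have "c * L = 2 * pi * of_int n" using assms by (simp add: c_def)
    then show ?thesis by (metis Ints_of_int cis_multiple_2pi)
  qed
  ultimately show ?thesis
    using assms by (simp add: interval_lebesgue_integral_def set_lebesgue_integral_def einterval_eq c_def)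
qed

lemma integral_emode:
  assumes "0 < L"
  shows "(\<integral>z. emode L k z \<partial>Om L) = (if k = 0 then of_real (L\<^sup>2) else 0)"
proof (cases "k = 0")
  case True
  then show ?thesis using assms by (simp add: measure_Om scaleR_conv_of_real)
next
  case False
  let ?f = "\<lambda>n x. indicator {0<..<L} x *\<^sub>R cis (2 * pi / L * of_int n * x)"
  have prod: "indicator (omega L) (x, y) *\<^sub>R emode L k (x, y) = ?f (fst k) x * ?f (snd k) y" for x y
    by (auto simp: omega_def emode_def cis_mult algebra_simps split: split_indicator)
  have eq: "(\<lambda>(x, y). ?f (fst k) x * ?f (snd k) y) = (\<lambda>z. indicator (omega L) z *\<^sub>R emode L k z)"
    by (intro ext) (simp only: case_prod_unfold prod[symmetric] prod.collapse)
  have int: "integrable (lborel \<Otimes>\<^sub>M lborel) (\<lambda>(x, y). ?f (fst k) x * ?f (snd k) y)"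
  proof -
    have "integrable (Om L) (emode L k)"
      using assms by (intro integrable_Om_bounded[of _ _ 1]) auto
    then have "integrable lborel (\<lambda>z. indicator (omega L) z *\<^sub>R emode L k z)"
      unfolding Om_def by (subst (asm) integrable_restrict_space) auto
    then show ?thesis unfolding lborel_prod eq .
  qed
  have "(\<integral>z. emode L k z \<partial>Om L) = (\<integral>z. indicator (omega L) z *\<^sub>R emode L k z \<partial>lborel)"
    unfolding Om_def by (subst integral_restrict_space) auto
  also have "\<dots> = (\<integral>z. (case z of (x, y) \<Rightarrow> ?f (fst k) x * ?f (snd k) y) \<partial>(lborel \<Otimes>\<^sub>M lborel))"
    unfolding lborel_prod eq ..
  also have "\<dots> = (\<integral>x. (\<integral>y. ?f (fst k) x * ?f (snd k) y \<partial>lborel) \<partial>lborel)"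
    using lborel_pair.integral_fst'[OF int] by simp
  also have "\<dots> = (\<integral>x. ?f (fst k) x \<partial>lborel) * (\<integral>y. ?f (snd k) y \<partial>lborel)"
    by (simp only: integral_mult_right_zero integral_mult_left_zero)
  also have "\<dots> = 0"
    using False integral_cis_zero[OF assms, of "fst k"] integral_cis_zero[OF assms, of "snd k"]
    by (cases k) (auto simp: zero_prod_def)
  finally show ?thesis using False by simp
qed

lemma ccoef_one:
  assumes "0 < L"
  shows "ccoef L (\<lambda>z. 1) k = (if k = 0 then 1 else 0)"
  using integral_emode[OF assms, of "- k"] assms
  by (simp add: ccoef_def emode_uminus)

lemma series_tail_bound:
  assumes c: "(\<lambda>k. norm (c k)) summable_on UNIV" and P: "finite P"
  shows "norm ((\<Sum>\<^sub>\<infinity>p. c p * emode L p z) - (\<Sum>p\<in>P. c p * emode L p z)) \<le> (\<Sum>\<^sub>\<infinity>p. norm (c p)) - (\<Sum>p\<in>P. norm (c p))"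
proof -
  have ab: "(\<lambda>p. norm (c p * emode L p z)) summable_on UNIV"
    using c by (simp add: norm_mult)
  have 1: "((\<lambda>p. c p * emode L p z) has_sum ((\<Sum>\<^sub>\<infinity>p. c p * emode L p z) - (\<Sum>p\<in>P. c p * emode L p z))) (UNIV - P)"
    by (intro has_sum_Diff has_sum_infsum abs_summable_summable[OF ab] has_sum_finite P) auto
  have 2: "((\<lambda>p. norm (c p * emode L p z)) has_sum ((\<Sum>\<^sub>\<infinity>p. norm (c p)) - (\<Sum>p\<in>P. norm (c p)))) (UNIV - P)"
    using c P by (intro has_sum_Diff) (auto simp: norm_mult intro: has_sum_infsum has_sum_finite)
  show ?thesis using norm_has_sum_bound[OF 2 1] .
qed

text \<open>Partial sums converge uniformly to \<open>S\<close>, and coefficients depend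
  continuously on the first factor in that sense when \<open>w\<close> is integrable. Taking
  \<open>w = 1\<close> identifies the coefficients of a series; a general \<open>w\<close> gives the
  convolution formula for products.\<close>

lemma has_sum_ccoef_series_mult:
  assumes "0 < L" and c: "(\<lambda>k. norm (c k)) summable_on UNIV"
    and w: "integrable (Om L) w"
    and S: "\<And>z. S z = (\<Sum>\<^sub>\<infinity>p. c p * emode L p z)" and Sm: "S \<in> borel_measurable (Om L)"
  shows "((\<lambda>p. c p * ccoef L w (k - p)) has_sum ccoef L (\<lambda>z. S z * w z) k) UNIV"
proof -
  define tail where "tail = (\<lambda>P. (\<Sum>\<^sub>\<infinity>p. norm (c p)) - (\<Sum>p\<in>P. norm (c p)))"
  have tail0: "(tail \<longlongrightarrow> 0) (finite_subsets_at_top UNIV)"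
  proof -
    have "(sum (\<lambda>k. norm (c k)) \<longlongrightarrow> (\<Sum>\<^sub>\<infinity>p. norm (c p))) (finite_subsets_at_top UNIV)"
      using c by (rule infsum_tendsto)
    from tendsto_diff[OF tendsto_const[of "\<Sum>\<^sub>\<infinity>p. norm (c p)"] this] show ?thesis unfolding tail_def by simp
  qed
  have diff: "norm (S z - (\<Sum>p\<in>P. c p * emode L p z)) \<le> tail P" if "finite P" for P z
    unfolding S tail_def using c that by (rule series_tail_bound)
  have bd: "norm (S z) \<le> tail {}" for z using diff[of "{}" z] by simp
  have Sw: "integrable (Om L) (\<lambda>z. S z * w z)"
  proof (rule Bochner_Integration.integrable_bound)
    show "integrable (Om L) (\<lambda>z. tail {} * norm (w z))" using w by auto
    show "AE z in Om L. norm (S z * w z) \<le> norm (tail {} * norm (w z))"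
    proof (rule AE_I2)
      fix z
      have "0 \<le> tail {}" using bd[of z] norm_ge_zero[of "S z"] by linarith
      then show "norm (S z * w z) \<le> norm (tail {} * norm (w z))"
        using bd[of z] by (simp add: norm_mult abs_mult mult_right_mono)
    qed
  qed (use Sm w in auto)
  have ew: "integrable (Om L) (\<lambda>z. emode L p z * w z)" for p
    by (rule Bochner_Integration.integrable_bound[OF w]) (use w in \<open>auto simp: norm_mult\<close>)
  have est: "norm ((\<Sum>p\<in>P. c p * ccoef L w (k - p)) - ccoef L (\<lambda>z. S z * w z) k) \<le>
      tail P * ((\<integral>z. norm (w z) \<partial>Om L) / L\<^sup>2)" if P: "finite P" for P
  proof -
    have intP: "integrable (Om L) (\<lambda>z. (\<Sum>p\<in>P. c p * emode L p z) * w z)"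
      unfolding sum_distrib_right mult.assoc using ew by (intro Bochner_Integration.integrable_sum integrable_mult_right) auto
    have "(\<Sum>p\<in>P. c p * ccoef L w (k - p)) = (\<Sum>p\<in>P. ccoef L (\<lambda>z. c p * (emode L p z * w z)) k)"
      by (simp add: ccoef_cmult ccoef_emode_mult)
    also have "\<dots> = ccoef L (\<lambda>z. (\<Sum>p\<in>P. c p * emode L p z) * w z) k"
      unfolding sum_distrib_right mult.assoc using ew by (subst ccoef_sum) auto
    finally have "(\<Sum>p\<in>P. c p * ccoef L w (k - p)) - ccoef L (\<lambda>z. S z * w z) k =
        ccoef L (\<lambda>z. (\<Sum>p\<in>P. c p * emode L p z) * w z - S z * w z) k"
      using ccoef_diff[OF intP Sw] by simp
    also have "norm \<dots> \<le> (\<integral>z. norm ((\<Sum>p\<in>P. c p * emode L p z) * w z - S z * w z) \<partial>Om L) / L\<^sup>2"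
      by (rule norm_ccoef_le[OF assms(1)])
    also have "\<dots> \<le> (\<integral>z. tail P * norm (w z) \<partial>Om L) / L\<^sup>2"
    proof (intro divide_right_mono integral_mono)
      show "norm ((\<Sum>p\<in>P. c p * emode L p z) * w z - S z * w z) \<le> tail P * norm (w z)" for z
        using diff[OF P, of z] unfolding left_diff_distrib[symmetric] norm_mult
        by (intro mult_right_mono) (auto simp: norm_minus_commute)
    qed (use intP Sw w in auto)
    finally show ?thesis by simp
  qed
  have "((\<lambda>P. (\<Sum>p\<in>P. c p * ccoef L w (k - p)) - ccoef L (\<lambda>z. S z * w z) k) \<longlongrightarrow> 0) (finite_subsets_at_top UNIV)"
  proof (rule Lim_null_comparison)
    show "\<forall>\<^sub>F P in finite_subsets_at_top UNIV. norm ((\<Sum>p\<in>P. c p * ccoef L w (k - p)) - ccoef L (\<lambda>z. S z * w z) k) \<le> tail P * ((\<integral>z. norm (w z) \<partial>Om L) / L\<^sup>2)"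
      using est by (intro eventually_finite_subsets_at_top_weakI) auto
    show "((\<lambda>P. tail P * ((\<integral>z. norm (w z) \<partial>Om L) / L\<^sup>2)) \<longlongrightarrow> 0) (finite_subsets_at_top UNIV)"
      using tail0 by (rule tendsto_mult_left_zero)
  qed
  then show ?thesis unfolding has_sum_def by (simp add: LIM_zero_iff)
qed

lemma continuous_series:
  assumes "0 < L" and c: "(\<lambda>k. norm (c k)) summable_on UNIV"
  shows "continuous_on UNIV (\<lambda>z. \<Sum>\<^sub>\<infinity>p. c p * emode L p z)"
proof (rule uniform_limit_theorem)
  show "\<forall>\<^sub>F P in finite_subsets_at_top UNIV. continuous_on UNIV (\<lambda>z. \<Sum>p\<in>P. c p * emode L p z)"
    by (intro always_eventually allI continuous_intros continuous_emode)
  show "uniform_limit UNIV (\<lambda>P z. \<Sum>p\<in>P. c p * emode L p z) (\<lambda>z. \<Sum>\<^sub>\<infinity>p. c p * emode L p z) (finite_subsets_at_top UNIV)"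
  proof (rule uniform_limitI)
    fix e :: real assume "0 < e"
    have "(sum (\<lambda>k. norm (c k)) \<longlongrightarrow> (\<Sum>\<^sub>\<infinity>p. norm (c p))) (finite_subsets_at_top UNIV)"
      using c by (rule infsum_tendsto)
    then have "\<forall>\<^sub>F P in finite_subsets_at_top UNIV. dist (\<Sum>p\<in>P. norm (c p)) (\<Sum>\<^sub>\<infinity>p. norm (c p)) < e"
      using \<open>0 < e\<close> by (rule tendstoD)
    moreover have "\<forall>\<^sub>F P in finite_subsets_at_top (UNIV :: (int \<times> int) set). finite P"
      by (rule eventually_finite_subsets_at_top_weakI)
    ultimately show "\<forall>\<^sub>F P in finite_subsets_at_top UNIV. \<forall>z\<in>UNIV. dist (\<Sum>p\<in>P. c p * emode L p z) (\<Sum>\<^sub>\<infinity>p. c p * emode L p z) < e"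
    proof eventually_elim
      case (elim P)
      show ?case
      proof
        fix z
        have "norm ((\<Sum>\<^sub>\<infinity>p. c p * emode L p z) - (\<Sum>p\<in>P. c p * emode L p z)) \<le> (\<Sum>\<^sub>\<infinity>p. norm (c p)) - (\<Sum>p\<in>P. norm (c p))"
          using c elim(2) by (rule series_tail_bound)
        then show "dist (\<Sum>p\<in>P. c p * emode L p z) (\<Sum>\<^sub>\<infinity>p. c p * emode L p z) < e"
          using elim by (simp add: dist_norm norm_minus_commute)
      qed
    qed
  qed
qed simp

lemma ccoef_series:
  assumes "0 < L" and c: "(\<lambda>k. norm (c k)) summable_on UNIV"
  shows "ccoef L (\<lambda>z. \<Sum>\<^sub>\<infinity>p. c p * emode L p z) k = c k"
proof -
  have "integrable (Om L) (\<lambda>z. 1 :: complex)"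
    using assms by (intro integrable_Om_bounded[of _ _ 1]) auto
  from has_sum_ccoef_series_mult[OF assms this refl continuous_measurable_Om[OF continuous_series[OF assms]], of k]
  have "((\<lambda>p. c p * (if p = k then 1 else 0)) has_sum ccoef L (\<lambda>z. \<Sum>\<^sub>\<infinity>p. c p * emode L p z) k) UNIV"
    unfolding ccoef_one[OF assms(1)] by (simp add: eq_commute[of k])
  moreover have "((\<lambda>p. c p * (if p = k then 1 else 0)) has_sum (\<Sum>p\<in>{k}. c p * (if p = k then 1 else 0))) UNIV"
    by (rule has_sum_finite_neutralI[of "{k}"]) auto
  ultimately have "ccoef L (\<lambda>z. \<Sum>\<^sub>\<infinity>p. c p * emode L p z) k = (\<Sum>p\<in>{k}. c p * (if p = k then 1 else 0))"
    by (rule has_sum_unique)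
  then show ?thesis by simp
qed

section \<open>Uniqueness and inversion for continuous periodic functions\<close>

lemma continuous_bounded_square:
  fixes f :: "real \<times> real \<Rightarrow> 'a :: real_normed_vector"
  assumes "continuous_on UNIV f"
  obtains B where "\<And>z. z \<in> {0..L} \<times> {0..L} \<Longrightarrow> norm (f z) \<le> B"
proof -
  have "bounded (f ` ({0..L} \<times> {0..L}))"
    using compact_continuous_image[OF continuous_on_subset[OF assms]] compact_imp_bounded
    by (metis compact_Icc compact_Times subset_UNIV)
  then show ?thesis using that unfolding bounded_iff by auto
qed

lemma omega_subset: "omega L \<subseteq> {0..L} \<times> {0..L}"
  by (auto simp: omega_def)

text \<open>The kernels \<open>((2 + cos (2\<pi>(x - x\<^sub>0)/L) + cos (2\<pi>(y - y\<^sub>0)/L)) / 4) ^ n\<close> are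
  trigonometric polynomials that concentrate at \<open>(x\<^sub>0, y\<^sub>0)\<close>.\<close>

lemma fourier_uniqueness_omega:
  assumes "0 < L" and cont: "continuous_on UNIV v" and zero: "\<And>k. fcoef L v k = 0" and z0: "z0 \<in> omega L"
  shows "v z0 \<le> 0"
proof (rule ccontr)
  assume "\<not> v z0 \<le> 0"
  then have v0: "0 < v z0" by simp
  define p where "p = (\<lambda>z::real \<times> real. (2 + cos (2 * pi / L * (fst z - fst z0)) + cos (2 * pi / L * (snd z - snd z0))) / 4)"
  have p_cont: "continuous_on A p" for A unfolding p_def by (intro continuous_intros) simp_all
  have p0: "0 \<le> p z" "p z \<le> 1" for z
  proof -
    have "0 \<le> 2 + cos a + cos b" "2 + cos a + cos b \<le> 4" for a b :: real
      using cos_ge_minus_one[of a] cos_ge_minus_one[of b] cos_le_one[of a] cos_le_one[of b] by linarith+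
    then show "0 \<le> p z" "p z \<le> 1" unfolding p_def by (auto simp only: zero_le_divide_iff divide_le_eq_1_pos zero_less_numeral zero_le_numeral)
  qed
  have comp: "compact ({0..L} \<times> {0..L})" by (intro compact_Times) auto
  obtain B where B: "\<And>z. z \<in> {0..L} \<times> {0..L} \<Longrightarrow> \<bar>v z\<bar> \<le> B"
    using continuous_bounded_square[OF cont, of L] unfolding real_norm_def by blast
  note om_sub = omega_subset[of L]
  have B0: "0 < B" using B[of z0] om_sub z0 v0 by fastforce
  have int: "integrable (Om L) (\<lambda>z. v z * p z ^ n)" for n
    using assms(1) om_sub
  proof (intro integrable_Om_bounded[of _ _ "B * 1"] continuous_measurable_Om continuous_intros cont p_cont)
    fix z assume "z \<in> omega L"
    then show "norm (v z * p z ^ n) \<le> B * 1"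
      using B[of z] om_sub p0[of z] B0 unfolding real_norm_def abs_mult by (intro mult_mono) (auto simp: power_le_one)
  qed
  \<comment> \<open>The factor \<open>p\<close> combines the constant with four modes of unit
    frequency, so multiplying by it only shifts coefficients. If all of them vanish for one power,
    they vanish for the next.\<close>
  have cz: "ccoef L (\<lambda>z. of_real (v z * p z ^ n)) k = 0" for n k
  proof (induction n arbitrary: k)
    case 0
    then show ?case using zero[of k] by (simp add: fcoef_eq_ccoef)
  next
    case (Suc n)
    let ?g = "\<lambda>z. complex_of_real (v z * p z ^ n)"
    have ig: "integrable (Om L) ?g" using int[of n] by (rule integrable_of_real)
    let ?e = "\<lambda>q z. emode L q z * cnj (emode L q z0)"
    have cosx: "complex_of_real (cos (2 * pi / L * (fst z - fst z0))) = (?e (1, 0) z + ?e (-1, 0) z) / 2" for z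
    proof -
      have "?e (1, 0) z = cis (2 * pi / L * (fst z - fst z0))" "?e (-1, 0) z = cis (- (2 * pi / L * (fst z - fst z0)))"
        unfolding emode_def cis_cnj cis_mult
        by (rule arg_cong[where f=cis], simp add: algebra_simps diff_divide_distrib)+
      then show ?thesis by (simp add: complex_eq_iff)
    qed
    have cosy: "complex_of_real (cos (2 * pi / L * (snd z - snd z0))) = (?e (0, 1) z + ?e (0, -1) z) / 2" for z
    proof -
      have "?e (0, 1) z = cis (2 * pi / L * (snd z - snd z0))" "?e (0, -1) z = cis (- (2 * pi / L * (snd z - snd z0)))"
        unfolding emode_def cis_cnj cis_mult
        by (rule arg_cong[where f=cis], simp add: algebra_simps diff_divide_distrib)+
      then show ?thesis by (simp add: complex_eq_iff)
    qed
    have eq: "complex_of_real (v z * p z ^ Suc n) = (1 / 2) * ?g z + (\<Sum>q\<in>{(1,0),(-1,0),(0,1),(0,-1)}. (cnj (emode L q z0) / 8) * (emode L q z * ?g z))" for z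
    proof -
      have "complex_of_real (p z) = 1 / 2 + (?e (1, 0) z + ?e (-1, 0) z + ?e (0, 1) z + ?e (0, -1) z) / 8"
        unfolding p_def of_real_divide of_real_add cosx cosy by (simp add: field_simps)
      then have "?g z * complex_of_real (p z) = ?g z * (1 / 2 + (?e (1, 0) z + ?e (-1, 0) z + ?e (0, 1) z + ?e (0, -1) z) / 8)"
        by (simp only:)
      moreover have "complex_of_real (v z * p z ^ Suc n) = ?g z * complex_of_real (p z)" by simp
      ultimately have "complex_of_real (v z * p z ^ Suc n) = ?g z * (1 / 2 + (?e (1, 0) z + ?e (-1, 0) z + ?e (0, 1) z + ?e (0, -1) z) / 8)"
        by (simp only:)
      also have "\<dots> = (1 / 2) * ?g z + (\<Sum>q\<in>{(1,0),(-1,0),(0,1),(0,-1)}. (cnj (emode L q z0) / 8) * (emode L q z * ?g z))"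
        by (simp add: field_simps)
      finally show ?thesis .
    qed
    have ieg: "integrable (Om L) (\<lambda>z. emode L q z * ?g z)" for q
      by (rule Bochner_Integration.integrable_bound[OF ig]) (use ig in \<open>auto simp: norm_mult\<close>)
    have isum: "integrable (Om L) (\<lambda>z. \<Sum>q\<in>{(1,0),(-1,0),(0,1),(0,-1)}. (cnj (emode L q z0) / 8) * (emode L q z * ?g z))"
      using ieg by (intro Bochner_Integration.integrable_sum integrable_mult_right) auto
    have "ccoef L (\<lambda>z. complex_of_real (v z * p z ^ Suc n)) k =
      (1 / 2) * ccoef L ?g k + (\<Sum>q\<in>{(1,0),(-1,0),(0,1),(0,-1)}. (cnj (emode L q z0) / 8) * ccoef L ?g (k - q))"
      unfolding eq by (subst ccoef_add[OF integrable_mult_right[OF ig] isum], subst ccoef_sum)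
        (use ieg in \<open>simp_all only: ccoef_cmult ccoef_emode_mult integrable_mult_right\<close>)
    then show ?case unfolding Suc by simp
  qed
  have zero_int: "(\<integral>z. v z * p z ^ n \<partial>Om L) = 0" for n
  proof -
    have "complex_of_real (\<integral>z. v z * p z ^ n \<partial>Om L) = 0"
      using cz[of n 0] assms(1) unfolding ccoef_def by (simp del: of_real_mult of_real_power)
    then show ?thesis by simp
  qed
  obtain d where d: "0 < d" "ball z0 d \<subseteq> omega L" "\<And>z. z \<in> ball z0 d \<Longrightarrow> v z0 / 2 < v z"
  proof -
    have "open (omega L)" unfolding omega_def by (intro open_Times) auto
    moreover have "open {z. v z0 / 2 < v z}" using cont by (intro open_Collect_less continuous_on_const) auto
    ultimately have "open (omega L \<inter> {z. v z0 / 2 < v z})" by (rule open_Int)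
    moreover have "z0 \<in> omega L \<inter> {z. v z0 / 2 < v z}" using z0 v0 by simp
    ultimately obtain d where "0 < d" "ball z0 d \<subseteq> omega L \<inter> {z. v z0 / 2 < v z}"
      by (meson openE)
    then show ?thesis using that[of d] by blast
  qed
  \<comment> \<open>On the closed square \<open>p\<close> equals 1 only at \<open>z0\<close>:
    because \<open>z0\<close> is an interior point, no other point differs from it by a full period.
    Compactness then gives a gap below 1 off the ball.\<close>
  obtain \<rho> where \<rho>: "0 < \<rho>" "\<rho> < 1" "\<And>z. z \<in> omega L - ball z0 d \<Longrightarrow> p z \<le> \<rho>"
  proof -
    let ?K = "{0..L} \<times> {0..L} - ball z0 d"
    have cK: "compact ?K" using comp by (intro compact_diff) auto
    have lt: "p z < 1" if z: "z \<in> ?K" for z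
    proof (rule ccontr)
      assume "\<not> p z < 1"
      moreover have "a = 1 \<and> b = 1" if "a \<le> 1" "b \<le> 1" "\<not> (2 + a + b) / 4 < 1" for a b :: real
        using that by auto
      ultimately have "cos (2 * pi / L * (fst z - fst z0)) = 1 \<and> cos (2 * pi / L * (snd z - snd z0)) = 1"
        unfolding p_def using cos_le_one by blast
      moreover have "x = x0" if "cos (2 * pi / L * (x - x0)) = 1" "x \<in> {0..L}" "x0 \<in> {0<..<L}" for x x0
      proof -
        obtain n :: int where "2 * pi / L * (x - x0) = of_int n * 2 * pi"
          using \<open>cos (2 * pi / L * (x - x0)) = 1\<close> unfolding cos_one_2pi_int by blast
        then have "(2 * pi) * ((x - x0) / L) = (2 * pi) * of_int n" by (simp add: mult_ac)
        then have "(x - x0) / L = of_int n" unfolding mult_cancel_left by auto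
        then have *: "x - x0 = of_int n * L" using assms(1) by (simp add: field_simps)
        have "\<bar>x - x0\<bar> < L" using that by auto
        then have "\<bar>real_of_int n\<bar> * L < 1 * L" unfolding * using assms(1) by (simp add: abs_mult)
        then have "\<bar>real_of_int n\<bar> < 1" using assms(1) by (simp only: mult_less_cancel_right_pos)
        then have "n = 0" by linarith
        then show ?thesis using * by simp
      qed
      ultimately have "z = z0" using z z0 by (auto simp: omega_def prod_eq_iff)
      then show False using z d by simp
    qed
    show ?thesis
    proof (cases "?K = {}")
      case True
      then show ?thesis using that[of "1 / 2"] om_sub by force
    next
      case False
      obtain x where x: "x \<in> ?K" "\<And>z. z \<in> ?K \<Longrightarrow> p z \<le> p x"
        using continuous_attains_sup[OF cK False p_cont] by blast
      then show ?thesis using that[of "max (1 / 2) (p x)"] lt[OF x(1)] om_sub by (force simp: le_max_iff_disj)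
    qed
  qed
  \<comment> \<open>A number strictly between \<open>\<rho>\<close> and 1: the kernel base exceeds
    it near \<open>z0\<close>, where it equals 1, so powers near \<open>z0\<close> eventually
    dominate those off the ball.\<close>
  define \<rho>' where "\<rho>' = (1 + \<rho>) / 2"
  have \<rho>': "\<rho> < \<rho>'" "\<rho>' < 1" "0 < \<rho>'" using \<rho> by (auto simp: \<rho>'_def)
  obtain d' where d': "0 < d'" "d' \<le> d" "\<And>z. z \<in> ball z0 d' \<Longrightarrow> \<rho>' < p z"
  proof -
    have "open {z. \<rho>' < p z}" using p_cont by (intro open_Collect_less continuous_on_const) auto
    moreover have "z0 \<in> {z. \<rho>' < p z}" using \<rho>' by (simp add: p_def)
    ultimately obtain d1 where "0 < d1" "ball z0 d1 \<subseteq> {z. \<rho>' < p z}" by (meson openE)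
    then show ?thesis using that[of "min d d1"] d(1) by fastforce
  qed
  define m where "m = measure (Om L) (ball z0 d')"
  have sub: "ball z0 d' \<subseteq> omega L" using d d' by (meson order_trans subset_ball)
  interpret finite_measure "Om L" using assms(1) by (rule finite_measure_Om)
  have mb [measurable]: "ball z0 d' \<in> sets (Om L)"
    unfolding Om_def using sub by (subst sets_restrict_space_iff) auto
  have m: "0 < m"
  proof -
    have "m = measure lborel (ball z0 d')"
      unfolding m_def Om_def using sub by (intro measure_restrict_space) auto
    then show ?thesis using content_ball_pos[OF d'(1), of z0] by simp
  qed
  \<comment> \<open>Three regions are compared: on the small ball the integrand is at least
    \<open>v z0 / 2 * \<rho>' ^ n\<close>, on the rest of the large ball it is nonnegative, and
    elsewhere it is at least \<open>- B * \<rho> ^ n\<close>. As the integral vanishes, large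
    \<open>n\<close> gives a contradiction.\<close>
  have ineq: "v z0 / 2 * \<rho>' ^ n * m \<le> B * \<rho> ^ n * L\<^sup>2" for n
  proof -
    have "(\<integral>z. v z0 / 2 * \<rho>' ^ n * indicator (ball z0 d') z \<partial>Om L) \<le> (\<integral>z. v z * p z ^ n + B * \<rho> ^ n \<partial>Om L)"
    proof (rule integral_mono)
      show "integrable (Om L) (\<lambda>z. v z0 / 2 * \<rho>' ^ n * indicator (ball z0 d') z)"
        by (intro integrable_mult_right) (simp add: less_top[symmetric])
      show "integrable (Om L) (\<lambda>z. v z * p z ^ n + B * \<rho> ^ n)" using int[of n] by simp
      fix z assume "z \<in> space (Om L)"
      then have z: "z \<in> omega L" by simp
      have nn: "0 \<le> B * \<rho> ^ n" using B0 \<rho> by simp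
      consider "z \<in> ball z0 d'" | "z \<notin> ball z0 d'" "z \<in> ball z0 d" | "z \<notin> ball z0 d" "z \<notin> ball z0 d'"
        using d'(2) by fastforce
      then show "v z0 / 2 * \<rho>' ^ n * indicator (ball z0 d') z \<le> v z * p z ^ n + B * \<rho> ^ n"
      proof cases
        case 1
        then have "z \<in> ball z0 d" using d'(2) by auto
        then have "v z0 / 2 * \<rho>' ^ n \<le> v z * p z ^ n"
          using d(3)[of z] d'(3)[of z] 1 v0 \<rho>' by (intro mult_mono power_mono) auto
        then show ?thesis using 1 nn by simp
      next
        case 2
        then have "0 \<le> v z * p z ^ n" using d(3)[of z] v0 p0[of z] by (intro mult_nonneg_nonneg) auto
        then show ?thesis using 2 nn by simp
      next
        case 3
        have "\<bar>v z * p z ^ n\<bar> \<le> B * \<rho> ^ n"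
          unfolding abs_mult using B[of z] z om_sub \<rho>(3)[of z] 3 p0[of z] B0
          by (intro mult_mono) (auto intro: power_mono)
        then show ?thesis using 3 by simp
      qed
    qed
    also have "\<dots> = B * \<rho> ^ n * L\<^sup>2"
      using int[of n] zero_int[of n] measure_Om[OF assms(1)] by (subst Bochner_Integration.integral_add) auto
    also have "(\<integral>z. v z0 / 2 * \<rho>' ^ n * indicator (ball z0 d') z \<partial>Om L) = v z0 / 2 * \<rho>' ^ n * m"
      using sub by (simp add: m_def Int_absorb2)
    finally show ?thesis .
  qed
  have "(\<lambda>n. B * L\<^sup>2 * (\<rho> / \<rho>') ^ n) \<longlonglongrightarrow> B * L\<^sup>2 * 0"
    using \<rho> \<rho>' by (intro tendsto_intros LIMSEQ_realpow_zero) auto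
  moreover have "v z0 / 2 * m \<le> B * L\<^sup>2 * (\<rho> / \<rho>') ^ n" for n
    using ineq[of n] \<rho>' by (simp add: power_divide field_simps)
  ultimately have "v z0 / 2 * m \<le> B * L\<^sup>2 * 0" by (intro LIMSEQ_le_const) auto
  then have "v z0 / 2 * m \<le> 0" by simp
  moreover have "0 < v z0 / 2 * m" using v0 m by simp
  ultimately show False by linarith
qed

lemma periodic2_shift:
  assumes "periodic2 L v"
  shows "v (x + of_int i * L, y + of_int j * L) = v (x, y)"
proof -
  have px: "v (x + L, y) = v (x, y)" and py: "v (x, y + L) = v (x, y)" for x y
    using assms by (auto simp: periodic2_def)
  have nat1: "v (x + real n * L, y) = v (x, y)" for n x y
  proof (induction n)
    case (Suc n)
    have "x + real (Suc n) * L = (x + real n * L) + L" by (simp add: distrib_right)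
    then show ?case using Suc px by metis
  qed simp
  have nat2: "v (x, y + real n * L) = v (x, y)" for n x y
  proof (induction n)
    case (Suc n)
    have "y + real (Suc n) * L = (y + real n * L) + L" by (simp add: distrib_right)
    then show ?case using Suc py by metis
  qed simp
  have int1: "v (x + of_int i * L, y) = v (x, y)" for i x y
  proof (cases "0 \<le> i")
    case True
    then show ?thesis using nat1[of x "nat i" y] by simp
  next
    case False
    then show ?thesis using nat1[of "x + of_int i * L" "nat (- i)" y] by simp
  qed
  have int2: "v (x, y + of_int i * L) = v (x, y)" for i x y
  proof (cases "0 \<le> i")
    case True
    then show ?thesis using nat2[of x y "nat i"] by simp
  next
    case False
    then show ?thesis using nat2[of x "y + of_int i * L" "nat (- i)"] by simp
  qed
  show ?thesis by (simp add: int1 int2)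
qed

text \<open>Applying \<open>fourier_uniqueness_omega\<close> to \<open>v\<close> and to
  \<open>- v\<close> gives zero on the open square; continuity reaches its closure, and periodicity
  the plane.\<close>

lemma fourier_uniqueness:
  assumes "0 < L" and cont: "continuous_on UNIV v" and per: "periodic2 L v" and zero: "\<And>k. fcoef L v k = 0"
  shows "v z = 0"
proof -
  have om: "v z = 0" if "z \<in> omega L" for z
  proof -
    have "fcoef L (\<lambda>z. - v z) k = 0" for k
      using zero[of k] ccoef_cmult[of L "-1" "\<lambda>z. of_real (v z)" k] by (simp add: fcoef_eq_ccoef)
    then have "- v z \<le> 0" using cont that assms(1) by (intro fourier_uniqueness_omega[of L "\<lambda>z. - v z"] continuous_on_minus)
    moreover have "v z \<le> 0" using fourier_uniqueness_omega[OF assms(1) cont zero that] .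
    ultimately show ?thesis by simp
  qed
  have cl: "v z = 0" if "z \<in> {0..L} \<times> {0..L}" for z
  proof -
    have "closure (omega L) \<subseteq> {z. v z = 0}"
      using om by (intro closure_minimal closed_Collect_eq cont continuous_on_const) auto
    moreover have "closure (omega L) = {0..L} \<times> {0..L}"
      using assms(1) unfolding omega_def closure_Times by simp
    ultimately show ?thesis using that by auto
  qed
  define i j where "i = \<lfloor>fst z / L\<rfloor>" and "j = \<lfloor>snd z / L\<rfloor>"
  have fl: "x - of_int \<lfloor>x / L\<rfloor> * L \<in> {0..L}" for x
  proof -
    have "of_int \<lfloor>x / L\<rfloor> * L \<le> (x / L) * L" "(x / L) * L \<le> (of_int \<lfloor>x / L\<rfloor> + 1) * L"
      using assms(1) by (intro mult_right_mono; linarith)+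
    then show ?thesis using assms(1) by (simp add: algebra_simps)
  qed
  have "v (fst z - of_int i * L, snd z - of_int j * L) = 0"
    unfolding i_def j_def using fl by (intro cl) auto
  then show ?thesis
    using periodic2_shift[OF per, of "fst z - of_int i * L" i "snd z - of_int j * L" j] by simp
qed

lemma emode_periodic:
  assumes "0 < L"
  shows "emode L k (x + L, y) = emode L k (x, y)" and "emode L k (x, y + L) = emode L k (x, y)"
proof -
  have "2 * pi / L * (of_int a * (x + L) + c) = 2 * pi / L * (of_int a * x + c) + 2 * pi * of_int a" for a x c
    using assms by (simp add: field_simps)
  then have *: "cis (2 * pi / L * (of_int a * (x + L) + c)) = cis (2 * pi / L * (of_int a * x + c))" for a x c
    by (simp flip: cis_mult)
  show "emode L k (x + L, y) = emode L k (x, y)" unfolding emode_def fst_conv snd_conv by (rule *)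
  show "emode L k (x, y + L) = emode L k (x, y)" 
    unfolding emode_def fst_conv snd_conv using *[of "snd k" y "of_int (fst k) * x"]
    by (simp only: add.commute[of "of_int (fst k) * x"])
qed

lemma cnj_series:
  assumes sym: "\<And>k. c (- k) = cnj (c k)"
  shows "cnj (\<Sum>\<^sub>\<infinity>p. c p * emode L p z) = (\<Sum>\<^sub>\<infinity>p. c p * emode L p z)"
proof -
  have "cnj (\<Sum>\<^sub>\<infinity>p. c p * emode L p z) = (\<Sum>\<^sub>\<infinity>p. c (- p) * emode L (- p) z)"
    unfolding infsum_cnj[symmetric] by (simp add: sym emode_uminus)
  also have "\<dots> = (\<Sum>\<^sub>\<infinity>p. c p * emode L p z)"
    by (rule infsum_reindex_bij_betw[of uminus UNIV UNIV "\<lambda>p. c p * emode L p z"]) (rule bij_uminus)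
  finally show ?thesis .
qed

text \<open>The function and its series are continuous and have the same coefficients, so uniqueness
  applies to the difference. That result concerns real functions, hence the detour through the
  conjugation symmetry of the coefficients.\<close>

lemma fourier_inversion:
  assumes "0 < L" and cont: "continuous_on UNIV v" and per: "periodic2 L v"
    and sm: "(\<lambda>k. norm (fcoef L v k)) summable_on UNIV"
  shows "of_real (v z) = (\<Sum>\<^sub>\<infinity>p. fcoef L v p * emode L p z)"
proof -
  define S where "S = (\<lambda>z. \<Sum>\<^sub>\<infinity>p. fcoef L v p * emode L p z)"
  have S_cont: "continuous_on UNIV S" unfolding S_def by (rule continuous_series[OF assms(1) sm])
  have "cnj (S z) = S z" for z unfolding S_def by (rule cnj_series) (rule fcoef_uminus)
  then have real: "of_real (Re (S z)) = S z" for z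
    by (metis Reals_cnj_iff of_real_Re)
  have bdd: "integrable (Om L) f" if fc: "continuous_on UNIV f" for f :: "real \<times> real \<Rightarrow> complex"
  proof -
    obtain B where "\<And>z. z \<in> {0..L} \<times> {0..L} \<Longrightarrow> norm (f z) \<le> B"
      using continuous_bounded_square[OF fc, of L] by blast
    moreover have "omega L \<subseteq> {0..L} \<times> {0..L}" by (rule omega_subset)
    ultimately show ?thesis using assms(1) that by (intro integrable_Om_bounded[of _ _ B] continuous_measurable_Om) auto
  qed
  have "v z - Re (S z) = 0"
  proof (rule fourier_uniqueness[OF assms(1)])
    show "continuous_on UNIV (\<lambda>z. v z - Re (S z))" by (intro continuous_intros cont S_cont)
    show "periodic2 L (\<lambda>z. v z - Re (S z))"
      using per emode_periodic[OF assms(1)] by (simp add: periodic2_def S_def)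
    fix k
    have "fcoef L (\<lambda>z. v z - Re (S z)) k = ccoef L (\<lambda>z. of_real (v z) - S z) k"
      unfolding fcoef_eq_ccoef by (simp add: real)
    also have "\<dots> = fcoef L v k - ccoef L S k"
      unfolding fcoef_eq_ccoef by (intro ccoef_diff bdd continuous_intros cont S_cont)
    also have "ccoef L S k = fcoef L v k" unfolding S_def by (rule ccoef_series[OF assms(1) sm])
    finally show "fcoef L (\<lambda>z. v z - Re (S z)) k = 0" by simp
  qed
  then show ?thesis using real[of z] unfolding S_def by simp
qed

section \<open>Sobolev bounds on Fourier coefficients\<close>

text \<open>A bound on the squared Sobolev norm, without the factor \<open>L\<^sup>2\<close>,
  phrased by finite partial sums: it carries summability with it, passes to coefficientwise limits,
  and applies to coefficient families that are not yet known to belong to a function.\<close>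

definition sobolev_le :: "real \<Rightarrow> nat \<Rightarrow> (int \<times> int \<Rightarrow> complex) \<Rightarrow> real \<Rightarrow> bool" where
  "sobolev_le L q c B \<longleftrightarrow> (\<forall>K. finite K \<longrightarrow> (\<Sum>k\<in>K. (1 + freq2 L k) ^ q * (norm (c k))\<^sup>2) \<le> B)"

lemma sobolev_leI: "(\<And>K. finite K \<Longrightarrow> (\<Sum>k\<in>K. (1 + freq2 L k) ^ q * (norm (c k))\<^sup>2) \<le> B) \<Longrightarrow> sobolev_le L q c B"
  by (simp add: sobolev_le_def)

lemma sobolev_leD: "sobolev_le L q c B \<Longrightarrow> finite K \<Longrightarrow> (\<Sum>k\<in>K. (1 + freq2 L k) ^ q * (norm (c k))\<^sup>2) \<le> B"
  by (simp add: sobolev_le_def)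

lemma sobolev_le_nonneg: "sobolev_le L q c B \<Longrightarrow> 0 \<le> B"
  using sobolev_leD[of L q c B "{}"] by simp

lemma sobolev_le_weaken:
  assumes "sobolev_le L q c B" and "q' \<le> q"
  shows "sobolev_le L q' c B"
proof (rule sobolev_leI)
  fix K :: "(int \<times> int) set" assume "finite K"
  have "(\<Sum>k\<in>K. (1 + freq2 L k) ^ q' * (norm (c k))\<^sup>2) \<le> (\<Sum>k\<in>K. (1 + freq2 L k) ^ q * (norm (c k))\<^sup>2)"
    using assms(2) by (intro sum_mono mult_right_mono power_increasing) auto
  then show "(\<Sum>k\<in>K. (1 + freq2 L k) ^ q' * (norm (c k))\<^sup>2) \<le> B"
    using sobolev_leD[OF assms(1) \<open>finite K\<close>] by linarith
qed

lemma sobolev_le_add: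
  assumes "sobolev_le L q c B" and "sobolev_le L q d D"
  shows "sobolev_le L q (\<lambda>k. c k + d k) (2 * B + 2 * D)"
proof (rule sobolev_leI)
  fix K :: "(int \<times> int) set" assume K: "finite K"
  have "(\<Sum>k\<in>K. (1 + freq2 L k) ^ q * (norm (c k + d k))\<^sup>2) \<le>
    (\<Sum>k\<in>K. (1 + freq2 L k) ^ q * (2 * (norm (c k))\<^sup>2 + 2 * (norm (d k))\<^sup>2))"
    by (intro sum_mono mult_left_mono norm_add_sq_le) auto
  also have "\<dots> = 2 * (\<Sum>k\<in>K. (1 + freq2 L k) ^ q * (norm (c k))\<^sup>2) + 2 * (\<Sum>k\<in>K. (1 + freq2 L k) ^ q * (norm (d k))\<^sup>2)"
    by (simp add: distrib_left sum.distrib sum_distrib_left mult_ac)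
  also have "\<dots> \<le> 2 * B + 2 * D"
    using sobolev_leD[OF assms(1) K] sobolev_leD[OF assms(2) K] by (intro add_mono mult_left_mono) auto
  finally show "(\<Sum>k\<in>K. (1 + freq2 L k) ^ q * (norm (c k + d k))\<^sup>2) \<le> 2 * B + 2 * D" .
qed

lemma sobolev_le_cmult:
  assumes "sobolev_le L q c B"
  shows "sobolev_le L q (\<lambda>k. a * c k) ((norm a)\<^sup>2 * B)"
proof (rule sobolev_leI)
  fix K :: "(int \<times> int) set" assume K: "finite K"
  have "(\<Sum>k\<in>K. (1 + freq2 L k) ^ q * (norm (a * c k))\<^sup>2) = (norm a)\<^sup>2 * (\<Sum>k\<in>K. (1 + freq2 L k) ^ q * (norm (c k))\<^sup>2)"
    by (simp add: norm_mult power_mult_distrib sum_distrib_left mult_ac)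
  also have "\<dots> \<le> (norm a)\<^sup>2 * B"
    by (intro mult_left_mono sobolev_leD[OF assms K]) auto
  finally show "(\<Sum>k\<in>K. (1 + freq2 L k) ^ q * (norm (a * c k))\<^sup>2) \<le> (norm a)\<^sup>2 * B" .
qed

text \<open>A factor of \<open>n\<close> powers of \<open>1 + freq2 L k\<close> costs
  \<open>2 * n\<close> orders, because the coefficients enter squared.\<close>

lemma sobolev_le_dominated:
  assumes "sobolev_le L q c B" and "\<And>k. norm (d k) \<le> (1 + freq2 L k) ^ n * norm (c k)" and "q' + 2 * n = q"
  shows "sobolev_le L q' d B"
proof (rule sobolev_leI)
  fix K :: "(int \<times> int) set" assume K: "finite K"
  have "(\<Sum>k\<in>K. (1 + freq2 L k) ^ q' * (norm (d k))\<^sup>2) \<le> (\<Sum>k\<in>K. (1 + freq2 L k) ^ q' * ((1 + freq2 L k) ^ n * norm (c k))\<^sup>2)"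
    by (intro sum_mono mult_left_mono power_mono assms) auto
  also have "\<dots> = (\<Sum>k\<in>K. (1 + freq2 L k) ^ q * (norm (c k))\<^sup>2)"
    unfolding assms(3)[symmetric] by (simp add: power_mult_distrib power_add power_mult power2_eq_square mult_ac)
  also have "\<dots> \<le> B" by (rule sobolev_leD[OF assms(1) K])
  finally show "(\<Sum>k\<in>K. (1 + freq2 L k) ^ q' * (norm (d k))\<^sup>2) \<le> B" .
qed

lemma sobolev_le_laplace:
  assumes "sobolev_le L (q + 2) c B"
  shows "sobolev_le L q (\<lambda>k. - of_real (freq2 L k) * c k) B"
  using assms by (rule sobolev_le_dominated[where n = 1]) (auto simp: norm_mult intro!: mult_right_mono)

text \<open>Order 2 embeds into absolutely convergent Fourier series in two dimensions:
  Cauchy-Schwarz against \<open>1 / (1 + freq2 L k)\<close>, whose squares are summable.\<close>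

lemma sobolev_le_abs_summable:
  assumes "0 < L" and "sobolev_le L q c B" and "2 \<le> q"
  shows "(\<lambda>k. norm (c k)) summable_on UNIV"
proof (rule nonneg_bdd_above_summable_on)
  have s: "sobolev_le L 2 c B" using assms by (auto intro: sobolev_le_weaken)
  show "bdd_above (sum (\<lambda>k. norm (c k)) ` {K. K \<subseteq> UNIV \<and> finite K})"
  proof (rule bdd_aboveI2)
    fix K :: "(int \<times> int) set" assume "K \<in> {K. K \<subseteq> UNIV \<and> finite K}"
    then have K: "finite K" by simp
    have "(\<Sum>k\<in>K. norm (c k))\<^sup>2 = (\<Sum>k\<in>K. (1 / (1 + freq2 L k)) * ((1 + freq2 L k) * norm (c k)))\<^sup>2" by simp
    also have "\<dots> \<le> (\<Sum>k\<in>K. (1 / (1 + freq2 L k))\<^sup>2) * (\<Sum>k\<in>K. ((1 + freq2 L k) * norm (c k))\<^sup>2)"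
      by (rule Cauchy_Schwarz_ineq_sum)
    also have "\<dots> \<le> weight_sum L * B"
      using weight_sum_bound[OF assms(1) K] sobolev_leD[OF s K] weight_sum_pos[OF assms(1)]
      by (intro mult_mono) (auto simp: power_divide power_mult_distrib intro!: sum_nonneg)
    finally show "(\<Sum>k\<in>K. norm (c k)) \<le> sqrt (weight_sum L * B)"
      by (rule real_le_rsqrt)
  qed
qed auto

text \<open>The abstract aliasing estimate. Cauchy-Schwarz inside each class with the weight
  \<open>(1 + freq2 L q) ^ (m + 2)\<close> leaves reciprocals: \<open>m\<close> of them give
  \<open>\<theta> ^ m\<close>, the other two are summable. Since the classes are disjoint, the outer
  sum collects into one Sobolev sum. It is used for proper aliases with
  \<open>\<theta> = (L / M)\<^sup>2\<close>, and for whole classes with \<open>\<theta> = 1\<close>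
  and \<open>m = 0\<close>.\<close>

lemma class_sum_bound:
  fixes S :: "'i \<Rightarrow> (int \<times> int) set"
  assumes "0 < L" and I: "finite I" and disj: "\<And>i j. i \<in> I \<Longrightarrow> j \<in> I \<Longrightarrow> i \<noteq> j \<Longrightarrow> S i \<inter> S j = {}"
    and \<theta>: "0 \<le> \<theta>" "\<And>i q. i \<in> I \<Longrightarrow> q \<in> S i \<Longrightarrow> 1 / (1 + freq2 L q) \<le> \<theta>"
    and B: "sobolev_le L (2 * n + m + 2) c B"
  shows "(\<Sum>i\<in>I. (\<Sum>\<^sub>\<infinity>q\<in>S i. (1 + freq2 L q) ^ n * norm (c q))\<^sup>2) \<le> weight_sum L * \<theta> ^ m * B"
    and "(\<lambda>q. (1 + freq2 L q) ^ n * norm (c q)) summable_on UNIV"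
proof -
  let ?f = "\<lambda>q. (1 + freq2 L q) ^ n * norm (c q)"
  have norm_w: "norm (complex_of_real ((1 + freq2 L q) ^ n) * c q) = (1 + freq2 L q) ^ n * norm (c q)" for q
  proof -
    have "0 \<le> (1 + freq2 L q) ^ n" by (rule zero_le_power) simp
    then show ?thesis unfolding norm_mult norm_of_real by (simp only: abs_of_nonneg)
  qed
  have "sobolev_le L (m + 2) (\<lambda>q. of_real ((1 + freq2 L q) ^ n) * c q) B"
    using B
  proof (rule sobolev_le_dominated[where n = n])
    show "norm (of_real ((1 + freq2 L k) ^ n) * c k) \<le> (1 + freq2 L k) ^ n * norm (c k)" for k
      unfolding norm_w by simp
  qed simp
  then have "(\<lambda>q. norm (of_real ((1 + freq2 L q) ^ n) * c q)) summable_on UNIV"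
    by (rule sobolev_le_abs_summable[OF assms(1)]) simp
  then show sm: "?f summable_on UNIV" unfolding norm_w .
  \<comment> \<open>\<open>sobolev_le\<close> speaks of finite sums only, so the estimate is proved
    for a finite set of frequencies first and then passes to the limit along
    \<open>finite_subsets_at_top\<close>.\<close>
  have fin: "(\<Sum>i\<in>I. (\<Sum>q\<in>Q. if q \<in> S i then ?f q else 0)\<^sup>2) \<le> weight_sum L * \<theta> ^ m * B" if Q: "finite Q" for Q
  proof -
    have one: "(\<Sum>q\<in>Q. if q \<in> S i then ?f q else 0)\<^sup>2 \<le> weight_sum L * \<theta> ^ m * (\<Sum>q\<in>Q \<inter> S i. (1 + freq2 L q) ^ (2 * n + m + 2) * (norm (c q))\<^sup>2)"
      if i: "i \<in> I" for i
    proof -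
      let ?w = "\<lambda>q. sqrt ((1 + freq2 L q) ^ (m + 2))"
      have w: "0 < ?w q" for q by (simp only: real_sqrt_gt_zero zero_less_power one_add_freq2_pos)
      have w2: "(?w q)\<^sup>2 = (1 + freq2 L q) ^ (m + 2)" for q
        by (rule real_sqrt_pow2) (simp only: zero_le_power less_imp_le one_add_freq2_pos)
      have "(\<Sum>q\<in>Q. if q \<in> S i then ?f q else 0) = (\<Sum>q\<in>Q \<inter> S i. ?f q)"
        by (rule sum.inter_restrict[OF Q, symmetric])
      also have "\<dots> = (\<Sum>q\<in>Q \<inter> S i. (1 / ?w q) * (?w q * ?f q))"
      proof (rule sum.cong[OF refl])
        fix q
        show "?f q = (1 / ?w q) * (?w q * ?f q)"
          using w[of q] by (simp only: mult.assoc[symmetric] divide_self_if times_divide_eq_left mult_1_left less_imp_neq[symmetric] if_False)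
      qed
      finally have "(\<Sum>q\<in>Q. if q \<in> S i then ?f q else 0)\<^sup>2 \<le> (\<Sum>q\<in>Q \<inter> S i. (1 / ?w q)\<^sup>2) * (\<Sum>q\<in>Q \<inter> S i. (?w q * ?f q)\<^sup>2)"
        using Cauchy_Schwarz_ineq_sum[of "\<lambda>q. 1 / ?w q" "\<lambda>q. ?w q * ?f q" "Q \<inter> S i"] by (simp only:)
      also have "(\<Sum>q\<in>Q \<inter> S i. (?w q * ?f q)\<^sup>2) = (\<Sum>q\<in>Q \<inter> S i. (1 + freq2 L q) ^ (2 * n + m + 2) * (norm (c q))\<^sup>2)"
      proof (rule sum.cong[OF refl])
        fix q
        have e: "2 * n + m + 2 = (m + 2) + n * 2" by simp
        show "(?w q * ?f q)\<^sup>2 = (1 + freq2 L q) ^ (2 * n + m + 2) * (norm (c q))\<^sup>2"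
          unfolding e power_mult_distrib w2 power_add[of _ "m + 2" "n * 2"] power_mult[of _ n 2] by (simp only: mult.assoc)
      qed
      also have "(\<Sum>q\<in>Q \<inter> S i. (1 / ?w q)\<^sup>2) * (\<Sum>q\<in>Q \<inter> S i. (1 + freq2 L q) ^ (2 * n + m + 2) * (norm (c q))\<^sup>2)
          \<le> weight_sum L * \<theta> ^ m * (\<Sum>q\<in>Q \<inter> S i. (1 + freq2 L q) ^ (2 * n + m + 2) * (norm (c q))\<^sup>2)"
      proof (rule mult_right_mono)
        have "(\<Sum>q\<in>Q \<inter> S i. (1 / ?w q)\<^sup>2) = (\<Sum>q\<in>Q \<inter> S i. (1 / (1 + freq2 L q)) ^ m * (1 / (1 + freq2 L q) ^ 2))"
          unfolding power_divide w2 power_add by simp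
        also have "\<dots> \<le> (\<Sum>q\<in>Q \<inter> S i. \<theta> ^ m * (1 / (1 + freq2 L q) ^ 2))"
          using \<theta>(2)[OF i] by (intro sum_mono mult_right_mono power_mono) auto
        also have "\<dots> = \<theta> ^ m * (\<Sum>q\<in>Q \<inter> S i. 1 / (1 + freq2 L q) ^ 2)" by (simp add: sum_distrib_left)
        also have "\<dots> \<le> \<theta> ^ m * weight_sum L"
          using Q \<theta>(1) by (intro mult_left_mono weight_sum_bound assms) auto
        finally show "(\<Sum>q\<in>Q \<inter> S i. (1 / ?w q)\<^sup>2) \<le> weight_sum L * \<theta> ^ m" by (simp add: mult.commute)
      qed (auto intro: sum_nonneg)
      finally show ?thesis .
    qed
    have "(\<Sum>i\<in>I. (\<Sum>q\<in>Q. if q \<in> S i then ?f q else 0)\<^sup>2) \<le>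
       (\<Sum>i\<in>I. weight_sum L * \<theta> ^ m * (\<Sum>q\<in>Q \<inter> S i. (1 + freq2 L q) ^ (2 * n + m + 2) * (norm (c q))\<^sup>2))"
      using one by (rule sum_mono)
    also have "\<dots> = weight_sum L * \<theta> ^ m * (\<Sum>q\<in>(\<Union>i\<in>I. Q \<inter> S i). (1 + freq2 L q) ^ (2 * n + m + 2) * (norm (c q))\<^sup>2)"
      using I Q disj by (subst sum.UNION_disjoint) (auto simp: sum_distrib_left)
    also have "\<dots> \<le> weight_sum L * \<theta> ^ m * B"
      using I Q \<theta>(1) weight_sum_pos[OF assms(1)] by (intro mult_left_mono sobolev_leD[OF B]) auto
    finally show ?thesis .
  qed
  have lim: "((\<lambda>Q. \<Sum>q\<in>Q. if q \<in> S i then ?f q else 0) \<longlongrightarrow> (\<Sum>\<^sub>\<infinity>q\<in>S i. ?f q)) (finite_subsets_at_top UNIV)" for i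
  proof -
    have "(?f has_sum (\<Sum>\<^sub>\<infinity>q\<in>S i. ?f q)) (S i)"
      by (intro has_sum_infsum summable_on_subset_banach[OF sm]) auto
    then have "((\<lambda>q. if q \<in> S i then ?f q else 0) has_sum (\<Sum>\<^sub>\<infinity>q\<in>S i. ?f q)) UNIV"
      by (subst has_sum_cong_neutral[where T = "S i" and g = ?f]) auto
    then show ?thesis unfolding has_sum_def .
  qed
  have "((\<lambda>Q. \<Sum>i\<in>I. (\<Sum>q\<in>Q. if q \<in> S i then ?f q else 0)\<^sup>2) \<longlongrightarrow> (\<Sum>i\<in>I. (\<Sum>\<^sub>\<infinity>q\<in>S i. ?f q)\<^sup>2)) (finite_subsets_at_top UNIV)"
    by (intro tendsto_sum tendsto_power lim)
  then show "(\<Sum>i\<in>I. (\<Sum>\<^sub>\<infinity>q\<in>S i. ?f q)\<^sup>2) \<le> weight_sum L * \<theta> ^ m * B"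
    by (rule tendsto_upperbound) (use fin in \<open>auto intro: eventually_finite_subsets_at_top_weakI\<close>)
qed

lemma has_sum_finite_sum:
  fixes f :: "'a \<Rightarrow> 'b \<Rightarrow> 'c :: {topological_comm_monoid_add}"
  assumes "\<And>x. x \<in> X \<Longrightarrow> (f x has_sum s x) A"
  shows "((\<lambda>a. \<Sum>x\<in>X. f x a) has_sum (\<Sum>x\<in>X. s x)) A"
  using assms by (induction X rule: infinite_finite_induct) (auto intro: has_sum_add)

text \<open>The aliasing formula: inserting the Fourier series into the finite grid sum,
  orthogonality on the grid leaves precisely the class of \<open>k\<close>. Continuity is what ties
  the grid values to the coefficients.\<close>

lemma dcoef_has_sum:
  assumes "0 < L" and "0 < M" and cont: "continuous_on UNIV v" and per: "periodic2 L v"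
    and sm: "(\<lambda>k. norm (fcoef L v k)) summable_on UNIV"
  shows "(fcoef L v has_sum dcoef L M (\<lambda>z. of_real (v z)) k) (aliases M k)"
proof -
  have "((\<lambda>q. fcoef L v q * emode L q z) has_sum of_real (v z)) UNIV" for z
  proof -
    have "(\<lambda>q. fcoef L v q * emode L q z) summable_on UNIV"
      by (rule abs_summable_summable) (use sm in \<open>simp add: norm_mult\<close>)
    then show ?thesis using fourier_inversion[OF assms(1) cont per sm, of z] by simp
  qed
  then have "((\<lambda>q. (cnj (emode L k z) / of_nat (M\<^sup>2)) * (fcoef L v q * emode L q z)) has_sum
      (cnj (emode L k z) / of_nat (M\<^sup>2)) * of_real (v z)) UNIV" for z
    by (rule has_sum_cmult_right)
  then have "((\<lambda>q. \<Sum>z\<in>grid L M. (cnj (emode L k z) / of_nat (M\<^sup>2)) * (fcoef L v q * emode L q z)) has_sum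
      (\<Sum>z\<in>grid L M. (cnj (emode L k z) / of_nat (M\<^sup>2)) * of_real (v z))) UNIV"
    by (intro has_sum_finite_sum)
  moreover have "(\<Sum>z\<in>grid L M. (cnj (emode L k z) / of_nat (M\<^sup>2)) * of_real (v z)) = dcoef L M (\<lambda>z. of_real (v z)) k"
    by (simp add: dcoef_def sum_divide_distrib mult_ac)
  moreover have "(\<Sum>z\<in>grid L M. (cnj (emode L k z) / of_nat (M\<^sup>2)) * (fcoef L v q * emode L q z)) = fcoef L v q * (if q \<in> aliases M k then 1 else 0)" for q
    unfolding dcoef_emode[OF assms(1,2), symmetric] by (simp add: dcoef_def sum_divide_distrib sum_distrib_left mult_ac)
  ultimately have "((\<lambda>q. fcoef L v q * (if q \<in> aliases M k then 1 else 0)) has_sum dcoef L M (\<lambda>z. of_real (v z)) k) UNIV"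
    by simp
  then show ?thesis
    by (subst has_sum_cong_neutral[where S = UNIV and f = "\<lambda>q. fcoef L v q * (if q \<in> aliases M k then 1 else 0)", symmetric]) auto
qed

section \<open>Square integrable functions\<close>

lemma L2perD:
  assumes "L2per L v"
  shows "periodic2 L v" and "v \<in> borel_measurable (Om L)" and "integrable (Om L) (\<lambda>z. (v z)\<^sup>2)"
  using assms unfolding L2per_def set_integrable_omega by (auto intro: measurable_Om)

lemma integral_abs_le:
  assumes "0 < L" and v: "v \<in> borel_measurable (Om L)" "integrable (Om L) (\<lambda>z. (v z :: real)\<^sup>2)"
  shows "integrable (Om L) v" and "(\<integral>z. \<bar>v z\<bar> \<partial>Om L) \<le> L * sqrt (\<integral>z. (v z)\<^sup>2 \<partial>Om L)"
proof -
  interpret finite_measure "Om L" using assms(1) by (rule finite_measure_Om)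
  show iv: "integrable (Om L) v"
  proof (rule Bochner_Integration.integrable_bound)
    show "integrable (Om L) (\<lambda>z. (v z)\<^sup>2 + 1)" using v by simp
    show "AE z in Om L. norm (v z) \<le> norm ((v z)\<^sup>2 + 1)"
    proof (rule AE_I2)
      fix z
      have "2 * \<bar>v z\<bar> * 1 \<le> \<bar>v z\<bar>\<^sup>2 + 1\<^sup>2" by (rule sum_squares_bound)
      then show "norm (v z) \<le> norm ((v z)\<^sup>2 + 1)" by simp
    qed
  qed (rule v)
  define A where "A = (\<integral>z. \<bar>v z\<bar> \<partial>Om L)"
  \<comment> \<open>The mean of \<open>\<bar>v\<bar>\<close>; nonnegativity of the variance is the
    wanted Cauchy-Schwarz inequality.\<close>
  define c where "c = A / L\<^sup>2"
  have "0 \<le> (\<integral>z. (\<bar>v z\<bar> - c)\<^sup>2 \<partial>Om L)" by (rule integral_nonneg_AE) auto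
  also have "\<dots> = (\<integral>z. (v z)\<^sup>2 - 2 * c * \<bar>v z\<bar> + c\<^sup>2 \<partial>Om L)"
    by (simp add: power2_diff algebra_simps)
  also have "\<dots> = (\<integral>z. (v z)\<^sup>2 \<partial>Om L) - 2 * c * A + c\<^sup>2 * L\<^sup>2"
    using iv v measure_Om[OF assms(1)] unfolding A_def
    by (subst Bochner_Integration.integral_add, simp, simp, subst Bochner_Integration.integral_diff) auto
  also have "\<dots> = (\<integral>z. (v z)\<^sup>2 \<partial>Om L) - A\<^sup>2 / L\<^sup>2"
    using assms(1) by (simp add: c_def power2_eq_square field_simps)
  finally have "A\<^sup>2 \<le> L\<^sup>2 * (\<integral>z. (v z)\<^sup>2 \<partial>Om L)" using assms(1) by (simp add: field_simps)
  then have "A \<le> sqrt (L\<^sup>2 * (\<integral>z. (v z)\<^sup>2 \<partial>Om L))" by (rule real_le_rsqrt)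
  then show "A \<le> L * sqrt (\<integral>z. (v z)\<^sup>2 \<partial>Om L)" using assms(1) by (simp add: real_sqrt_mult)
qed

lemma L2per_integrable:
  assumes "0 < L" and "L2per L v"
  shows "integrable (Om L) v"
  by (rule integral_abs_le(1)[OF assms(1) L2perD(2,3)[OF assms(2)]])

lemma L2per_add:
  assumes "L2per L v" and "L2per L w"
  shows "L2per L (\<lambda>z. v z + w z)"
proof -
  have "integrable (Om L) (\<lambda>z. (v z + w z)\<^sup>2)"
  proof (rule Bochner_Integration.integrable_bound)
    show "integrable (Om L) (\<lambda>z. 2 * (v z)\<^sup>2 + 2 * (w z)\<^sup>2)"
      using L2perD(3)[OF assms(1)] L2perD(3)[OF assms(2)] by simp
    show "AE z in Om L. norm ((v z + w z)\<^sup>2) \<le> norm (2 * (v z)\<^sup>2 + 2 * (w z)\<^sup>2)"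
      using norm_add_sq_le[of "v _" "w _"] by (intro AE_I2) simp
    show "(\<lambda>z. (v z + w z)\<^sup>2) \<in> borel_measurable (Om L)"
      using L2perD(2)[OF assms(1)] L2perD(2)[OF assms(2)] by measurable
  qed
  then show ?thesis using assms unfolding L2per_def set_integrable_omega by (auto simp: periodic2_def)
qed

lemma L2per_cmult: "L2per L v \<Longrightarrow> L2per L (\<lambda>z. c * v z)"
  unfolding L2per_def set_integrable_omega by (auto simp: periodic2_def power_mult_distrib)

lemma L2per_sum: "(\<And>j. j \<in> J \<Longrightarrow> L2per L (v j)) \<Longrightarrow> L2per L (\<lambda>z. \<Sum>j\<in>J. v j z)"
proof (induction J rule: infinite_finite_induct)
  case (insert x J)
  then show ?case using L2per_add[of L "v x" "\<lambda>z. \<Sum>j\<in>J. v j z"] by auto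
qed (auto simp: L2per_def set_integrable_omega periodic2_def)

lemma L2per_continuous:
  assumes "0 < L" and "continuous_on UNIV v" and "periodic2 L v"
  shows "L2per L v"
proof -
  obtain B where B: "\<And>z. z \<in> {0..L} \<times> {0..L} \<Longrightarrow> norm (v z) \<le> B"
    using continuous_bounded_square[OF assms(2), of L] by blast
  have "integrable (Om L) (\<lambda>z. (v z)\<^sup>2)"
  proof (rule integrable_Om_bounded[OF assms(1)])
    show "norm ((v z)\<^sup>2) \<le> B\<^sup>2" if "z \<in> omega L" for z
    proof -
      have "z \<in> {0..L} \<times> {0..L}" using that by (auto simp: omega_def)
      from power_mono[OF B[OF this] norm_ge_zero, of 2] show ?thesis unfolding norm_power .
    qed
    show "(\<lambda>z. (v z)\<^sup>2) \<in> borel_measurable (Om L)"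
      by (intro continuous_measurable_Om continuous_intros assms)
  qed
  then show ?thesis
    using assms unfolding L2per_def set_integrable_omega by (auto intro: borel_measurable_continuous_onI)
qed

lemma fcoef_add:
  assumes "0 < L" and "L2per L v" and "L2per L w"
  shows "fcoef L (\<lambda>z. v z + w z) k = fcoef L v k + fcoef L w k"
  unfolding fcoef_eq_ccoef of_real_add
  by (rule ccoef_add; rule integrable_of_real; rule L2per_integrable) fact+

lemma fcoef_cmult: "fcoef L (\<lambda>z. c * v z) k = of_real c * fcoef L v k"
  unfolding fcoef_eq_ccoef of_real_mult by (rule ccoef_cmult)

lemma fcoef_sum:
  assumes "0 < L" and "\<And>j. j \<in> J \<Longrightarrow> L2per L (v j)"
  shows "fcoef L (\<lambda>z. \<Sum>j\<in>J. v j z) k = (\<Sum>j\<in>J. fcoef L (v j) k)"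
  unfolding fcoef_eq_ccoef of_real_sum
  by (rule ccoef_sum, rule integrable_of_real, rule L2per_integrable[OF assms(1) assms(2)])

lemma fcoef_cong_AE:
  assumes "L2per L v" and "L2per L w" and "AE z in lborel. v z = w z"
  shows "fcoef L v k = fcoef L w k"
proof -
  have [measurable]: "v \<in> borel_measurable (Om L)" "w \<in> borel_measurable (Om L)"
    by (rule L2perD(2)[OF assms(1)], rule L2perD(2)[OF assms(2)])
  have "(\<integral>z. of_real (v z) * emode L (- k) z \<partial>Om L) = (\<integral>z. of_real (w z) * emode L (- k) z \<partial>Om L)"
  proof (rule integral_cong_AE)
    show "AE z in Om L. complex_of_real (v z) * emode L (- k) z = of_real (w z) * emode L (- k) z"
      using AE_Om[OF assms(3)] by eventually_elim simp
  qed measurable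
  then show ?thesis unfolding fcoef_eq_ccoef ccoef_def by (simp add: emode_uminus)
qed

lemma L2norm_nonneg: "0 \<le> L2norm L v"
  unfolding L2norm_def set_integral_omega by (intro real_sqrt_ge_zero integral_nonneg_AE) auto

lemma norm_fcoef_le:
  assumes "0 < L" and "L2per L v"
  shows "norm (fcoef L v k) \<le> L2norm L v / L"
proof -
  have "norm (fcoef L v k) \<le> (\<integral>z. norm (complex_of_real (v z)) \<partial>Om L) / L\<^sup>2"
    unfolding fcoef_eq_ccoef by (rule norm_ccoef_le[OF assms(1)])
  also have "\<dots> \<le> (L * sqrt (\<integral>z. (v z)\<^sup>2 \<partial>Om L)) / L\<^sup>2"
    using integral_abs_le(2)[OF assms(1) L2perD(2,3)[OF assms(2)]] by (intro divide_right_mono) auto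
  also have "\<dots> = L2norm L v / L"
    using assms(1) unfolding L2norm_def set_integral_omega by (simp add: power2_eq_square)
  finally show ?thesis .
qed

section \<open>Products\<close>

lemma fcoef_mult_has_sum:
  assumes "0 < L" and v: "continuous_on UNIV v" "periodic2 L v" "(\<lambda>k. norm (fcoef L v k)) summable_on UNIV"
    and w: "continuous_on UNIV w" "periodic2 L w"
  shows "((\<lambda>p. fcoef L v p * fcoef L w (k - p)) has_sum fcoef L (\<lambda>z. v z * w z) k) UNIV"
proof -
  have "integrable (Om L) (\<lambda>z. complex_of_real (w z))"
    using L2per_integrable[OF assms(1) L2per_continuous[OF assms(1) w]] by simp
  from has_sum_ccoef_series_mult[OF assms(1) v(3) this fourier_inversion[OF assms(1) v] continuous_measurable_Om, of k]
  have "((\<lambda>p. fcoef L v p * ccoef L (\<lambda>z. of_real (w z)) (k - p)) has_sum ccoef L (\<lambda>z. of_real (v z) * of_real (w z)) k) UNIV"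
    using v(1) by (auto intro: continuous_on_of_real)
  then show ?thesis unfolding fcoef_eq_ccoef of_real_mult .
qed

text \<open>The algebra property for orders at least 2, from the convolution bound with
  \<open>\<psi> k p = k - p\<close>. Both index sets are finite at first; for fixed \<open>K\<close>
  the limit in \<open>P\<close> replaces the partial convolutions by the coefficients of the
  product.\<close>

lemma sobolev_le_mult:
  assumes "0 < L" and v: "continuous_on UNIV v" "periodic2 L v" "sobolev_le L q (fcoef L v) B"
    and w: "continuous_on UNIV w" "periodic2 L w" "sobolev_le L q (fcoef L w) D" and q: "2 \<le> q"
  shows "sobolev_le L q (fcoef L (\<lambda>z. v z * w z)) (2 * 4 ^ q * weight_sum L * B * D)"
proof (rule sobolev_leI)
  fix K :: "(int \<times> int) set" assume K: "finite K"
  let ?W = "\<lambda>k. (1 + freq2 L k) ^ q"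
  let ?a = "fcoef L v" and ?b = "fcoef L w"
  have fin: "(\<Sum>k\<in>K. ?W k * (norm (\<Sum>p\<in>P. ?a p * ?b (k - p)))\<^sup>2) \<le> 2 * 4 ^ q * weight_sum L * B * D" if P: "finite P" for P
  proof -
    have "(\<Sum>k\<in>K. ?W k * (norm (\<Sum>p\<in>P. ?a p * ?b (k - p)))\<^sup>2) \<le> (\<Sum>k\<in>K. ?W k * (\<Sum>p\<in>P. norm (?a p) * norm (?b (k - p)))\<^sup>2)"
      by (intro sum_mono mult_left_mono power_mono) (auto intro!: order_trans[OF norm_sum] simp: norm_mult)
    also have "\<dots> \<le> 2 * 4 ^ q * weight_sum L * B * D"
    proof (rule weighted_convolution_bound)
      show "?W k \<le> 4 ^ q * (?W p + ?W (k - p))" for k p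
        using freq2_add_le[of L p "k - p"] by (intro weight_subadditive) auto
      show "(\<Sum>p\<in>P. 1 / ?W p) \<le> weight_sum L"
        using weight_sum_bound_image[OF assms(1) P, of "\<lambda>p. p" q] q by simp
      show "(\<Sum>p\<in>P. 1 / ?W (k - p)) \<le> weight_sum L" for k
        using q P by (intro weight_sum_bound_image assms) (auto simp: inj_on_def)
      show "(\<Sum>p\<in>P. ?W p * (norm (?a p))\<^sup>2) \<le> B" using v(3) P by (rule sobolev_leD)
      show "(\<Sum>k\<in>K. ?W (k - p) * (norm (?b (k - p)))\<^sup>2) \<le> D" for p
      proof -
        have "(\<Sum>k\<in>K. ?W (k - p) * (norm (?b (k - p)))\<^sup>2) = (\<Sum>k\<in>(\<lambda>k. k - p) ` K. ?W k * (norm (?b k))\<^sup>2)"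
          by (subst sum.reindex) (auto simp: inj_on_def)
        also have "\<dots> \<le> D" using K by (intro sobolev_leD[OF w(3)]) auto
        finally show ?thesis .
      qed
      show "0 \<le> D" using w(3) by (rule sobolev_le_nonneg)
    qed auto
    finally show ?thesis .
  qed
  have "((\<lambda>P. \<Sum>p\<in>P. ?a p * ?b (k - p)) \<longlongrightarrow> fcoef L (\<lambda>z. v z * w z) k) (finite_subsets_at_top UNIV)" for k
    using fcoef_mult_has_sum[OF assms(1) v(1,2) sobolev_le_abs_summable[OF assms(1) v(3) q] w(1,2)]
    unfolding has_sum_def .
  then have "((\<lambda>P. \<Sum>k\<in>K. ?W k * (norm (\<Sum>p\<in>P. ?a p * ?b (k - p)))\<^sup>2) \<longlongrightarrow>
      (\<Sum>k\<in>K. ?W k * (norm (fcoef L (\<lambda>z. v z * w z) k))\<^sup>2)) (finite_subsets_at_top UNIV)"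
    by (intro tendsto_sum tendsto_mult tendsto_const tendsto_power tendsto_norm)
  then show "(\<Sum>k\<in>K. ?W k * (norm (fcoef L (\<lambda>z. v z * w z) k))\<^sup>2) \<le> 2 * 4 ^ q * weight_sum L * B * D"
    by (rule tendsto_upperbound) (use fin in \<open>auto intro: eventually_finite_subsets_at_top_weakI\<close>)
qed

section \<open>Existence of the weak Laplacian\<close>

lemma integral_norm_trig_poly:
  assumes "0 < L" and K: "finite K"
  shows "(\<integral>z. (norm (\<Sum>k\<in>K. d k * emode L k z))\<^sup>2 \<partial>Om L) = L\<^sup>2 * (\<Sum>k\<in>K. (norm (d k))\<^sup>2)"
proof -
  have int: "integrable (Om L) (emode L k)" for k
    using assms(1) by (intro integrable_Om_bounded[of _ _ 1]) auto
  have "complex_of_real (\<integral>z. (norm (\<Sum>k\<in>K. d k * emode L k z))\<^sup>2 \<partial>Om L) =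
      (\<integral>z. complex_of_real ((norm (\<Sum>k\<in>K. d k * emode L k z))\<^sup>2) \<partial>Om L)"
    by (rule integral_complex_of_real[symmetric])
  also have "\<dots> = (\<integral>z. (\<Sum>k\<in>K. \<Sum>l\<in>K. d k * cnj (d l) * emode L (k - l) z) \<partial>Om L)"
    unfolding complex_norm_square cnj_sum sum_product emode_diff by (simp add: mult_ac)
  also have "\<dots> = (\<Sum>k\<in>K. \<Sum>l\<in>K. d k * cnj (d l) * (\<integral>z. emode L (k - l) z \<partial>Om L))"
    using int by (subst Bochner_Integration.integral_sum, auto)+
  also have "\<dots> = (\<Sum>k\<in>K. \<Sum>l\<in>K. if k = l then of_real (L\<^sup>2) * (d k * cnj (d l)) else 0)"
    unfolding integral_emode[OF assms(1)] by (intro sum.cong) auto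
  also have "\<dots> = (\<Sum>k\<in>K. of_real (L\<^sup>2) * (d k * cnj (d k)))" using K by simp
  also have "\<dots> = complex_of_real (L\<^sup>2 * (\<Sum>k\<in>K. (norm (d k))\<^sup>2))"
    unfolding complex_norm_square[symmetric] by (simp add: sum_distrib_left)
  finally show ?thesis by (simp only: of_real_eq_iff)
qed

text \<open>Monotone convergence makes the increments absolutely summable almost everywhere, and the
  sum of their moduli serves as a majorant. The limit is written with \<open>lim\<close>, which is
  defined at every point, so that measurability and periodicity of the limit function need no
  correction on a null set.\<close>

lemma L1_telescoping_converges:
  fixes f :: "nat \<Rightarrow> 'a \<Rightarrow> real"
  assumes int: "\<And>n. integrable M (f n)" and le: "\<And>n. (\<integral>x. \<bar>f (Suc n) x - f n x\<bar> \<partial>M) \<le> c * (1 / 2) ^ n"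
  shows "\<exists>g. integrable M g \<and> (AE x in M. (\<lambda>n. f n x) \<longlonglongrightarrow> lim (\<lambda>n. f n x)) \<and> (\<forall>n. AE x in M. \<bar>f n x\<bar> \<le> g x)"
proof -
  let ?d = "\<lambda>n x. f (Suc n) x - f n x"
  have [measurable]: "f n \<in> borel_measurable M" for n using int by auto
  have di: "integrable M (\<lambda>x. \<bar>?d n x\<bar>)" for n using int by auto
  have sm: "summable (\<lambda>n. (\<integral>x. \<bar>?d n x\<bar> \<partial>M))"
  proof (rule summable_comparison_test')
    show "summable (\<lambda>n. c * (1 / 2) ^ n)" by (intro summable_mult summable_geometric) simp
    show "norm (\<integral>x. \<bar>?d n x\<bar> \<partial>M) \<le> c * (1 / 2) ^ n" for n
      using le[of n] by (simp add: integral_nonneg_AE)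
  qed
  have nn: "(\<integral>\<^sup>+x. ennreal \<bar>?d n x\<bar> \<partial>M) = ennreal (\<integral>x. \<bar>?d n x\<bar> \<partial>M)" for n
    by (rule nn_integral_eq_integral[OF di]) simp
  have "(\<integral>\<^sup>+x. (\<Sum>n. ennreal \<bar>?d n x\<bar>) \<partial>M) = (\<Sum>n. \<integral>\<^sup>+x. ennreal \<bar>?d n x\<bar> \<partial>M)"
    by (rule nn_integral_suminf) measurable
  also have "\<dots> \<noteq> \<infinity>"
    unfolding nn infinity_ennreal_def by (rule ennreal_suminf_neq_top[OF sm]) simp
  finally have fin: "(\<integral>\<^sup>+x. (\<Sum>n. ennreal \<bar>?d n x\<bar>) \<partial>M) \<noteq> \<infinity>" .
  have "AE x in M. (\<Sum>n. ennreal \<bar>?d n x\<bar>) \<noteq> \<infinity>"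
    by (rule nn_integral_PInf_AE[OF _ fin]) measurable
  then have AEs: "AE x in M. summable (\<lambda>n. \<bar>?d n x\<bar>)"
  proof eventually_elim
    case (elim x)
    show ?case by (rule summable_suminf_not_top) (use elim in \<open>simp_all add: infinity_ennreal_def\<close>)
  qed
  define g where "g = (\<lambda>x. \<bar>f 0 x\<bar> + (\<Sum>n. \<bar>?d n x\<bar>))"
  have "integrable M (\<lambda>x. \<Sum>n. \<bar>?d n x\<bar>)"
    using di AEs sm by (intro integrable_suminf) auto
  then have "integrable M g" unfolding g_def using int by auto
  moreover have "AE x in M. (\<lambda>n. f n x) \<longlonglongrightarrow> lim (\<lambda>n. f n x)"
    using AEs
  proof eventually_elim
    case (elim x)
    have "summable (\<lambda>n. ?d n x)" using elim by (rule summable_rabs_cancel)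
    then have "(\<lambda>n. \<Sum>i<n. ?d i x) \<longlonglongrightarrow> suminf (\<lambda>n. ?d n x)" by (rule summable_LIMSEQ)
    moreover have "(\<Sum>i<n. ?d i x) = f n x - f 0 x" for n by (rule sum_lessThan_telescope)
    ultimately have "(\<lambda>n. f n x - f 0 x) \<longlonglongrightarrow> suminf (\<lambda>n. ?d n x)" by simp
    from tendsto_add[OF this tendsto_const[of "f 0 x"]] have "(\<lambda>n. f n x) \<longlonglongrightarrow> suminf (\<lambda>n. ?d n x) + f 0 x"
      by simp
    then have "convergent (\<lambda>n. f n x)" unfolding convergent_def by blast
    then show ?case by (simp add: convergent_LIMSEQ_iff)
  qed
  moreover have "AE x in M. \<bar>f n x\<bar> \<le> g x" for n
    using AEs
  proof eventually_elim
    case (elim x)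
    have "(\<Sum>i<n. ?d i x) = f n x - f 0 x" by (rule sum_lessThan_telescope)
    then have "\<bar>f n x\<bar> \<le> \<bar>f 0 x\<bar> + (\<Sum>i<n. \<bar>?d i x\<bar>)" using sum_abs[of "\<lambda>i. ?d i x" "{..<n}"] by linarith
    also have "\<dots> \<le> g x" unfolding g_def using elim by (intro add_left_mono sum_le_suminf) auto
    finally show ?case .
  qed
  ultimately show ?thesis by blast
qed

text \<open>The coefficient bound of order 1 makes the dyadic partial sums converge geometrically in
  \<open>L\<^sup>1\<close>, so no completeness theorem for \<open>L\<^sup>2\<close> is needed.\<close>

lemma ex_L2per_with_fcoef:
  assumes "0 < L" and d: "sobolev_le L 1 d D" and sym: "\<And>k. d (- k) = cnj (d k)"
  shows "\<exists>w. L2per L w \<and> (\<forall>k. fcoef L w k = d k)"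
proof -
  define K where "K = (\<lambda>n::nat. {- (2 ^ n)..2 ^ n::int} \<times> {- (2 ^ n)..2 ^ n::int})"
  have fK [simp]: "finite (K n)" for n by (simp add: K_def)
  have D0: "0 \<le> D" using d by (rule sobolev_le_nonneg)
  define S where "S = (\<lambda>n z. \<Sum>k\<in>K n. d k * emode L k z)"
  define s where "s = (\<lambda>n z. Re (S n z))"
  have real: "of_real (s n z) = S n z" for n z
  proof -
    have "cnj (S n z) = (\<Sum>k\<in>K n. d (- k) * emode L (- k) z)"
      by (simp add: S_def sym emode_uminus)
    also have "\<dots> = S n z" unfolding S_def
      by (rule sum.reindex_bij_witness[of _ uminus uminus]) (auto simp: K_def)
    finally show ?thesis unfolding s_def by (metis Reals_cnj_iff of_real_Re)
  qed
  have sc: "continuous_on UNIV (s n)" for n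
    unfolding s_def S_def by (intro continuous_intros continuous_emode)
  have sp: "periodic2 L (s n)" for n
    using emode_periodic[OF assms(1)] by (simp add: periodic2_def s_def S_def)
  have sL: "L2per L (s n)" for n using assms(1) sc sp by (rule L2per_continuous)
  have sint: "integrable (Om L) (s n)" for n using assms(1) sL by (rule L2per_integrable)
  have norm_le: "(\<Sum>k\<in>P. (norm (d k))\<^sup>2) \<le> D" if "finite P" for P
    using sobolev_leD[OF sobolev_le_weaken[OF d, of 0] that] by simp
  have s2: "(\<integral>z. (s n z)\<^sup>2 \<partial>Om L) \<le> L\<^sup>2 * D" for n
  proof -
    have "(s n z)\<^sup>2 = (norm (S n z))\<^sup>2" for z unfolding real[symmetric] norm_of_real by simp
    then have "(\<integral>z. (s n z)\<^sup>2 \<partial>Om L) = L\<^sup>2 * (\<Sum>k\<in>K n. (norm (d k))\<^sup>2)"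
      using integral_norm_trig_poly[OF assms(1) fK] by (simp add: S_def)
    also have "\<dots> \<le> L\<^sup>2 * D" by (intro mult_left_mono norm_le) auto
    finally show ?thesis .
  qed
  define \<alpha> where "\<alpha> = (2 * pi / L)\<^sup>2"
  have \<alpha>: "0 < \<alpha>" using assms(1) by (simp add: \<alpha>_def)
  \<comment> \<open>Outside \<open>K n\<close> some component is at least \<open>2 ^ n\<close>, so
    one order of weight gains the factor \<open>\<alpha> * 4 ^ n\<close> in the squared
    \<open>L\<^sup>2\<close> norm. Its root is the source of the geometric ratio 1/2.\<close>
  have diff: "(\<integral>z. \<bar>s (Suc n) z - s n z\<bar> \<partial>Om L) \<le> L\<^sup>2 * sqrt (D / \<alpha>) * (1 / 2) ^ n" for n
  proof -
    let ?P = "K (Suc n) - K n"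
    have sub: "K n \<subseteq> K (Suc n)" unfolding K_def by auto
    have dS: "S (Suc n) z - S n z = (\<Sum>k\<in>?P. d k * emode L k z)" for z
      unfolding S_def using sub by (subst sum_diff) auto
    have sq: "(s (Suc n) z - s n z)\<^sup>2 = (norm (\<Sum>k\<in>?P. d k * emode L k z))\<^sup>2" for z
      unfolding dS[symmetric] real[symmetric] of_real_diff[symmetric] norm_of_real by simp
    have "(\<integral>z. \<bar>s (Suc n) z - s n z\<bar> \<partial>Om L) \<le> L * sqrt (\<integral>z. (s (Suc n) z - s n z)\<^sup>2 \<partial>Om L)"
    proof (rule integral_abs_le(2)[OF assms(1)])
      have "L2per L (\<lambda>z. s (Suc n) z + (- 1) * s n z)" by (intro L2per_add L2per_cmult sL)
      from L2perD(2,3)[OF this]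
      show "(\<lambda>z. s (Suc n) z - s n z) \<in> borel_measurable (Om L)" "integrable (Om L) (\<lambda>z. (s (Suc n) z - s n z)\<^sup>2)"
        by simp_all
    qed
    also have "(\<integral>z. (s (Suc n) z - s n z)\<^sup>2 \<partial>Om L) = L\<^sup>2 * (\<Sum>k\<in>?P. (norm (d k))\<^sup>2)"
      unfolding sq by (rule integral_norm_trig_poly[OF assms(1)]) simp
    also have "L * sqrt (L\<^sup>2 * (\<Sum>k\<in>?P. (norm (d k))\<^sup>2)) \<le> L * sqrt (L\<^sup>2 * (D / (\<alpha> * 4 ^ n)))"
    proof (intro mult_left_mono real_sqrt_le_mono)
      have ge: "\<alpha> * 4 ^ n \<le> 1 + freq2 L k" if "k \<in> ?P" for k
      proof -
        have "2 ^ n \<le> \<bar>fst k\<bar> \<or> 2 ^ n \<le> \<bar>snd k\<bar>" using that unfolding K_def by (cases k) auto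
        then have "((2::real) ^ n)\<^sup>2 \<le> (of_int (fst k))\<^sup>2 + (of_int (snd k))\<^sup>2"
        proof
          assume "2 ^ n \<le> \<bar>fst k\<bar>"
          then have "real_of_int (2 ^ n) \<le> real_of_int \<bar>fst k\<bar>" by (simp only: of_int_le_iff)
          then have "\<bar>(2::real) ^ n\<bar> \<le> \<bar>of_int (fst k)\<bar>" by simp
          then have "((2::real) ^ n)\<^sup>2 \<le> (of_int (fst k))\<^sup>2" by (simp only: abs_le_square_iff)
          then show ?thesis by (simp add: add_increasing2)
        next
          assume "2 ^ n \<le> \<bar>snd k\<bar>"
          then have "real_of_int (2 ^ n) \<le> real_of_int \<bar>snd k\<bar>" by (simp only: of_int_le_iff)
          then have "\<bar>(2::real) ^ n\<bar> \<le> \<bar>of_int (snd k)\<bar>" by simp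
          then have "((2::real) ^ n)\<^sup>2 \<le> (of_int (snd k))\<^sup>2" by (simp only: abs_le_square_iff)
          then show ?thesis by (simp add: add_increasing)
        qed
        moreover have "((2::real) ^ n)\<^sup>2 = 4 ^ n" by (simp add: power2_eq_square flip: power_mult_distrib)
        ultimately have "\<alpha> * 4 ^ n \<le> freq2 L k" unfolding freq2_def \<alpha>_def by (intro mult_left_mono) auto
        then show ?thesis by simp
      qed
      have "(\<Sum>k\<in>?P. (norm (d k))\<^sup>2) * (\<alpha> * 4 ^ n) \<le> (\<Sum>k\<in>?P. (1 + freq2 L k) ^ 1 * (norm (d k))\<^sup>2)"
        unfolding sum_distrib_right
      proof (rule sum_mono)
        fix k assume "k \<in> ?P"
        then have "(\<alpha> * 4 ^ n) * (norm (d k))\<^sup>2 \<le> (1 + freq2 L k) * (norm (d k))\<^sup>2"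
          by (intro mult_right_mono ge) auto
        then show "(norm (d k))\<^sup>2 * (\<alpha> * 4 ^ n) \<le> (1 + freq2 L k) ^ 1 * (norm (d k))\<^sup>2"
          by (simp add: mult.commute)
      qed
      also have "\<dots> \<le> D" by (rule sobolev_leD[OF d]) simp
      finally show "(\<Sum>k\<in>?P. (norm (d k))\<^sup>2) \<le> D / (\<alpha> * 4 ^ n)" using \<alpha> by (simp add: pos_le_divide_eq)
    qed (use assms(1) in auto)
    also have "L * sqrt (L\<^sup>2 * (D / (\<alpha> * 4 ^ n))) = L\<^sup>2 * sqrt (D / \<alpha>) * (1 / 2) ^ n"
    proof -
      have "(4::real) ^ n = (2 ^ n)\<^sup>2" by (simp add: power2_eq_square flip: power_mult_distrib)
      then have "sqrt (4 ^ n) = (2::real) ^ n" by simp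
      then show ?thesis using assms(1)
        by (simp add: real_sqrt_mult real_sqrt_divide power2_eq_square power_one_over)
    qed
    finally show ?thesis .
  qed
  obtain g where g: "integrable (Om L) g" "AE z in Om L. (\<lambda>n. s n z) \<longlonglongrightarrow> lim (\<lambda>n. s n z)" "\<And>n. AE z in Om L. \<bar>s n z\<bar> \<le> g z"
    using L1_telescoping_converges[OF sint diff] by blast
  define w where "w = (\<lambda>z. lim (\<lambda>n. s n z))"
  have wm: "w \<in> borel_measurable borel"
    unfolding w_def by (intro borel_measurable_lim_metric borel_measurable_continuous_onI sc)
  have wm' [measurable]: "w \<in> borel_measurable (Om L)" using wm by (rule measurable_Om)
  have [measurable]: "s n \<in> borel_measurable (Om L)" for n using sint by auto
  \<comment> \<open>Convergence almost everywhere and the uniform bound \<open>s2\<close> give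
    square integrability by Fatou's lemma.\<close>
  have wi: "integrable (Om L) (\<lambda>z. (w z)\<^sup>2)"
  proof (rule integrableI_bounded)
    have "(\<integral>\<^sup>+z. ennreal (norm ((w z)\<^sup>2)) \<partial>Om L) = (\<integral>\<^sup>+z. liminf (\<lambda>n. ennreal ((s n z)\<^sup>2)) \<partial>Om L)"
    proof (rule nn_integral_cong_AE)
      show "AE z in Om L. ennreal (norm ((w z)\<^sup>2)) = liminf (\<lambda>n. ennreal ((s n z)\<^sup>2))"
        using g(2)
      proof eventually_elim
        case (elim z)
        then have "(\<lambda>n. ennreal ((s n z)\<^sup>2)) \<longlonglongrightarrow> ennreal ((w z)\<^sup>2)"
          unfolding w_def by (intro tendsto_ennrealI tendsto_power)
        then have "liminf (\<lambda>n. ennreal ((s n z)\<^sup>2)) = ennreal ((w z)\<^sup>2)"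
          by (rule lim_imp_Liminf[OF trivial_limit_sequentially])
        then show ?case by simp
      qed
    qed
    also have "\<dots> \<le> liminf (\<lambda>n. \<integral>\<^sup>+z. ennreal ((s n z)\<^sup>2) \<partial>Om L)"
      by (rule nn_integral_liminf) measurable
    also have "\<dots> \<le> ennreal (L\<^sup>2 * D)"
    proof (rule Liminf_le[OF trivial_limit_sequentially], intro always_eventually allI)
      fix n
      have "(\<integral>\<^sup>+z. ennreal ((s n z)\<^sup>2) \<partial>Om L) = ennreal (\<integral>z. (s n z)\<^sup>2 \<partial>Om L)"
        by (rule nn_integral_eq_integral[OF L2perD(3)[OF sL]]) simp
      then show "(\<integral>\<^sup>+z. ennreal ((s n z)\<^sup>2) \<partial>Om L) \<le> ennreal (L\<^sup>2 * D)"
        using s2[of n] by (simp only: ennreal_leI)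
    qed
    finally have "(\<integral>\<^sup>+z. ennreal (norm ((w z)\<^sup>2)) \<partial>Om L) \<le> ennreal (L\<^sup>2 * D)" .
    then show "(\<integral>\<^sup>+z. ennreal (norm ((w z)\<^sup>2)) \<partial>Om L) < \<infinity>"
      unfolding infinity_ennreal_def by (rule le_less_trans[OF _ ennreal_less_top])
  qed measurable
  have wL: "L2per L w"
    unfolding L2per_def set_integrable_omega using wi wm sp by (simp add: periodic2_def w_def)
  moreover have "fcoef L w k = d k" for k
  proof -
    have "(\<lambda>n. \<integral>z. of_real (s n z) * emode L (- k) z \<partial>Om L) \<longlonglongrightarrow> (\<integral>z. of_real (w z) * emode L (- k) z \<partial>Om L)"
    proof (rule integral_dominated_convergence[where w = g])
      show "AE z in Om L. (\<lambda>n. complex_of_real (s n z) * emode L (- k) z) \<longlonglongrightarrow> of_real (w z) * emode L (- k) z"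
        using g(2) by eventually_elim (auto simp: w_def intro!: tendsto_intros)
      show "AE z in Om L. norm (complex_of_real (s n z) * emode L (- k) z) \<le> g z" for n
        using g(3)[of n] by eventually_elim (simp add: norm_mult)
      show "(\<lambda>z. complex_of_real (w z) * emode L (- k) z) \<in> borel_measurable (Om L)" by measurable
      show "(\<lambda>z. complex_of_real (s n z) * emode L (- k) z) \<in> borel_measurable (Om L)" for n by measurable
      show "integrable (Om L) g" by (rule g(1))
    qed
    from tendsto_divide[OF this tendsto_const[of "of_real (L\<^sup>2)"]]
    have lim: "(\<lambda>n. fcoef L (s n) k) \<longlonglongrightarrow> fcoef L w k"
      unfolding fcoef_eq_ccoef ccoef_def emode_uminus[symmetric] using assms(1) by simp
    have ev: "\<forall>\<^sub>F n in sequentially. fcoef L (s n) k = d k"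
    proof -
      obtain N where N: "\<bar>fst k\<bar> \<le> 2 ^ N \<and> \<bar>snd k\<bar> \<le> 2 ^ N"
      proof
        define N where "N = nat (max \<bar>fst k\<bar> \<bar>snd k\<bar>)"
        have "max \<bar>fst k\<bar> \<bar>snd k\<bar> = int N" by (simp add: N_def)
        moreover have "int N \<le> 2 ^ N"
        proof -
          have "int N \<le> int (2 ^ N)" using less_exp[of N] by (simp only: of_nat_le_iff less_imp_le)
          then show ?thesis by simp
        qed
        ultimately show "\<bar>fst k\<bar> \<le> 2 ^ N \<and> \<bar>snd k\<bar> \<le> 2 ^ N" by linarith
      qed
      have "fcoef L (s n) k = d k" if "N \<le> n" for n
      proof -
        have "(2::int) ^ N \<le> 2 ^ n" using that by (intro power_increasing) auto
        then have "\<bar>fst k\<bar> \<le> 2 ^ n" "\<bar>snd k\<bar> \<le> 2 ^ n" using N by (blast intro: order_trans)+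
        then have "k \<in> K n" unfolding K_def mem_Times_iff by (auto simp: abs_le_iff)
        have "fcoef L (s n) k = ccoef L (\<lambda>z. \<Sum>q\<in>K n. d q * emode L q z) k"
          unfolding fcoef_eq_ccoef real S_def ..
        also have "\<dots> = (\<Sum>q\<in>K n. ccoef L (\<lambda>z. d q * (emode L q z * 1)) k)"
        proof -
          have "integrable (Om L) (\<lambda>z. d q * emode L q z)" for q
            using assms(1) by (intro integrable_mult_right integrable_Om_bounded[of _ _ 1]) auto
          then show ?thesis by (subst ccoef_sum) auto
        qed
        also have "\<dots> = (\<Sum>q\<in>K n. if q = k then d k else 0)"
          unfolding ccoef_cmult ccoef_emode_mult ccoef_one[OF assms(1)] by (intro sum.cong) auto
        also have "\<dots> = d k" using \<open>k \<in> K n\<close> by simp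
        finally show ?thesis .
      qed
      then show ?thesis unfolding eventually_sequentially by blast
    qed
    have "(\<lambda>n. fcoef L (s n) k) \<longlonglongrightarrow> d k" using ev by (rule tendsto_eventually)
    with lim show ?thesis by (rule LIMSEQ_unique)
  qed
  ultimately show ?thesis by blast
qed

text \<open>\<open>laplacian\<close> is a choice, so its defining property has to be supported by a
  witness. Order 3 is asked for because the Laplacian uses two orders and
  \<open>ex_L2per_with_fcoef\<close> starts from one more.\<close>

lemma is_laplacian_laplacian:
  assumes "0 < L" and "sobolev_le L 3 (fcoef L v) B"
  shows "is_laplacian L v (laplacian L v)"
proof -
  have "sobolev_le L 1 (\<lambda>k. - of_real (freq2 L k) * fcoef L v k) B"
    using assms(2) by (intro sobolev_le_laplace) (simp add: eval_nat_numeral)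
  then have "\<exists>w. L2per L w \<and> (\<forall>k. fcoef L w k = - of_real (freq2 L k) * fcoef L v k)"
    by (rule ex_L2per_with_fcoef[OF assms(1)]) (simp add: fcoef_uminus)
  then have "\<exists>w. is_laplacian L v w" unfolding is_laplacian_def .
  then show ?thesis unfolding laplacian_def by (rule someI_ex)
qed

lemma
  assumes "0 < L" and "sobolev_le L q (fcoef L v) B" and "3 \<le> q"
  shows L2per_laplacian: "L2per L (laplacian L v)"
    and fcoef_laplacian: "fcoef L (laplacian L v) k = - of_real (freq2 L k) * fcoef L v k"
  using is_laplacian_laplacian[OF assms(1) sobolev_le_weaken[OF assms(2,3)]] unfolding is_laplacian_def by blast+

section \<open>Regularity of the exact solution\<close>

lemma Hper_sobolev_le:
  assumes "0 < L" and "Hper L q v" and "Hnorm L q v \<le> C"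
  shows "sobolev_le L q (fcoef L v) (C\<^sup>2 / L\<^sup>2)"
proof (rule sobolev_leI)
  fix K :: "(int \<times> int) set" assume K: "finite K"
  let ?X = "\<Sum>\<^sub>\<infinity>k. (1 + freq2 L k) ^ q * (norm (fcoef L v k))\<^sup>2"
  have X0: "0 \<le> ?X" by (rule infsum_nonneg) simp
  have "(\<Sum>k\<in>K. (1 + freq2 L k) ^ q * (norm (fcoef L v k))\<^sup>2) \<le> ?X"
    using assms(2) K unfolding Hper_def by (intro finite_sum_le_infsum) auto
  also have "?X \<le> C\<^sup>2 / L\<^sup>2"
  proof -
    have "sqrt (L\<^sup>2 * ?X) \<le> C" using assms(3) unfolding Hnorm_def .
    then have "L\<^sup>2 * ?X \<le> C\<^sup>2" by (rule sqrt_le_D)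
    then show ?thesis using assms(1) by (simp add: pos_le_divide_eq mult.commute)
  qed
  finally show "(\<Sum>k\<in>K. (1 + freq2 L k) ^ q * (norm (fcoef L v k))\<^sup>2) \<le> C\<^sup>2 / L\<^sup>2" .
qed

lemma Hnorm_nonneg: "0 \<le> Hnorm L q v"
  unfolding Hnorm_def by (intro real_sqrt_ge_zero mult_nonneg_nonneg infsum_nonneg) auto

lemma fcoef_tendsto:
  assumes "0 < L" and "\<And>r. r \<in> S \<Longrightarrow> L2per L (v r)" and "L2per L w"
    and lim: "((\<lambda>r. L2norm L (\<lambda>z. v r z - w z)) \<longlongrightarrow> 0) Fl" and ev: "\<forall>\<^sub>F r in Fl. r \<in> S"
  shows "((\<lambda>r. fcoef L (v r) k) \<longlongrightarrow> fcoef L w k) Fl"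
proof -
  have "((\<lambda>r. fcoef L (v r) k - fcoef L w k) \<longlongrightarrow> 0) Fl"
  proof (rule Lim_null_comparison)
    show "\<forall>\<^sub>F r in Fl. norm (fcoef L (v r) k - fcoef L w k) \<le> L2norm L (\<lambda>z. v r z - w z) / L"
      using ev
    proof eventually_elim
      case (elim r)
      have d: "L2per L (\<lambda>z. v r z + (- 1) * w z)" using assms elim by (intro L2per_add L2per_cmult)
      have "fcoef L (v r) k - fcoef L w k = fcoef L (\<lambda>z. v r z + (- 1) * w z) k"
        using fcoef_add[OF assms(1) assms(2)[OF elim] L2per_cmult[OF assms(3)], of "-1" k]
          fcoef_cmult[of L "-1" w k] by simp
      also have "norm \<dots> \<le> L2norm L (\<lambda>z. v r z + (- 1) * w z) / L"
        by (rule norm_fcoef_le[OF assms(1) d])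
      finally show ?case by simp
    qed
    show "((\<lambda>r. L2norm L (\<lambda>z. v r z - w z) / L) \<longlongrightarrow> 0) Fl"
      using lim by (rule tendsto_divide_zero)
  qed
  then show ?thesis by (rule LIM_zero_cancel)
qed

text \<open>Strong derivatives enter the argument only through this scalar limit, where uniqueness
  is immediate.\<close>

lemma has_L2_deriv_fcoef:
  assumes "0 < L" and d: "has_L2_deriv L \<Phi> g t S" and "t \<in> S"
  shows "((\<lambda>r. (fcoef L (\<Phi> r) k - fcoef L (\<Phi> t) k) / of_real (r - t)) \<longlongrightarrow> fcoef L g k) (at t within S)"
proof -
  have L2: "L2per L (\<Phi> r)" if "r \<in> S" for r using d that by (simp add: has_L2_deriv_def)
  have eq: "(\<lambda>z. (\<Phi> r z - \<Phi> t z) / (r - t)) = (\<lambda>z. (1 / (r - t)) * \<Phi> r z + (- 1 / (r - t)) * \<Phi> t z)" for r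
    by (simp add: diff_divide_distrib)
  have q: "L2per L (\<lambda>z. (\<Phi> r z - \<Phi> t z) / (r - t))" if "r \<in> S" for r
    unfolding eq using L2 that assms(3) by (intro L2per_add L2per_cmult)
  have c: "fcoef L (\<lambda>z. (\<Phi> r z - \<Phi> t z) / (r - t)) k = (fcoef L (\<Phi> r) k - fcoef L (\<Phi> t) k) / of_real (r - t)" if "r \<in> S" for r
    unfolding eq fcoef_add[OF assms(1) L2per_cmult[OF L2[OF that]] L2per_cmult[OF L2[OF assms(3)]]] fcoef_cmult
    by (simp add: diff_divide_distrib)
  have ev: "\<forall>\<^sub>F r in at t within S. r \<in> S" unfolding eventually_at_filter by simp
  have "((\<lambda>r. fcoef L (\<lambda>z. (\<Phi> r z - \<Phi> t z) / (r - t)) k) \<longlongrightarrow> fcoef L g k) (at t within S)"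
    using d unfolding has_L2_deriv_def by (intro fcoef_tendsto[OF assms(1) q _ _ ev]) auto
  then show ?thesis
    by (rule Lim_transform_eventually) (use ev c in \<open>auto elim: eventually_mono\<close>)
qed

lemma has_L2_deriv_fcoef_continuous:
  assumes "0 < L" and d: "has_L2_deriv L \<Phi> g t S" and "t \<in> S"
  shows "((\<lambda>r. fcoef L (\<Phi> r) k) \<longlongrightarrow> fcoef L (\<Phi> t) k) (at t within S)"
proof -
  have "((\<lambda>r. complex_of_real (r - t)) \<longlongrightarrow> of_real (t - t)) (at t within S)"
    by (intro tendsto_intros)
  from tendsto_mult[OF has_L2_deriv_fcoef[OF assms, of k] this]
  have "((\<lambda>r. (fcoef L (\<Phi> r) k - fcoef L (\<Phi> t) k) / of_real (r - t) * of_real (r - t)) \<longlongrightarrow> 0) (at t within S)"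
    by simp
  moreover have "\<forall>\<^sub>F r in at t within S. (fcoef L (\<Phi> r) k - fcoef L (\<Phi> t) k) / of_real (r - t) * of_real (r - t) = fcoef L (\<Phi> r) k - fcoef L (\<Phi> t) k"
    unfolding eventually_at_filter by (simp del: of_real_diff)
  ultimately have "((\<lambda>r. fcoef L (\<Phi> r) k - fcoef L (\<Phi> t) k) \<longlongrightarrow> 0) (at t within S)"
    by (rule Lim_transform_eventually)
  then show ?thesis by (rule LIM_zero_cancel)
qed

text \<open>Lower semicontinuity: a finite weighted sum is continuous in the finitely many
  coefficients it contains. It carries interior bounds to the end points of the time
  interval.\<close>

lemma sobolev_le_limit:
  assumes "Fl \<noteq> bot" and lim: "\<And>k. ((\<lambda>r. c r k) \<longlongrightarrow> d k) Fl" and ev: "\<forall>\<^sub>F r in Fl. sobolev_le L q (c r) B"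
  shows "sobolev_le L q d B"
proof (rule sobolev_leI)
  fix K :: "(int \<times> int) set" assume K: "finite K"
  have "((\<lambda>r. \<Sum>k\<in>K. (1 + freq2 L k) ^ q * (norm (c r k))\<^sup>2) \<longlongrightarrow> (\<Sum>k\<in>K. (1 + freq2 L k) ^ q * (norm (d k))\<^sup>2)) Fl"
    by (intro tendsto_sum tendsto_mult tendsto_const tendsto_power tendsto_norm lim)
  then show "(\<Sum>k\<in>K. (1 + freq2 L k) ^ q * (norm (d k))\<^sup>2) \<le> B"
    by (rule tendsto_upperbound) (use ev K assms(1) in \<open>auto elim: eventually_mono dest: sobolev_leD\<close>)
qed

lemma sobolev_le_deriv_F:
  assumes "0 < L" and v: "continuous_on UNIV v" "periodic2 L v" "sobolev_le L q (fcoef L v) B" and q: "2 \<le> q"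
  defines "A \<equiv> 2 * 4 ^ q * weight_sum L"
  shows "sobolev_le L q (fcoef L (\<lambda>z. deriv F (v z))) (2 * (A * B * (A * B * B)) + 2 * B)"
    and "L2per L (\<lambda>z. deriv F (v z))"
proof -
  have v2: "continuous_on UNIV (\<lambda>z. v z * v z)" "periodic2 L (\<lambda>z. v z * v z)"
    using v by (auto intro!: continuous_intros simp: periodic2_def)
  have v3: "continuous_on UNIV (\<lambda>z. v z * (v z * v z))" "periodic2 L (\<lambda>z. v z * (v z * v z))"
    using v by (auto intro!: continuous_intros simp: periodic2_def)
  have s2: "sobolev_le L q (fcoef L (\<lambda>z. v z * v z)) (A * B * B)"
    unfolding A_def by (rule sobolev_le_mult) (use assms in auto)
  have s3: "sobolev_le L q (fcoef L (\<lambda>z. v z * (v z * v z))) (A * B * (A * B * B))"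
    unfolding A_def by (rule sobolev_le_mult) (use assms v2 s2 in \<open>auto simp: A_def\<close>)
  have L: "L2per L (\<lambda>z. v z * (v z * v z))" "L2per L v"
    using assms v3 by (auto intro: L2per_continuous)
  have eq: "deriv F (v z) = v z * (v z * v z) + (- 1) * v z" for z
    by (simp add: deriv_F power3_eq_cube)
  show "L2per L (\<lambda>z. deriv F (v z))" unfolding eq using L by (intro L2per_add L2per_cmult)
  have c: "fcoef L (\<lambda>z. deriv F (v z)) = (\<lambda>k. fcoef L (\<lambda>z. v z * (v z * v z)) k + (- 1) * fcoef L v k)"
    unfolding eq using fcoef_add[OF assms(1) L(1) L2per_cmult[OF L(2)], of "-1"] fcoef_cmult[of L "-1" v] by auto
  show "sobolev_le L q (fcoef L (\<lambda>z. deriv F (v z))) (2 * (A * B * (A * B * B)) + 2 * B)"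
    unfolding c using sobolev_le_add[OF s3 sobolev_le_cmult[OF v(3), of "-1"]] by simp
qed

text \<open>Elliptic regularity: by the equation, \<open>\<epsilon>\<^sup>2 \<Delta>\<^sup>2 \<Phi> = \<Delta> F'(\<Phi>) - \<partial>\<^sub>t \<Phi>\<close> is bounded in the
  Sobolev space of order \<open>m + 2\<close>, so \<open>\<Phi>\<close> gains two orders over the assumption.\<close>

lemma solution_regularity:
  assumes "0 < L" and "0 < T" and "0 < \<epsilon>" and "1 \<le> m"
    and sol: "ch_solution L T \<epsilon> \<Phi>0 \<Phi>" and reg: "ch_regular L T m p C0 \<Phi>0 \<Phi>"
  shows "\<exists>B. \<forall>t\<in>{0..T}. sobolev_le L (m + 6) (fcoef L (\<Phi> t)) B"
proof -
  have cont: "continuous_on UNIV (\<Phi> t)" and per: "periodic2 L (\<Phi> t)" if "t \<in> {0..T}" for t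
    using sol that unfolding ch_solution_def by auto
  have L2\<Phi>: "L2per L (\<Phi> t)" if "t \<in> {0..T}" for t
    using assms(1) cont[OF that] per[OF that] by (rule L2per_continuous)
  obtain G where G0: "\<And>t. t \<in> {0<..<T} \<Longrightarrow> G 0 t = \<Phi> t"
    and Gd: "\<And>k t. k < max 2 (p + 1) \<Longrightarrow> t \<in> {0<..<T} \<Longrightarrow> has_L2_deriv L (G k) (G (Suc k) t) t {0<..<T}"
    and Gb: "\<And>t. t \<in> {0<..<T} \<Longrightarrow> (\<forall>k\<le>2. Hper L (m + 4 - k) (G k t)) \<and>
           Hnorm L (m + 4) \<Phi>0 + (\<Sum>k\<le>2. Hnorm L (m + 4 - k) (G k t)) + (\<Sum>k=3..p+1. L2norm L (G k t)) \<le> C0"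
    using reg unfolding ch_regular_def by blast
  define B0 where "B0 = C0\<^sup>2 / L\<^sup>2"
  have Gs: "sobolev_le L (m + 4 - k) (fcoef L (G k t)) B0" if t: "t \<in> {0<..<T}" and "k \<le> 2" for k t
  proof -
    have "Hnorm L (m + 4 - k) (G k t) \<le> (\<Sum>k\<le>2. Hnorm L (m + 4 - k) (G k t))"
      using \<open>k \<le> 2\<close> by (intro member_le_sum) (auto simp: Hnorm_nonneg)
    moreover have "0 \<le> Hnorm L (m + 4) \<Phi>0" "0 \<le> (\<Sum>k=3..p+1. L2norm L (G k t))"
      by (rule Hnorm_nonneg, intro sum_nonneg L2norm_nonneg)
    ultimately have "Hnorm L (m + 4 - k) (G k t) \<le> C0" using Gb[OF t] by linarith
    then show ?thesis using Gb[OF t] \<open>k \<le> 2\<close> unfolding B0_def by (intro Hper_sobolev_le assms(1)) auto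
  qed
  define A where "A = 2 * 4 ^ (m + 4) * weight_sum L"
  define BF where "BF = 2 * (A * B0 * (A * B0 * B0)) + 2 * B0"
  \<comment> \<open>The 8 comes from \<open>(1 + x) ^ 4 \<le> 8 * (1 + x ^ 4)\<close> for
    \<open>x = freq2 L k\<close>, which reduces order \<open>m + 6\<close> to order
    \<open>m + 2\<close> of the coefficients and of their multiples by \<open>x\<^sup>2\<close>. The
    second summand bounds the latter, solved from the equation.\<close>
  define B where "B = 8 * (B0 + (norm (complex_of_real (- 1 / \<epsilon>\<^sup>2)))\<^sup>2 * (2 * B0 + 2 * BF))"
  have interior: "sobolev_le L (m + 6) (fcoef L (\<Phi> t)) B" if t: "t \<in> {0<..<T}" for t
  proof -
    have tI: "t \<in> {0..T}" using t by auto
    let ?c = "fcoef L (\<Phi> t)" and ?f = "fcoef L (\<lambda>z. deriv F (\<Phi> t z))"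
    let ?W = "\<lambda>z. deriv F (\<Phi> t z) - \<epsilon>\<^sup>2 * laplacian L (\<Phi> t) z"
    have c4: "sobolev_le L (m + 4) ?c B0" using Gs[OF t, of 0] G0[OF t] by simp
    have f4: "sobolev_le L (m + 4) ?f BF" and fL: "L2per L (\<lambda>z. deriv F (\<Phi> t z))"
      using sobolev_le_deriv_F[OF assms(1) cont[OF tI] per[OF tI] c4] by (auto simp: BF_def A_def)
    have lapL: "L2per L (laplacian L (\<Phi> t))" and lapc: "\<And>k. fcoef L (laplacian L (\<Phi> t)) k = - of_real (freq2 L k) * ?c k"
      using L2per_laplacian[OF assms(1) c4] fcoef_laplacian[OF assms(1) c4] by auto
    have Wc: "fcoef L ?W k = ?f k + of_real (\<epsilon>\<^sup>2 * freq2 L k) * ?c k" for k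
      using fcoef_add[OF assms(1) fL L2per_cmult[OF lapL], of "- \<epsilon>\<^sup>2" k] fcoef_cmult[of L "- \<epsilon>\<^sup>2" "laplacian L (\<Phi> t)" k] lapc[of k]
      by simp
    have "sobolev_le L (m + 2) (\<lambda>k. of_real (\<epsilon>\<^sup>2 * freq2 L k) * ?c k) ((norm (complex_of_real (- (\<epsilon>\<^sup>2))))\<^sup>2 * B0)"
    proof -
      have "sobolev_le L (m + 2 + 2) ?c B0" using c4 by (simp add: eval_nat_numeral)
      from sobolev_le_cmult[OF sobolev_le_laplace[OF this], of "of_real (- (\<epsilon>\<^sup>2))"] show ?thesis
        by (simp add: mult.assoc)
    qed
    from sobolev_le_add[OF sobolev_le_weaken[OF f4, of "m + 2"] this]
    have "sobolev_le L (m + 2) (fcoef L ?W) (2 * BF + 2 * ((norm (complex_of_real (- (\<epsilon>\<^sup>2))))\<^sup>2 * B0))"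
      by (simp add: Wc[abs_def])
    then have Lc: "fcoef L (laplacian L ?W) k = - of_real (freq2 L k) * fcoef L ?W k" for k
      by (rule fcoef_laplacian[OF assms(1)]) (use \<open>1 \<le> m\<close> in simp)
    have d1: "has_L2_deriv L \<Phi> (laplacian L ?W) t {0..T}"
      using sol t unfolding ch_solution_def by auto
    have d2: "has_L2_deriv L (G 0) (G 1 t) t {0<..<T}" using Gd[of 0 t] t by simp
    \<comment> \<open>The norm bound concerns \<open>G 1 t\<close>, the equation concerns the
      derivative of \<open>\<Phi>\<close>. Both are strong derivatives at \<open>t\<close>, along
      \<open>{0<..<T}\<close> and \<open>{0..T}\<close>, so their coefficients agree by uniqueness
      of limits.\<close>
    have PDE: "fcoef L (G 1 t) k = fcoef L (laplacian L ?W) k" for k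
    proof (rule tendsto_unique)
      have "at t within {0<..<T} = at t" using t by (intro at_within_open) auto
      then show "at t within {0<..<T} \<noteq> bot" by simp
      show "((\<lambda>r. (fcoef L (\<Phi> r) k - fcoef L (\<Phi> t) k) / of_real (r - t)) \<longlongrightarrow> fcoef L (laplacian L ?W) k) (at t within {0<..<T})"
        by (rule tendsto_within_subset[OF has_L2_deriv_fcoef[OF assms(1) d1 tI]]) auto
      have "\<forall>\<^sub>F r in at t within {0<..<T}. r \<in> {0<..<T}" unfolding eventually_at_filter by simp
      then have "\<forall>\<^sub>F r in at t within {0<..<T}. (fcoef L (G 0 r) k - fcoef L (G 0 t) k) / of_real (r - t) =
          (fcoef L (\<Phi> r) k - fcoef L (\<Phi> t) k) / of_real (r - t)"
      proof eventually_elim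
        case (elim r)
        show ?case unfolding G0[OF elim] G0[OF t] ..
      qed
      with has_L2_deriv_fcoef[OF assms(1) d2 t]
      show "((\<lambda>r. (fcoef L (\<Phi> r) k - fcoef L (\<Phi> t) k) / of_real (r - t)) \<longlongrightarrow> fcoef L (G 1 t) k) (at t within {0<..<T})"
        by (rule Lim_transform_eventually)
    qed
    have l2: "of_real ((freq2 L k)\<^sup>2) * ?c k = of_real (- 1 / \<epsilon>\<^sup>2) * (fcoef L (G 1 t) k + of_real (freq2 L k) * ?f k)" for k
    proof -
      have "fcoef L (G 1 t) k + of_real (freq2 L k) * ?f k = of_real (- (\<epsilon>\<^sup>2)) * (of_real ((freq2 L k)\<^sup>2) * ?c k)"
        unfolding PDE Lc Wc by (simp add: power2_eq_square algebra_simps)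
      moreover have "complex_of_real (- 1 / \<epsilon>\<^sup>2) * of_real (- (\<epsilon>\<^sup>2)) = 1"
        unfolding of_real_mult[symmetric] using assms(3) by simp
      ultimately show ?thesis by (metis mult.assoc mult_1)
    qed
    have "sobolev_le L (m + 2) (\<lambda>k. of_real (freq2 L k) * ?f k) BF"
    proof -
      have "sobolev_le L (m + 2 + 2) ?f BF" using f4 by (simp add: eval_nat_numeral)
      from sobolev_le_cmult[OF sobolev_le_laplace[OF this], of "-1"] show ?thesis by simp
    qed
    moreover have "sobolev_le L (m + 2) (fcoef L (G 1 t)) B0"
      using Gs[OF t, of 1] by (rule sobolev_le_weaken) auto
    ultimately have "sobolev_le L (m + 2) (\<lambda>k. of_real (- 1 / \<epsilon>\<^sup>2) * (fcoef L (G 1 t) k + of_real (freq2 L k) * ?f k))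
        ((norm (complex_of_real (- 1 / \<epsilon>\<^sup>2)))\<^sup>2 * (2 * B0 + 2 * BF))"
      by (intro sobolev_le_cmult sobolev_le_add)
    then have l2s: "sobolev_le L (m + 2) (\<lambda>k. of_real ((freq2 L k)\<^sup>2) * ?c k) ((norm (complex_of_real (- 1 / \<epsilon>\<^sup>2)))\<^sup>2 * (2 * B0 + 2 * BF))"
      unfolding l2 .
    have c2: "sobolev_le L (m + 2) ?c B0" using c4 by (rule sobolev_le_weaken) simp
    show ?thesis
    proof (rule sobolev_leI)
      fix K :: "(int \<times> int) set" assume K: "finite K"
      have "(\<Sum>k\<in>K. (1 + freq2 L k) ^ (m + 6) * (norm (?c k))\<^sup>2) \<le>
        (\<Sum>k\<in>K. 8 * ((1 + freq2 L k) ^ (m + 2) * (norm (?c k))\<^sup>2 + (1 + freq2 L k) ^ (m + 2) * (norm (of_real ((freq2 L k)\<^sup>2) * ?c k))\<^sup>2))"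
      proof (rule sum_mono)
        fix k
        let ?x = "freq2 L k" and ?y = "(1 + freq2 L k) ^ (m + 2) * (norm (?c k))\<^sup>2"
        have a: "(u + v)\<^sup>2 \<le> 2 * u\<^sup>2 + 2 * v\<^sup>2" for u v :: real
          using sum_squares_bound[of u v] by (simp add: power2_sum)
        have "(1 + ?x) ^ 4 = ((1 + ?x)\<^sup>2)\<^sup>2" by simp
        also have "\<dots> \<le> (2 * 1\<^sup>2 + 2 * ?x\<^sup>2)\<^sup>2" by (intro power_mono a) auto
        also have "\<dots> \<le> 2 * (2 * 1\<^sup>2)\<^sup>2 + 2 * (2 * ?x\<^sup>2)\<^sup>2" by (rule a)
        finally have "(1 + ?x) ^ 4 \<le> 8 * (1 + (?x\<^sup>2)\<^sup>2)" by (simp add: power_mult_distrib)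
        then have le: "(1 + ?x) ^ 4 * ?y \<le> 8 * (1 + (?x\<^sup>2)\<^sup>2) * ?y" by (rule mult_right_mono) simp
        have e: "m + 6 = 4 + (m + 2)" by simp
        have "(1 + ?x) ^ (m + 6) * (norm (?c k))\<^sup>2 = (1 + ?x) ^ 4 * ?y"
          unfolding e power_add[of _ 4 "m + 2"] by (simp only: mult.assoc)
        also note le
        also have "8 * (1 + (?x\<^sup>2)\<^sup>2) * ?y = 8 * (?y + (1 + ?x) ^ (m + 2) * ((?x\<^sup>2)\<^sup>2 * (norm (?c k))\<^sup>2))"
        proof -
          have "8 * (1 + X) * (W * N) = 8 * (W * N + W * (X * N))" for X W N :: real by (simp add: algebra_simps)
          then show ?thesis .
        qed
        also have "(?x\<^sup>2)\<^sup>2 * (norm (?c k))\<^sup>2 = (norm (of_real (?x\<^sup>2) * ?c k))\<^sup>2"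
          unfolding norm_mult norm_of_real power_mult_distrib power2_abs ..
        finally show "(1 + ?x) ^ (m + 6) * (norm (?c k))\<^sup>2 \<le>
           8 * (?y + (1 + ?x) ^ (m + 2) * (norm (of_real (?x\<^sup>2) * ?c k))\<^sup>2)" .
      qed
      also have "\<dots> = 8 * ((\<Sum>k\<in>K. (1 + freq2 L k) ^ (m + 2) * (norm (?c k))\<^sup>2) +
         (\<Sum>k\<in>K. (1 + freq2 L k) ^ (m + 2) * (norm (of_real ((freq2 L k)\<^sup>2) * ?c k))\<^sup>2))"
        unfolding sum_distrib_left[symmetric] sum.distrib ..
      also have "\<dots> \<le> B" unfolding B_def
        using sobolev_leD[OF c2 K] sobolev_leD[OF l2s K] by (intro mult_left_mono add_mono) auto
      finally show "(\<Sum>k\<in>K. (1 + freq2 L k) ^ (m + 6) * (norm (?c k))\<^sup>2) \<le> B" .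
    qed
  qed
  \<comment> \<open>The assumed bounds hold for \<open>0 < t < T\<close> only. The initial time is
    reached through the \<open>L\<^sup>2\<close> limit in the definition of a solution, the final
    time through differentiability there.\<close>
  have left: "at 0 within {0<..<T} \<noteq> bot" and right: "at T within {0<..<T} \<noteq> bot"
    using assms(2) islimpt_greaterThanLessThan1[of 0 T] islimpt_greaterThanLessThan2[of 0 T]
    by (simp_all add: trivial_limit_within)
  have evI: "\<forall>\<^sub>F r in at t within {0<..<T}. r \<in> {0<..<T}" for t unfolding eventually_at_filter by simp
  then have evs: "\<forall>\<^sub>F r in at t within {0<..<T}. sobolev_le L (m + 6) (fcoef L (\<Phi> r)) B" for t
    by (rule eventually_mono[OF _ interior])
  have "sobolev_le L (m + 6) (fcoef L (\<Phi> 0)) B"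
  proof (rule sobolev_le_limit[OF left _ evs])
    fix k
    have "((\<lambda>t. L2norm L (\<lambda>z. \<Phi> t z - \<Phi> 0 z)) \<longlongrightarrow> 0) (at_right 0)"
      using sol unfolding ch_solution_def by auto
    then have l: "((\<lambda>t. L2norm L (\<lambda>z. \<Phi> t z - \<Phi> 0 z)) \<longlongrightarrow> 0) (at 0 within {0<..<T})"
      by (rule tendsto_within_subset) auto
    show "((\<lambda>r. fcoef L (\<Phi> r) k) \<longlongrightarrow> fcoef L (\<Phi> 0) k) (at 0 within {0<..<T})"
      using L2\<Phi> assms(2) by (intro fcoef_tendsto[OF assms(1) _ _ l evI]) auto
  qed
  moreover have "sobolev_le L (m + 6) (fcoef L (\<Phi> T)) B"
  proof (rule sobolev_le_limit[OF right _ evs])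
    fix k
    have "has_L2_deriv L \<Phi> (laplacian L (\<lambda>z. deriv F (\<Phi> T z) - \<epsilon>\<^sup>2 * laplacian L (\<Phi> T) z)) T {0..T}"
      using sol assms(2) unfolding ch_solution_def by auto
    from has_L2_deriv_fcoef_continuous[OF assms(1) this]
    have "((\<lambda>r. fcoef L (\<Phi> r) k) \<longlongrightarrow> fcoef L (\<Phi> T) k) (at T within {0..T})"
      using assms(2) by auto
    then show "((\<lambda>r. fcoef L (\<Phi> r) k) \<longlongrightarrow> fcoef L (\<Phi> T) k) (at T within {0<..<T})"
      by (rule tendsto_within_subset) auto
  qed
  ultimately have "\<forall>t\<in>{0..T}. sobolev_le L (m + 6) (fcoef L (\<Phi> t)) B"
    using interior by (metis atLeastAtMost_iff greaterThanLessThan_iff order_le_less)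
  then show ?thesis ..
qed

section \<open>The inverse differentiation matrix\<close>

text \<open>The inverse of \<open>D_R\<close>, that is, the inverse of \<open>E_low\<close> times
  \<open>A_E\<close>, written out: each row of \<open>A_E\<close> minus the row before. Entry
  \<open>(i, j)\<close> of \<open>A_E\<close> is \<open>a (i + 2) (j + 1)\<close>, as matrices count
  from 0.\<close>

definition stage_matrix :: "(nat \<Rightarrow> nat \<Rightarrow> real) \<Rightarrow> nat \<Rightarrow> nat \<Rightarrow> real" where
  "stage_matrix a i j = (if j \<le> i then a (i + 2) (j + 1) else 0) - (if j < i then a (i + 1) (j + 1) else 0)"

lemma det_nonzero_inverse:
  fixes A :: "real mat"
  assumes "A \<in> carrier_mat n n" and "Determinant.det A \<noteq> 0"
  shows "the (mat_inverse A) \<in> carrier_mat n n" and "A * the (mat_inverse A) = 1\<^sub>m n"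
proof -
  have "mat_inverse A \<noteq> None"
    using det_non_zero_imp_unit[OF assms, where b = "()"] mat_inverse(1)[OF assms(1), where b = "()"] by blast
  then obtain B where "mat_inverse A = Some B" by blast
  then show "the (mat_inverse A) \<in> carrier_mat n n" and "A * the (mat_inverse A) = 1\<^sub>m n"
    using mat_inverse(2)[OF assms(1)] by auto
qed

lemma det_low_triangular_nonzero:
  fixes f :: "nat \<Rightarrow> nat \<Rightarrow> real"
  assumes "\<And>i. i < n \<Longrightarrow> f i i \<noteq> 0"
  shows "Determinant.det (Matrix.mat n n (\<lambda>(i, j). if j \<le> i then f i j else 0)) \<noteq> 0"
proof -
  let ?A = "Matrix.mat n n (\<lambda>(i, j). if j \<le> i then f i j else 0)"
  have "Determinant.det ?A = prod_list (diag_mat ?A)"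
    by (rule det_lower_triangular[of n]) auto
  also have "\<dots> \<noteq> 0"
    using assms unfolding prod_list_zero_iff by (auto simp: diag_mat_def)
  finally show ?thesis .
qed

text \<open>If \<open>X\<close> is the inverse of \<open>D_R\<close>, then
  \<open>E_low s * X = A_E s\<close>: cumulative column sums of \<open>X\<close> are entries of
  \<open>A_E\<close>, and differencing recovers \<open>X\<close>. The diagonal
  \<open>a (k + 1) k \<noteq> 0\<close> makes the triangular matrices invertible.\<close>

lemma stage_matrix_eq:
  assumes "ierk_coeffs s a" and "i < s - 1" and "j < s - 1"
  shows "the (mat_inverse (D_R s a)) $$ (i, j) = stage_matrix a i j"
    and "the (mat_inverse (D_R s a)) \<in> carrier_mat (s - 1) (s - 1)"
proof -
  let ?n = "s - 1"
  let ?A = "A_E s a" and ?E = "E_low s"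
  have A: "?A \<in> carrier_mat ?n ?n" and E: "?E \<in> carrier_mat ?n ?n" by (auto simp: A_E_def E_low_def)
  have dA: "Determinant.det ?A \<noteq> 0"
    unfolding A_E_def
  proof (rule det_low_triangular_nonzero)
    fix i assume "i < ?n"
    then show "a (i + 2) (i + 1) \<noteq> 0" using assms(1) unfolding ierk_coeffs_def by (auto dest!: bspec[of _ _ "i + 1"])
  qed
  have dE: "Determinant.det ?E \<noteq> 0" unfolding E_low_def by (rule det_low_triangular_nonzero) simp
  define A' where "A' = the (mat_inverse ?A)"
  have A': "A' \<in> carrier_mat ?n ?n" "?A * A' = 1\<^sub>m ?n"
    using det_nonzero_inverse[OF A dA] by (auto simp: A'_def)
  have D: "D_R s a = A' * ?E" by (simp add: D_R_def A'_def)
  have Dc: "D_R s a \<in> carrier_mat ?n ?n" unfolding D using A' E by simp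
  have "Determinant.det ?A * Determinant.det A' = 1" using det_mult[OF A A'(1)] A'(2) by simp
  then have "Determinant.det A' \<noteq> 0" by auto
  then have dD: "Determinant.det (D_R s a) \<noteq> 0" unfolding D using det_mult[OF A'(1) E] dE by simp
  define X where "X = the (mat_inverse (D_R s a))"
  have X: "X \<in> carrier_mat ?n ?n" "D_R s a * X = 1\<^sub>m ?n"
    using det_nonzero_inverse[OF Dc dD] by (auto simp: X_def)
  show "the (mat_inverse (D_R s a)) \<in> carrier_mat ?n ?n" using X(1) by (simp add: X_def)
  have EX: "?E * X = ?A"
  proof -
    have "?A = ?A * (D_R s a * X)" using X A by simp
    also have "\<dots> = ?A * (A' * (?E * X))" unfolding D using assoc_mult_mat[OF A'(1) E X(1)] by simp
    also have "\<dots> = (?A * A') * (?E * X)" using A A' E X by (intro assoc_mult_mat[symmetric]) auto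
    also have "\<dots> = ?E * X" using A'(2) E X by simp
    finally show ?thesis by simp
  qed
  have cum: "(\<Sum>l\<le>i. X $$ (l, j)) = (if j \<le> i then a (i + 2) (j + 1) else 0)" if "i < ?n" for i
  proof -
    have "(?E * X) $$ (i, j) = (\<Sum>l<?n. (if l \<le> i then 1 else 0) * X $$ (l, j))"
      using that assms(3) X(1) by (auto simp: E_low_def scalar_prod_def lessThan_atLeast0 intro!: sum.cong)
    also have "\<dots> = (\<Sum>l\<in>{..<?n} \<inter> {..i}. X $$ (l, j))"
      by (subst sum.inter_restrict) (auto intro!: sum.cong)
    also have "{..<?n} \<inter> {..i} = {..i}" using that by auto
    finally show ?thesis using that assms(3) unfolding EX by (simp add: A_E_def)
  qed
  show "the (mat_inverse (D_R s a)) $$ (i, j) = stage_matrix a i j"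
  proof (cases i)
    case 0
    then show ?thesis using cum[OF assms(2)] by (simp add: X_def stage_matrix_def)
  next
    case (Suc i')
    have "X $$ (i, j) = (\<Sum>l\<le>i. X $$ (l, j)) - (\<Sum>l\<le>i'. X $$ (l, j))" by (simp add: Suc)
    moreover have "(\<Sum>l\<le>i'. X $$ (l, j)) = (if j < i then a (i + 1) (j + 1) else 0)"
      using cum[of i'] assms(2) by (simp add: Suc less_Suc_eq_le)
    ultimately show ?thesis using cum[OF assms(2)] by (simp add: X_def stage_matrix_def)
  qed
qed

text \<open>Positive definiteness concerns the symmetric part, which has the same quadratic form.
  One \<open>\<beta>\<close> serves all leading blocks because a vector of length \<open>k\<close>
  can be extended by zeros; intermediate stages need exactly this.\<close>

lemma stage_matrix_coercive:
  assumes "ierk_coeffs s a" and pd: "pos_def_mat (s - 1) (the (mat_inverse (D_R s a)))"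
  shows "\<exists>\<beta>>0. \<forall>k x. k \<le> s - 1 \<longrightarrow>
     \<beta> * (\<Sum>i<k. (x i)\<^sup>2) \<le> (\<Sum>i<k. \<Sum>j<k. stage_matrix a i j * x i * x j)"
proof -
  let ?n = "s - 1" and ?b = "stage_matrix a"
  define X where "X = the (mat_inverse (D_R s a))"
  have n: "0 < ?n" using assms(1) by (auto simp: ierk_coeffs_def)
  have Xc: "X \<in> carrier_mat ?n ?n" unfolding X_def by (rule stage_matrix_eq(2)[OF assms(1) n n])
  have Xb: "X $$ (i, j) = ?b i j" if "i < ?n" "j < ?n" for i j
    unfolding X_def using that by (rule stage_matrix_eq(1)[OF assms(1)])
  have pos: "0 < (\<Sum>i<?n. \<Sum>j<?n. ?b i j * x i * x j)" if ex: "\<exists>i<?n. x i \<noteq> 0" for x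
  proof -
    let ?v = "Matrix.vec ?n x"
    have "?v \<in> carrier_vec ?n" by simp
    moreover have "?v \<noteq> 0\<^sub>v ?n"
    proof
      assume "?v = 0\<^sub>v ?n"
      then have "?v $ i = 0\<^sub>v ?n $ i" for i by simp
      then show False using ex by (metis index_vec index_zero_vec(1))
    qed
    ultimately have "0 < scalar_prod ?v (((1 / 2) \<cdot>\<^sub>m (X + transpose_mat X)) *\<^sub>v ?v)"
      using pd unfolding pos_def_mat_def X_def by blast
    also have "\<dots> = (\<Sum>i<?n. \<Sum>j<?n. x i * ((?b i j + ?b j i) / 2 * x j))"
      using Xc by (simp add: scalar_prod_def lessThan_atLeast0 sum_distrib_left Xb)
    also have "\<dots> = (\<Sum>i<?n. \<Sum>j<?n. ?b i j * x i * x j / 2) + (\<Sum>i<?n. \<Sum>j<?n. ?b j i * x j * x i / 2)"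
      unfolding sum.distrib[symmetric] by (intro sum.cong refl) (simp add: field_simps)
    also have "(\<Sum>i<?n. \<Sum>j<?n. ?b j i * x j * x i / 2) = (\<Sum>j<?n. \<Sum>i<?n. ?b j i * x j * x i / 2)"
      by (rule sum.swap)
    also have "(\<Sum>i<?n. \<Sum>j<?n. ?b i j * x i * x j / 2) + (\<Sum>j<?n. \<Sum>i<?n. ?b j i * x j * x i / 2) =
        (\<Sum>i<?n. \<Sum>j<?n. ?b i j * x i * x j)"
      by (simp flip: sum_divide_distrib)
    finally show ?thesis .
  qed
  from coercive_form[OF pos] obtain \<beta> where \<beta>: "0 < \<beta>"
    "\<And>x. \<beta> * (\<Sum>i<?n. (x i)\<^sup>2) \<le> (\<Sum>i<?n. \<Sum>j<?n. ?b i j * x i * x j)" by blast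
  have "\<beta> * (\<Sum>i<k. (x i)\<^sup>2) \<le> (\<Sum>i<k. \<Sum>j<k. ?b i j * x i * x j)" if k: "k \<le> ?n" for k x
  proof -
    let ?y = "\<lambda>i. if i < k then x i else 0"
    have restr: "(\<Sum>i<?n. if i < k then g i else 0) = (\<Sum>i<k. g i)" for g :: "nat \<Rightarrow> real"
      using k by (intro sum.mono_neutral_cong_right) auto
    have "(\<Sum>i<?n. (?y i)\<^sup>2) = (\<Sum>i<k. (x i)\<^sup>2)"
      unfolding restr[symmetric] by (intro sum.cong) auto
    moreover have "(\<Sum>i<?n. \<Sum>j<?n. ?b i j * ?y i * ?y j) = (\<Sum>i<k. \<Sum>j<k. ?b i j * x i * x j)"
      unfolding restr[symmetric] by (intro sum.cong refl) (auto simp: restr[symmetric] intro!: sum.cong)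
    ultimately show ?thesis using \<beta>(2)[of ?y] by simp
  qed
  with \<beta>(1) show ?thesis by blast
qed

text \<open>Subtracting the equations of consecutive stages turns rows of \<open>A_E\<close> into
  rows of \<open>stage_matrix\<close>. The defect of the previous stage would enter with a minus
  sign, but it is zero since only the last one may differ from zero. The sum may run to any
  \<open>k > i\<close>, entries with \<open>j > i\<close> being zero.\<close>

lemma stage_increment:
  fixes e :: "nat \<Rightarrow> complex" and R Z :: "nat \<Rightarrow> complex"
  assumes eq: "\<And>i. i < n \<Longrightarrow> e (Suc i) = e 0 + \<tau> * (\<Sum>j\<le>i. of_real (a (i + 2) (j + 1)) * R j) + \<tau> * Z i"
    and Z0: "\<And>i. Suc i < n \<Longrightarrow> Z i = 0" and "i < k" and "k \<le> n"
  shows "e (Suc i) - e i = \<tau> * (\<Sum>j<k. of_real (stage_matrix a i j) * R j) + \<tau> * Z i"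
proof -
  have 1: "(\<Sum>j<k. of_real (if j \<le> i then a (i + 2) (j + 1) else 0) * R j) = (\<Sum>j\<le>i. of_real (a (i + 2) (j + 1)) * R j)"
    using assms by (intro sum.mono_neutral_cong_right) auto
  have 2: "(\<Sum>j<k. of_real (if j < i then a (i + 1) (j + 1) else 0) * R j) = (\<Sum>j<i. of_real (a (i + 1) (j + 1)) * R j)"
    using assms by (intro sum.mono_neutral_cong_right) auto
  have b: "(\<Sum>j<k. of_real (stage_matrix a i j) * R j) =
     (\<Sum>j\<le>i. of_real (a (i + 2) (j + 1)) * R j) - (\<Sum>j<i. of_real (a (i + 1) (j + 1)) * R j)"
    unfolding 1[symmetric] 2[symmetric] sum_subtractf[symmetric] stage_matrix_def of_real_diff left_diff_distrib ..
  have "e i = e 0 + \<tau> * (\<Sum>j<i. of_real (a (i + 1) (j + 1)) * R j)"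
  proof (cases i)
    case (Suc i')
    then show ?thesis using eq[of i'] Z0[of i'] assms by (simp add: lessThan_Suc_atMost)
  qed simp
  then show ?thesis using eq[of i] assms unfolding b by (simp add: algebra_simps)
qed

section \<open>Spatial consistency\<close>

lemma class_sum_bound_aliases:
  assumes "0 < L" and "0 < M" and "even M" and c: "sobolev_le L (2 * n + m + 2) c B"
  shows "(\<Sum>k\<in>modes M. (\<Sum>\<^sub>\<infinity>q\<in>aliases M k - {k}. (1 + freq2 L q) ^ n * norm (c q))\<^sup>2) \<le> weight_sum L * ((L / M)\<^sup>2) ^ m * B"
proof (rule class_sum_bound(1)[OF assms(1) finite_modes _ _ _ c])
  fix i j assume ij: "i \<in> modes M" "j \<in> modes M" "i \<noteq> j"
  show "(aliases M i - {i}) \<inter> (aliases M j - {j}) = {}"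
    using aliases_disjoint[OF assms(3) ij] by blast
next
  show "1 / (1 + freq2 L q) \<le> (L / M)\<^sup>2" if "k \<in> modes M" "q \<in> aliases M k - {k}" for k q
    using freq2_alias_ge[OF assms(3,2,1) that(1)] that(2) by auto
qed simp

lemma norm_has_sum_weighted_le:
  fixes d :: "'a \<Rightarrow> complex"
  assumes "(d has_sum S) A" and "\<And>q. q \<in> A \<Longrightarrow> norm (d q) \<le> f q" and "f summable_on A"
  shows "norm S \<le> infsum f A"
proof -
  have "(\<lambda>q. norm (d q)) summable_on A"
    using assms(1) summable_on_iff_abs_summable_on_complex has_sum_imp_summable by blast
  then have 1: "((\<lambda>q. norm (d q)) has_sum (\<Sum>\<^sub>\<infinity>q\<in>A. norm (d q))) A" by (rule has_sum_infsum)
  have "norm S \<le> (\<Sum>\<^sub>\<infinity>q\<in>A. norm (d q))" using 1 assms(1) by (rule norm_has_sum_bound)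
  also have "\<dots> \<le> infsum f A"
    using has_sum_imp_summable[OF 1] assms by (intro infsum_mono) auto
  finally show ?thesis .
qed

text \<open>Interpolation and projection coefficients differ by the aliases other than
  \<open>k\<close> itself, whose weights dominate the weight at \<open>k\<close>; so the aliasing
  estimate applies with \<open>n = 1\<close>. This will bound the initial error, the scheme being
  started from the projection.\<close>

lemma dcoef_minus_fcoef_bound:
  assumes "0 < L" and M: "0 < M" "even M" and v: "continuous_on UNIV v" "periodic2 L v" "sobolev_le L (m + 4) (fcoef L v) B"
  shows "(\<Sum>k\<in>modes M. (1 + freq2 L k)\<^sup>2 * (norm (dcoef L M (\<lambda>z. of_real (v z)) k - fcoef L v k))\<^sup>2) \<le> weight_sum L * ((L / M)\<^sup>2) ^ m * B"
proof -
  have s: "sobolev_le L (2 * 1 + m + 2) (fcoef L v) B" using v(3) by (simp add: eval_nat_numeral)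
  let ?f = "\<lambda>q. (1 + freq2 L q) ^ 1 * norm (fcoef L v q)"
  have sm: "?f summable_on UNIV"
    using class_sum_bound(2)[where I = "{} :: nat set" and \<theta> = 0, OF assms(1) _ _ _ _ s] by simp
  have abs: "(\<lambda>k. norm (fcoef L v k)) summable_on UNIV"
    using assms(1) v(3) by (rule sobolev_le_abs_summable) simp
  have "(1 + freq2 L k)\<^sup>2 * (norm (dcoef L M (\<lambda>z. of_real (v z)) k - fcoef L v k))\<^sup>2 \<le> (\<Sum>\<^sub>\<infinity>q\<in>aliases M k - {k}. ?f q)\<^sup>2"
    if k: "k \<in> modes M" for k
  proof -
    have "(fcoef L v has_sum (dcoef L M (\<lambda>z. of_real (v z)) k - fcoef L v k)) (aliases M k - {k})"
      by (intro has_sum_Diff dcoef_has_sum[OF assms(1) M(1) v(1,2) abs] has_sum_finiteI) auto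
    then have h: "((\<lambda>q. of_real (1 + freq2 L k) * fcoef L v q) has_sum of_real (1 + freq2 L k) * (dcoef L M (\<lambda>z. of_real (v z)) k - fcoef L v k)) (aliases M k - {k})"
      by (rule has_sum_cmult_right)
    have nk: "norm (complex_of_real (1 + freq2 L k)) = 1 + freq2 L k" unfolding norm_of_real by simp
    have "norm (of_real (1 + freq2 L k) * (dcoef L M (\<lambda>z. of_real (v z)) k - fcoef L v k)) \<le> infsum ?f (aliases M k - {k})"
    proof (rule norm_has_sum_weighted_le[OF h])
      show "norm (of_real (1 + freq2 L k) * fcoef L v q) \<le> ?f q" if "q \<in> aliases M k - {k}" for q
        unfolding norm_mult nk using freq2_mono_aliases[OF M(2) k, of q L] that by (intro mult_right_mono) auto
      show "?f summable_on aliases M k - {k}" by (rule summable_on_subset_banach[OF sm]) auto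
    qed
    then have "(norm (of_real (1 + freq2 L k) * (dcoef L M (\<lambda>z. of_real (v z)) k - fcoef L v k)))\<^sup>2 \<le> (infsum ?f (aliases M k - {k}))\<^sup>2"
      by (rule power_mono) simp
    then show ?thesis unfolding norm_mult nk power_mult_distrib .
  qed
  then have "(\<Sum>k\<in>modes M. (1 + freq2 L k)\<^sup>2 * (norm (dcoef L M (\<lambda>z. of_real (v z)) k - fcoef L v k))\<^sup>2) \<le>
      (\<Sum>k\<in>modes M. (\<Sum>\<^sub>\<infinity>q\<in>aliases M k - {k}. ?f q)\<^sup>2)"
    by (rule sum_mono)
  also have "\<dots> \<le> weight_sum L * ((L / M)\<^sup>2) ^ m * B" by (rule class_sum_bound_aliases[OF assms(1) M s])
  finally show ?thesis .
qed

text \<open>The same comparison with whole classes: no power of the mesh width is gained, but the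
  bound on the exact solution is uniform in \<open>M\<close>, as the Lipschitz constant
  requires.\<close>

lemma dnorm2_sq_le_sobolev:
  assumes "0 < L" and M: "0 < M" "even M" and v: "continuous_on UNIV v" "periodic2 L v" "sobolev_le L 4 (fcoef L v) B"
  shows "dnorm2_sq L M (\<lambda>z. of_real (v z)) \<le> weight_sum L * B"
proof -
  have s: "sobolev_le L (2 * 1 + 0 + 2) (fcoef L v) B" using v(3) by simp
  let ?f = "\<lambda>q. (1 + freq2 L q) ^ 1 * norm (fcoef L v q)"
  have one: "1 / (1 + freq2 L q) \<le> 1" for q by simp
  have csb: "(\<Sum>k\<in>modes M. (\<Sum>\<^sub>\<infinity>q\<in>aliases M k. ?f q)\<^sup>2) \<le> weight_sum L * 1 ^ 0 * B"
    and sm: "?f summable_on UNIV"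
    using class_sum_bound[where S = "aliases M" and \<theta> = 1, OF assms(1) finite_modes aliases_disjoint[OF M(2)] _ one s] by auto
  have abs: "(\<lambda>k. norm (fcoef L v k)) summable_on UNIV"
    using assms(1) v(3) by (rule sobolev_le_abs_summable) simp
  have "(1 + freq2 L k)\<^sup>2 * (norm (dcoef L M (\<lambda>z. of_real (v z)) k))\<^sup>2 \<le> (\<Sum>\<^sub>\<infinity>q\<in>aliases M k. ?f q)\<^sup>2"
    if k: "k \<in> modes M" for k
  proof -
    have h: "((\<lambda>q. of_real (1 + freq2 L k) * fcoef L v q) has_sum of_real (1 + freq2 L k) * dcoef L M (\<lambda>z. of_real (v z)) k) (aliases M k)"
      by (rule has_sum_cmult_right[OF dcoef_has_sum[OF assms(1) M(1) v(1,2) abs]])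
    have nk: "norm (complex_of_real (1 + freq2 L k)) = 1 + freq2 L k" unfolding norm_of_real by simp
    have "norm (of_real (1 + freq2 L k) * dcoef L M (\<lambda>z. of_real (v z)) k) \<le> infsum ?f (aliases M k)"
    proof (rule norm_has_sum_weighted_le[OF h])
      show "norm (of_real (1 + freq2 L k) * fcoef L v q) \<le> ?f q" if "q \<in> aliases M k" for q
        unfolding norm_mult nk using freq2_mono_aliases[OF M(2) k that, of L] by (intro mult_right_mono) auto
      show "?f summable_on aliases M k" by (rule summable_on_subset_banach[OF sm]) auto
    qed
    then have "(norm (of_real (1 + freq2 L k) * dcoef L M (\<lambda>z. of_real (v z)) k))\<^sup>2 \<le> (infsum ?f (aliases M k))\<^sup>2"
      by (rule power_mono) simp
    then show ?thesis unfolding norm_mult nk power_mult_distrib .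
  qed
  then have "dnorm2_sq L M (\<lambda>z. of_real (v z)) \<le> (\<Sum>k\<in>modes M. (\<Sum>\<^sub>\<infinity>q\<in>aliases M k. ?f q)\<^sup>2)"
    unfolding dnorm2_sq_def by (rule sum_mono)
  with csb show ?thesis by simp
qed

text \<open>The Fourier symbol of \<open>- \<Delta> L\<^sub>\<kappa>\<close>.\<close>

definition ch_symbol :: "real \<Rightarrow> real \<Rightarrow> real \<Rightarrow> int \<times> int \<Rightarrow> real" where
  "ch_symbol L \<epsilon> \<kappa> k = freq2 L k * (\<epsilon>\<^sup>2 * freq2 L k + \<kappa>)"

lemma dcoef_ch_rhs_h:
  assumes "0 < L" and "0 < M" and "even M" and "k \<in> modes M"
  shows "dcoef L M (ch_rhs_h L M \<epsilon> \<kappa> v w) k =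
    - of_real (ch_symbol L \<epsilon> \<kappa> k) * dcoef L M v k + of_real (freq2 L k) * dcoef L M (\<lambda>z. f_kappa \<kappa> (w z)) k"
  unfolding ch_rhs_h_def dcoef_dlap[OF assms] dcoef_diff dcoef_add dcoef_cmult
  by (simp add: ch_symbol_def algebra_simps)

text \<open>Counting orders: the inner Laplacian takes \<open>v\<close> from order
  \<open>q + 4\<close> to \<open>q + 2\<close>, and the outer one requires at least 3, whence
  \<open>1 \<le> q\<close>.\<close>

lemma
  assumes "0 < L" and v: "L2per L v" "sobolev_le L (q + 4) (fcoef L v) B"
    and w: "L2per L (\<lambda>z. f_kappa \<kappa> (w z))" "sobolev_le L (q + 2) (fcoef L (\<lambda>z. f_kappa \<kappa> (w z))) D" and q: "1 \<le> q"
  shows fcoef_ch_rhs: "fcoef L (ch_rhs L \<epsilon> \<kappa> v w) k =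
      - of_real (ch_symbol L \<epsilon> \<kappa> k) * fcoef L v k + of_real (freq2 L k) * fcoef L (\<lambda>z. f_kappa \<kappa> (w z)) k"
    and L2per_ch_rhs: "L2per L (ch_rhs L \<epsilon> \<kappa> v w)"
proof -
  let ?f = "\<lambda>z. f_kappa \<kappa> (w z)"
  let ?W = "\<lambda>z. - \<epsilon>\<^sup>2 * laplacian L v z + \<kappa> * v z - f_kappa \<kappa> (w z)"
  have q3: "3 \<le> q + 4" by simp
  have lapL: "L2per L (laplacian L v)" using assms(1) v(2) q3 by (rule L2per_laplacian)
  have lapc: "fcoef L (laplacian L v) k = - of_real (freq2 L k) * fcoef L v k" for k
    using assms(1) v(2) q3 by (rule fcoef_laplacian)
  have 1: "L2per L (\<lambda>z. - \<epsilon>\<^sup>2 * laplacian L v z)" and 2: "L2per L (\<lambda>z. \<kappa> * v z)" and 3: "L2per L (\<lambda>z. (- 1) * ?f z)"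
    by (intro L2per_cmult lapL v w)+
  have Weq: "?W = (\<lambda>z. (- \<epsilon>\<^sup>2 * laplacian L v z + \<kappa> * v z) + (- 1) * ?f z)" by auto
  have Wc: "fcoef L ?W k = of_real (\<epsilon>\<^sup>2) * (of_real (freq2 L k) * fcoef L v k) + (of_real \<kappa> * fcoef L v k + (- 1) * fcoef L ?f k)" for k
    unfolding Weq fcoef_add[OF assms(1) L2per_add[OF 1 2] 3] fcoef_add[OF assms(1) 1 2] fcoef_cmult lapc by simp
  have s1: "sobolev_le L (q + 2) (\<lambda>k. of_real (freq2 L k) * fcoef L v k) B"
  proof -
    have "sobolev_le L (q + 2 + 2) (fcoef L v) B" using v(2) by (simp add: eval_nat_numeral)
    from sobolev_le_cmult[OF sobolev_le_laplace[OF this], of "-1"] show ?thesis by simp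
  qed
  have s2: "sobolev_le L (q + 2) (fcoef L v) B" using v(2) by (rule sobolev_le_weaken) simp
  obtain BW where "sobolev_le L (q + 2) (fcoef L ?W) BW"
    unfolding Wc[abs_def] using sobolev_le_add[OF sobolev_le_cmult[OF s1] sobolev_le_add[OF sobolev_le_cmult[OF s2] sobolev_le_cmult[OF w(2)]]]
    by blast
  note W = this
  have q3': "3 \<le> q + 2" using q by simp
  show "L2per L (ch_rhs L \<epsilon> \<kappa> v w)" unfolding ch_rhs_def using assms(1) W q3' by (rule L2per_laplacian)
  have "fcoef L (ch_rhs L \<epsilon> \<kappa> v w) k = - of_real (freq2 L k) * fcoef L ?W k"
    unfolding ch_rhs_def using assms(1) W q3' by (rule fcoef_laplacian)
  then show "fcoef L (ch_rhs L \<epsilon> \<kappa> v w) k =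
      - of_real (ch_symbol L \<epsilon> \<kappa> k) * fcoef L v k + of_real (freq2 L k) * fcoef L (\<lambda>z. f_kappa \<kappa> (w z)) k"
    unfolding Wc by (simp add: ch_symbol_def algebra_simps)
qed

text \<open>Summing the exact right-hand side over a class evaluates the symbols at each
  \<open>q\<close>, whereas the scheme uses those at \<open>k\<close>. The term \<open>q = k\<close>
  cancels, so \<open>r\<close> consists of proper aliases. The orders \<open>m + 6\<close> and
  \<open>m + 4\<close> are \<open>2 * n + m + 2\<close> with \<open>n = 2\<close> powers of the
  weight on \<open>v\<close> and \<open>n = 1\<close> on \<open>g\<close>.\<close>

lemma consistency_residual:
  assumes "0 < L" and M: "0 < M" "even M" and \<epsilon>: "0 < \<epsilon>" "\<epsilon> < 1" and \<kappa>: "0 \<le> \<kappa>"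
    and v: "continuous_on UNIV v" "periodic2 L v" "sobolev_le L (m + 6) (fcoef L v) B"
    and g: "continuous_on UNIV g" "periodic2 L g" "sobolev_le L (m + 4) (fcoef L g) D"
  defines "Z \<equiv> \<lambda>q. - of_real (ch_symbol L \<epsilon> \<kappa> q) * fcoef L v q + of_real (freq2 L q) * fcoef L g q"
  shows "\<exists>r. (\<forall>k\<in>modes M. (Z has_sum (- of_real (ch_symbol L \<epsilon> \<kappa> k) * dcoef L M (\<lambda>z. of_real (v z)) k
        + of_real (freq2 L k) * dcoef L M (\<lambda>z. of_real (g z)) k + r k)) (aliases M k)) \<and>
      (\<Sum>k\<in>modes M. (norm (r k))\<^sup>2) \<le> weight_sum L * ((L / M)\<^sup>2) ^ m * (2 * (1 + \<kappa>)\<^sup>2 * B + 2 * D)"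
    and "Z summable_on UNIV"
proof -
  have sv: "sobolev_le L (2 * 2 + m + 2) (fcoef L v) B" using v(3) by (simp add: eval_nat_numeral)
  have sg: "sobolev_le L (2 * 1 + m + 2) (fcoef L g) D" using g(3) by (simp add: eval_nat_numeral)
  let ?x = "\<lambda>q. (1 + freq2 L q) ^ 2 * norm (fcoef L v q)" and ?y = "\<lambda>q. (1 + freq2 L q) ^ 1 * norm (fcoef L g q)"
  have smx: "?x summable_on UNIV"
    using class_sum_bound(2)[where I = "{} :: nat set" and \<theta> = 0, OF assms(1) _ _ _ _ sv] by simp
  have smy: "?y summable_on UNIV"
    using class_sum_bound(2)[where I = "{} :: nat set" and \<theta> = 0, OF assms(1) _ _ _ _ sg] by simp
  let ?h = "\<lambda>q. (1 + \<kappa>) * ?x q + ?y q"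
  have smh: "?h summable_on UNIV" by (intro summable_on_add summable_on_cmult_right smx smy)
  have sym: "0 \<le> ch_symbol L \<epsilon> \<kappa> q" "ch_symbol L \<epsilon> \<kappa> q \<le> (1 + \<kappa>) * (1 + freq2 L q)\<^sup>2" for q
  proof -
    let ?l = "freq2 L q"
    show "0 \<le> ch_symbol L \<epsilon> \<kappa> q" unfolding ch_symbol_def using \<kappa> by (intro mult_nonneg_nonneg add_nonneg_nonneg) auto
    have "\<epsilon>\<^sup>2 * ?l \<le> 1 * ?l" using \<epsilon> by (intro mult_right_mono power_le_one) auto
    then have "ch_symbol L \<epsilon> \<kappa> q \<le> ?l * (1 * ?l + \<kappa>)"
      unfolding ch_symbol_def by (intro mult_left_mono add_right_mono) auto
    also have "\<dots> = ?l\<^sup>2 + \<kappa> * ?l" by (simp add: power2_eq_square algebra_simps)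
    also have "\<dots> \<le> (1 + ?l)\<^sup>2 + \<kappa> * (1 + ?l)\<^sup>2"
    proof (intro add_mono mult_left_mono \<kappa>)
      show "?l\<^sup>2 \<le> (1 + ?l)\<^sup>2" by (rule power_mono) auto
      have "0 \<le> ?l\<^sup>2" by simp
      then have "?l \<le> 1 + 2 * ?l + ?l\<^sup>2" using freq2_nonneg[of L q] by linarith
      then show "?l \<le> (1 + ?l)\<^sup>2" by (simp add: power2_sum)
    qed
    finally show "ch_symbol L \<epsilon> \<kappa> q \<le> (1 + \<kappa>) * (1 + ?l)\<^sup>2" by (simp add: distrib_right)
  qed
  \<comment> \<open>Stated for bounded multipliers in order to serve twice: for the symbols at
    \<open>q\<close>, and for their differences from the symbols at \<open>k\<close>.\<close>
  have lin: "norm (- of_real a * fcoef L v q + of_real b * fcoef L g q) \<le> ?h q"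
    if "\<bar>a\<bar> \<le> ch_symbol L \<epsilon> \<kappa> q" "\<bar>b\<bar> \<le> freq2 L q" for a b q
  proof -
    have "norm (- of_real a * fcoef L v q + of_real b * fcoef L g q) \<le> \<bar>a\<bar> * norm (fcoef L v q) + \<bar>b\<bar> * norm (fcoef L g q)"
      by (rule order_trans[OF norm_triangle_ineq]) (simp add: norm_mult)
    also have "\<dots> \<le> ((1 + \<kappa>) * (1 + freq2 L q)\<^sup>2) * norm (fcoef L v q) + (1 + freq2 L q) * norm (fcoef L g q)"
      using that sym(2)[of q] freq2_nonneg[of L q] by (intro add_mono mult_right_mono) auto
    finally show ?thesis by (simp add: mult.assoc)
  qed
  have Zle: "norm (Z q) \<le> ?h q" for q
    unfolding Z_def using sym(1)[of q] by (intro lin) auto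
  show Zs: "Z summable_on UNIV"
    by (rule abs_summable_summable, rule summable_on_comparison_test[OF smh]) (use Zle in auto)
  define r where "r = (\<lambda>k. infsum Z (aliases M k) - (- of_real (ch_symbol L \<epsilon> \<kappa> k) * dcoef L M (\<lambda>z. of_real (v z)) k
        + of_real (freq2 L k) * dcoef L M (\<lambda>z. of_real (g z)) k))"
  have Zh: "(Z has_sum infsum Z (aliases M k)) (aliases M k)" for k
    by (intro has_sum_infsum summable_on_subset_banach[OF Zs]) auto
  have absv: "(\<lambda>k. norm (fcoef L v k)) summable_on UNIV" using assms(1) v(3) by (rule sobolev_le_abs_summable) simp
  have absg: "(\<lambda>k. norm (fcoef L g k)) summable_on UNIV" using assms(1) g(3) by (rule sobolev_le_abs_summable) simp
  have rle: "(norm (r k))\<^sup>2 \<le> 2 * (1 + \<kappa>)\<^sup>2 * (infsum ?x (aliases M k - {k}))\<^sup>2 + 2 * (infsum ?y (aliases M k - {k}))\<^sup>2"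
    if k: "k \<in> modes M" for k
  proof -
    let ?d = "\<lambda>q. - of_real (ch_symbol L \<epsilon> \<kappa> q - ch_symbol L \<epsilon> \<kappa> k) * fcoef L v q + of_real (freq2 L q - freq2 L k) * fcoef L g q"
    let ?A = "aliases M k - {k}"
    have "((\<lambda>q. Z q + (of_real (ch_symbol L \<epsilon> \<kappa> k) * fcoef L v q + (- of_real (freq2 L k)) * fcoef L g q)) has_sum
        (infsum Z (aliases M k) + (of_real (ch_symbol L \<epsilon> \<kappa> k) * dcoef L M (\<lambda>z. of_real (v z)) k + (- of_real (freq2 L k)) * dcoef L M (\<lambda>z. of_real (g z)) k))) (aliases M k)"
      by (intro has_sum_add Zh has_sum_cmult_right dcoef_has_sum[OF assms(1) M(1) v(1,2) absv] dcoef_has_sum[OF assms(1) M(1) g(1,2) absg])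
    moreover have "Z q + (of_real (ch_symbol L \<epsilon> \<kappa> k) * fcoef L v q + (- of_real (freq2 L k)) * fcoef L g q) = ?d q" for q
      by (simp add: Z_def algebra_simps)
    moreover have "infsum Z (aliases M k) + (of_real (ch_symbol L \<epsilon> \<kappa> k) * dcoef L M (\<lambda>z. of_real (v z)) k + (- of_real (freq2 L k)) * dcoef L M (\<lambda>z. of_real (g z)) k) = r k"
      by (simp add: r_def algebra_simps)
    ultimately have d: "(?d has_sum r k) (aliases M k)" by simp
    have "(?d has_sum r k - (\<Sum>q\<in>{k}. ?d q)) (aliases M k - {k})"
      by (rule has_sum_Diff[OF d has_sum_finite]) auto
    then have d': "(?d has_sum r k) ?A" by simp
    have sA: "?x summable_on ?A" "?y summable_on ?A"
      by (rule summable_on_subset_banach[OF smx], simp, rule summable_on_subset_banach[OF smy], simp)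
    have "norm (r k) \<le> infsum ?h ?A"
    proof (rule norm_has_sum_weighted_le[OF d'])
      fix q assume q: "q \<in> ?A"
      have f: "freq2 L k \<le> freq2 L q" using freq2_mono_aliases[OF M(2) k] q by blast
      have "ch_symbol L \<epsilon> \<kappa> k \<le> ch_symbol L \<epsilon> \<kappa> q"
        unfolding ch_symbol_def using f \<kappa> by (intro mult_mono add_mono mult_left_mono) auto
      then show "norm (?d q) \<le> ?h q" using f sym(1)[of k] by (intro lin) auto
    qed (rule summable_on_subset_banach[OF smh], simp)
    also have "infsum ?h ?A = (1 + \<kappa>) * infsum ?x ?A + infsum ?y ?A"
      using sA by (subst infsum_add) (auto intro: summable_on_cmult_right simp: infsum_cmult_right)
    finally have le: "norm (r k) \<le> (1 + \<kappa>) * infsum ?x ?A + infsum ?y ?A" .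
    have "(norm (r k))\<^sup>2 \<le> ((1 + \<kappa>) * infsum ?x ?A + infsum ?y ?A)\<^sup>2" using le by (rule power_mono) simp
    also have "\<dots> \<le> 2 * ((1 + \<kappa>) * infsum ?x ?A)\<^sup>2 + 2 * (infsum ?y ?A)\<^sup>2"
      using norm_add_sq_le[of "(1 + \<kappa>) * infsum ?x ?A" "infsum ?y ?A"] by simp
    finally show ?thesis by (simp add: power_mult_distrib mult.assoc)
  qed
  have "(\<Sum>k\<in>modes M. (norm (r k))\<^sup>2) \<le> (\<Sum>k\<in>modes M. 2 * (1 + \<kappa>)\<^sup>2 * (infsum ?x (aliases M k - {k}))\<^sup>2 + 2 * (infsum ?y (aliases M k - {k}))\<^sup>2)"
    using rle by (rule sum_mono)
  also have "\<dots> = 2 * (1 + \<kappa>)\<^sup>2 * (\<Sum>k\<in>modes M. (infsum ?x (aliases M k - {k}))\<^sup>2) + 2 * (\<Sum>k\<in>modes M. (infsum ?y (aliases M k - {k}))\<^sup>2)"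
    by (simp only: sum.distrib sum_distrib_left)
  also have "\<dots> \<le> 2 * (1 + \<kappa>)\<^sup>2 * (weight_sum L * ((L / M)\<^sup>2) ^ m * B) + 2 * (weight_sum L * ((L / M)\<^sup>2) ^ m * D)"
    by (intro add_mono mult_left_mono class_sum_bound_aliases[OF assms(1) M sv] class_sum_bound_aliases[OF assms(1) M sg]) auto
  also have "\<dots> = weight_sum L * ((L / M)\<^sup>2) ^ m * (2 * (1 + \<kappa>)\<^sup>2 * B + 2 * D)" by (simp add: algebra_simps)
  finally have "(\<Sum>k\<in>modes M. (norm (r k))\<^sup>2) \<le> weight_sum L * ((L / M)\<^sup>2) ^ m * (2 * (1 + \<kappa>)\<^sup>2 * B + 2 * D)" .
  moreover have "(Z has_sum (- of_real (ch_symbol L \<epsilon> \<kappa> k) * dcoef L M (\<lambda>z. of_real (v z)) k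
        + of_real (freq2 L k) * dcoef L M (\<lambda>z. of_real (g z)) k + r k)) (aliases M k)" for k
    using Zh[of k] by (simp add: r_def)
  ultimately show "\<exists>r. (\<forall>k\<in>modes M. (Z has_sum (- of_real (ch_symbol L \<epsilon> \<kappa> k) * dcoef L M (\<lambda>z. of_real (v z)) k
        + of_real (freq2 L k) * dcoef L M (\<lambda>z. of_real (g z)) k + r k)) (aliases M k)) \<and>
      (\<Sum>k\<in>modes M. (norm (r k))\<^sup>2) \<le> weight_sum L * ((L / M)\<^sup>2) ^ m * (2 * (1 + \<kappa>)\<^sup>2 * B + 2 * D)"
    by (intro exI[of _ r]) auto
qed

section \<open>One step of the method\<close>

text \<open>Stages are indexed from 0 here: \<open>\<phi> i\<close> is the exact solution at stage \<open>i + 1\<close>, and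
  \<open>\<zeta> i\<close> is the defect of stage \<open>i + 2\<close>.\<close>

lemma exact_stage_equations:
  assumes "0 < L" and M: "0 < M" "even M" and \<epsilon>: "0 < \<epsilon>" "\<epsilon> < 1" and \<kappa>: "0 \<le> \<kappa>" and "1 \<le> m" and "0 < \<tau>"
    and \<phi>: "\<And>i. i \<le> n \<Longrightarrow> continuous_on UNIV (\<phi> i)" "\<And>i. i \<le> n \<Longrightarrow> periodic2 L (\<phi> i)" "\<And>i. i \<le> n \<Longrightarrow> sobolev_le L (m + 6) (fcoef L (\<phi> i)) B"
    and f\<phi>: "\<And>i. i \<le> n \<Longrightarrow> sobolev_le L (m + 4) (fcoef L (\<lambda>z. f_kappa \<kappa> (\<phi> i z))) D"
    and \<zeta>: "\<And>i. i < n \<Longrightarrow> continuous_on UNIV (\<zeta> i)" "\<And>i. i < n \<Longrightarrow> periodic2 L (\<zeta> i)"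
    and eq: "\<And>i. i < n \<Longrightarrow> AE z in lborel. \<phi> (Suc i) z = \<phi> 0 z + \<tau> * (\<Sum>j\<le>i. \<alpha> i j * ch_rhs L \<epsilon> \<kappa> (\<lambda>z. (\<phi> j z + \<phi> (Suc j) z) / 2) (\<phi> j) z) + \<tau> * \<zeta> i z"
  shows "\<exists>r. (\<forall>j<n. (\<Sum>k\<in>modes M. (norm (r j k))\<^sup>2) \<le> weight_sum L * ((L / M)\<^sup>2) ^ m * (2 * (1 + \<kappa>)\<^sup>2 * B + 2 * D)) \<and>
    (\<forall>i<n. \<forall>k\<in>modes M. dcoef L M (\<lambda>z. of_real (\<phi> (Suc i) z)) k = dcoef L M (\<lambda>z. of_real (\<phi> 0 z)) k
      + \<tau> * (\<Sum>j\<le>i. of_real (\<alpha> i j) * (- of_real (ch_symbol L \<epsilon> \<kappa> k) * ((dcoef L M (\<lambda>z. of_real (\<phi> j z)) k + dcoef L M (\<lambda>z. of_real (\<phi> (Suc j) z)) k) / 2)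
          + of_real (freq2 L k) * dcoef L M (\<lambda>z. f_kappa \<kappa> (of_real (\<phi> j z))) k + r j k))
      + \<tau> * dcoef L M (\<lambda>z. of_real (\<zeta> i z)) k)"
proof -
  let ?v = "\<lambda>j z. (\<phi> j z + \<phi> (Suc j) z) / 2" and ?g = "\<lambda>j z. f_kappa \<kappa> (\<phi> j z)"
  define Z where "Z = (\<lambda>j q. - of_real (ch_symbol L \<epsilon> \<kappa> q) * fcoef L (?v j) q + of_real (freq2 L q) * fcoef L (?g j) q)"
  have \<phi>L: "L2per L (\<phi> i)" if "i \<le> n" for i using assms(1) \<phi>(1,2)[OF that] by (rule L2per_continuous)
  have vc: "continuous_on UNIV (?v j)" "periodic2 L (?v j)" if "j < n" for j
    using \<phi>(1,2)[of j] \<phi>(1,2)[of "Suc j"] that by (auto intro!: continuous_intros simp: periodic2_def)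
  have gc: "continuous_on UNIV (?g j)" "periodic2 L (?g j)" if "j \<le> n" for j
    using \<phi>(1,2)[OF that] unfolding f_kappa_eq by (auto intro!: continuous_intros simp: periodic2_def)
  have vs: "sobolev_le L (m + 6) (fcoef L (?v j)) B" if "j < n" for j
  proof -
    have e: "?v j = (\<lambda>z. (1 / 2) * \<phi> j z + (1 / 2) * \<phi> (Suc j) z)" by (auto simp: field_simps)
    have c: "fcoef L (?v j) k = of_real (1 / 2) * fcoef L (\<phi> j) k + of_real (1 / 2) * fcoef L (\<phi> (Suc j)) k" for k
    proof -
      have "fcoef L (\<lambda>z. (1 / 2) * \<phi> j z + (1 / 2) * \<phi> (Suc j) z) k = fcoef L (\<lambda>z. (1 / 2) * \<phi> j z) k + fcoef L (\<lambda>z. (1 / 2) * \<phi> (Suc j) z) k"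
        using that by (intro fcoef_add[OF assms(1)] L2per_cmult \<phi>L) auto
      then show ?thesis unfolding e fcoef_cmult .
    qed
    have "sobolev_le L (m + 6) (fcoef L (?v j)) (2 * ((norm (complex_of_real (1 / 2)))\<^sup>2 * B) + 2 * ((norm (complex_of_real (1 / 2)))\<^sup>2 * B))"
      unfolding c[abs_def] using that by (intro sobolev_le_add sobolev_le_cmult \<phi>(3)) auto
    then show ?thesis by (simp add: norm_divide power_divide)
  qed
  have "\<forall>j. \<exists>r. j < n \<longrightarrow> (\<forall>k\<in>modes M. (Z j has_sum (- of_real (ch_symbol L \<epsilon> \<kappa> k) * dcoef L M (\<lambda>z. of_real (?v j z)) k
        + of_real (freq2 L k) * dcoef L M (\<lambda>z. of_real (?g j z)) k + r k)) (aliases M k)) \<and>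
      (\<Sum>k\<in>modes M. (norm (r k))\<^sup>2) \<le> weight_sum L * ((L / M)\<^sup>2) ^ m * (2 * (1 + \<kappa>)\<^sup>2 * B + 2 * D)"
  proof
    fix j
    show "\<exists>r. j < n \<longrightarrow> (\<forall>k\<in>modes M. (Z j has_sum (- of_real (ch_symbol L \<epsilon> \<kappa> k) * dcoef L M (\<lambda>z. of_real (?v j z)) k
        + of_real (freq2 L k) * dcoef L M (\<lambda>z. of_real (?g j z)) k + r k)) (aliases M k)) \<and>
      (\<Sum>k\<in>modes M. (norm (r k))\<^sup>2) \<le> weight_sum L * ((L / M)\<^sup>2) ^ m * (2 * (1 + \<kappa>)\<^sup>2 * B + 2 * D)"
    proof (cases "j < n")
      case True
      then show ?thesis
        using consistency_residual(1)[OF assms(1) M \<epsilon> \<kappa> vc[OF True] vs[OF True] gc[of j] f\<phi>[of j]] unfolding Z_def by auto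
    qed simp
  qed
  from choice[OF this] obtain r where r: "\<And>j k. j < n \<Longrightarrow> k \<in> modes M \<Longrightarrow> (Z j has_sum (- of_real (ch_symbol L \<epsilon> \<kappa> k) * dcoef L M (\<lambda>z. of_real (?v j z)) k
        + of_real (freq2 L k) * dcoef L M (\<lambda>z. of_real (?g j z)) k + r j k)) (aliases M k)"
    and rb: "\<And>j. j < n \<Longrightarrow> (\<Sum>k\<in>modes M. (norm (r j k))\<^sup>2) \<le> weight_sum L * ((L / M)\<^sup>2) ^ m * (2 * (1 + \<kappa>)\<^sup>2 * B + 2 * D)"
    by blast
  have Zs: "Z j summable_on UNIV" if "j < n" for j
    unfolding Z_def using consistency_residual(2)[OF assms(1) M \<epsilon> \<kappa> vc[OF that] vs[OF that] gc f\<phi>] that by auto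
  have abs\<phi>: "(\<lambda>k. norm (fcoef L (\<phi> i) k)) summable_on UNIV" if "i \<le> n" for i
    using assms(1) \<phi>(3)[OF that] by (rule sobolev_le_abs_summable) simp
  have rhsL: "L2per L (ch_rhs L \<epsilon> \<kappa> (?v j) (\<phi> j))" and rhsc: "fcoef L (ch_rhs L \<epsilon> \<kappa> (?v j) (\<phi> j)) q = Z j q" if "j < n" for j q
  proof -
    have 1: "L2per L (?v j)" using assms(1) vc[OF that] by (rule L2per_continuous)
    have 2: "L2per L (?g j)" using assms(1) gc that by (intro L2per_continuous) auto
    have 3: "sobolev_le L (m + 4) (fcoef L (?v j)) B" using vs[OF that] by (rule sobolev_le_weaken) simp
    have 4: "sobolev_le L (m + 2) (fcoef L (?g j)) D" using that by (intro sobolev_le_weaken[OF f\<phi>]) auto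
    show "L2per L (ch_rhs L \<epsilon> \<kappa> (?v j) (\<phi> j))" by (rule L2per_ch_rhs[OF assms(1) 1 3 2 4 \<open>1 \<le> m\<close>])
    show "fcoef L (ch_rhs L \<epsilon> \<kappa> (?v j) (\<phi> j)) q = Z j q" unfolding Z_def by (rule fcoef_ch_rhs[OF assms(1) 1 3 2 4 \<open>1 \<le> m\<close>])
  qed
  have stage: "dcoef L M (\<lambda>z. of_real (\<phi> (Suc i) z)) k = dcoef L M (\<lambda>z. of_real (\<phi> 0 z)) k
      + \<tau> * (\<Sum>j\<le>i. of_real (\<alpha> i j) * (- of_real (ch_symbol L \<epsilon> \<kappa> k) * ((dcoef L M (\<lambda>z. of_real (\<phi> j z)) k + dcoef L M (\<lambda>z. of_real (\<phi> (Suc j) z)) k) / 2)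
          + of_real (freq2 L k) * dcoef L M (\<lambda>z. f_kappa \<kappa> (of_real (\<phi> j z))) k + r j k))
      + \<tau> * dcoef L M (\<lambda>z. of_real (\<zeta> i z)) k" if i: "i < n" and k: "k \<in> modes M" for i k
  proof -
    have \<zeta>L: "L2per L (\<zeta> i)" using assms(1) \<zeta>[OF i] by (rule L2per_continuous)
    let ?S = "\<lambda>z. \<Sum>j\<le>i. \<alpha> i j * ch_rhs L \<epsilon> \<kappa> (?v j) (\<phi> j) z"
    have SL: "L2per L ?S" using i by (intro L2per_sum L2per_cmult rhsL) auto
    have Sc: "fcoef L ?S q = (\<Sum>j\<le>i. of_real (\<alpha> i j) * Z j q)" for q
    proof -
      have "fcoef L ?S q = (\<Sum>j\<le>i. fcoef L (\<lambda>z. \<alpha> i j * ch_rhs L \<epsilon> \<kappa> (?v j) (\<phi> j) z) q)"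
        using i by (intro fcoef_sum[OF assms(1)] L2per_cmult rhsL) auto
      also have "\<dots> = (\<Sum>j\<le>i. of_real (\<alpha> i j) * Z j q)"
        using i by (intro sum.cong refl) (simp add: fcoef_cmult rhsc)
      finally show ?thesis .
    qed
    have coef: "fcoef L (\<phi> (Suc i)) q = fcoef L (\<phi> 0) q + of_real \<tau> * (\<Sum>j\<le>i. of_real (\<alpha> i j) * Z j q) + of_real \<tau> * fcoef L (\<zeta> i) q" for q
    proof -
      have a: "L2per L (\<lambda>z. \<phi> 0 z + \<tau> * ?S z)" using SL by (intro L2per_add L2per_cmult \<phi>L) auto
      have b: "L2per L (\<lambda>z. \<phi> 0 z + \<tau> * ?S z + \<tau> * \<zeta> i z)" using \<zeta>L by (intro L2per_add[OF a] L2per_cmult)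
      have "fcoef L (\<phi> (Suc i)) q = fcoef L (\<lambda>z. \<phi> 0 z + \<tau> * ?S z + \<tau> * \<zeta> i z) q"
        using i by (intro fcoef_cong_AE[OF \<phi>L b eq]) auto
      also have "\<dots> = fcoef L (\<phi> 0) q + of_real \<tau> * fcoef L ?S q + of_real \<tau> * fcoef L (\<zeta> i) q"
        unfolding fcoef_add[OF assms(1) a L2per_cmult[OF \<zeta>L]] fcoef_add[OF assms(1) \<phi>L[OF le0] L2per_cmult[OF SL]] fcoef_cmult ..
      finally show ?thesis unfolding Sc .
    qed
    \<comment> \<open>The defect is only assumed continuous, which does not make its coefficients
      summable. Solving the stage equation for them shows that they are, so the aliasing formula
      applies to the defect as well.\<close>
    have \<zeta>c: "fcoef L (\<zeta> i) = (\<lambda>q. of_real (1 / \<tau>) * (fcoef L (\<phi> (Suc i)) q + (- 1) * fcoef L (\<phi> 0) q) + (- 1) * (\<Sum>j\<le>i. of_real (\<alpha> i j) * Z j q))"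
      using \<open>0 < \<tau>\<close> unfolding coef by (auto simp: fun_eq_iff field_simps)
    have s\<phi>: "fcoef L (\<phi> i') summable_on UNIV" if "i' \<le> n" for i'
      by (rule abs_summable_summable[OF abs\<phi>[OF that]])
    have sS: "(\<lambda>q. \<Sum>j\<le>i. of_real (\<alpha> i j) * Z j q) summable_on UNIV"
    proof -
      have "((\<lambda>q. \<Sum>j\<in>{..i}. of_real (\<alpha> i j) * Z j q) has_sum (\<Sum>j\<in>{..i}. of_real (\<alpha> i j) * infsum (Z j) UNIV)) UNIV"
        using i by (intro has_sum_finite_sum has_sum_cmult_right has_sum_infsum Zs) auto
      then show ?thesis by (rule has_sum_imp_summable)
    qed
    have "fcoef L (\<zeta> i) summable_on UNIV"
      unfolding \<zeta>c using i by (intro summable_on_add summable_on_cmult_right sS s\<phi>) auto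
    then have abs\<zeta>: "(\<lambda>k. norm (fcoef L (\<zeta> i) k)) summable_on UNIV"
      by (simp add: summable_on_iff_abs_summable_on_complex)
    let ?r = "\<lambda>j. - of_real (ch_symbol L \<epsilon> \<kappa> k) * dcoef L M (\<lambda>z. of_real (?v j z)) k
        + of_real (freq2 L k) * dcoef L M (\<lambda>z. of_real (?g j z)) k + r j k"
    \<comment> \<open>The coefficient identity is summed over the class of \<open>k\<close> term by
      term; uniqueness of the sum turns it into an equation between discrete coefficients.\<close>
    have "((\<lambda>q. fcoef L (\<phi> 0) q + of_real \<tau> * (\<Sum>j\<le>i. of_real (\<alpha> i j) * Z j q) + of_real \<tau> * fcoef L (\<zeta> i) q) has_sum
        dcoef L M (\<lambda>z. of_real (\<phi> 0 z)) k + of_real \<tau> * (\<Sum>j\<le>i. of_real (\<alpha> i j) * ?r j) + of_real \<tau> * dcoef L M (\<lambda>z. of_real (\<zeta> i z)) k) (aliases M k)"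
      using i k by (intro has_sum_add has_sum_cmult_right has_sum_finite_sum r
          dcoef_has_sum[OF assms(1) M(1)] \<phi> \<zeta> abs\<phi> abs\<zeta>) auto
    then have "(fcoef L (\<phi> (Suc i)) has_sum
        dcoef L M (\<lambda>z. of_real (\<phi> 0 z)) k + of_real \<tau> * (\<Sum>j\<le>i. of_real (\<alpha> i j) * ?r j) + of_real \<tau> * dcoef L M (\<lambda>z. of_real (\<zeta> i z)) k) (aliases M k)"
      unfolding coef[symmetric] .
    moreover have "(fcoef L (\<phi> (Suc i)) has_sum dcoef L M (\<lambda>z. of_real (\<phi> (Suc i) z)) k) (aliases M k)"
      using i by (intro dcoef_has_sum[OF assms(1) M(1)] \<phi> abs\<phi>) auto
    ultimately have "dcoef L M (\<lambda>z. of_real (\<phi> (Suc i) z)) k = dcoef L M (\<lambda>z. of_real (\<phi> 0 z)) k + of_real \<tau> * (\<Sum>j\<le>i. of_real (\<alpha> i j) * ?r j) + of_real \<tau> * dcoef L M (\<lambda>z. of_real (\<zeta> i z)) k"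
      by (rule has_sum_unique[symmetric])
    moreover have "dcoef L M (\<lambda>z. of_real (?v j z)) k = (dcoef L M (\<lambda>z. of_real (\<phi> j z)) k + dcoef L M (\<lambda>z. of_real (\<phi> (Suc j) z)) k) / 2" for j
    proof -
      have h: "(\<lambda>z. complex_of_real (?v j z)) = (\<lambda>z. (1 / 2) * (of_real (\<phi> j z) + of_real (\<phi> (Suc j) z)))" by auto
      show ?thesis unfolding h dcoef_cmult dcoef_add by simp
    qed
    ultimately show ?thesis by (simp only: of_real_f_kappa)
  qed
  show ?thesis by (intro exI[of _ r] conjI allI impI ballI rb stage)
qed

text \<open>Only stages up to \<open>K\<close> need errors at most 1, although the bound concerns
  stage \<open>K + 1\<close>: the nonlinearity is evaluated explicitly, so the new stage enters on
  the right through the first sum alone. \<open>bb\<close> is the squared Frobenius norm of the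
  stage matrix, which bounds its action on nonlinear differences and residuals.\<close>

lemma stage_energy:
  fixes w u :: "nat \<Rightarrow> real \<times> real \<Rightarrow> complex" and r Z :: "nat \<Rightarrow> int \<times> int \<Rightarrow> complex"
    and L \<epsilon> \<kappa> \<beta> \<tau> \<rho> \<zeta> Cf :: real and M n K :: nat and a :: "nat \<Rightarrow> nat \<Rightarrow> real"
    and rhs :: "(nat \<Rightarrow> real \<times> real \<Rightarrow> complex) \<Rightarrow> nat \<Rightarrow> int \<times> int \<Rightarrow> complex"
  defines "E \<equiv> \<lambda>i. dnorm2_sq L M (\<lambda>z. w i z - u i z)"
  defines "rhs \<equiv> \<lambda>v j k. - of_real (ch_symbol L \<epsilon> \<kappa> k) * ((dcoef L M (v j) k + dcoef L M (v (Suc j)) k) / 2)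
      + of_real (freq2 L k) * dcoef L M (\<lambda>z. f_kappa \<kappa> (v j z)) k"
  defines "bb \<equiv> \<Sum>i<n. \<Sum>j<n. (stage_matrix a i j)\<^sup>2"
  assumes "0 < \<epsilon>" and "0 \<le> \<kappa>" and "0 < \<beta>" and "0 \<le> \<tau>"
    and coer: "\<And>k x. k \<le> n \<Longrightarrow> \<beta> * (\<Sum>i<k. (x i)\<^sup>2) \<le> (\<Sum>i<k. \<Sum>j<k. stage_matrix a i j * x i * x j)"
    and w: "\<And>i k. i < n \<Longrightarrow> k \<in> modes M \<Longrightarrow> dcoef L M (w (Suc i)) k = dcoef L M (w 0) k
      + \<tau> * (\<Sum>j\<le>i. of_real (a (i + 2) (j + 1)) * (rhs w j k + r j k)) + \<tau> * Z i k"
    and u: "\<And>i k. i < n \<Longrightarrow> k \<in> modes M \<Longrightarrow> dcoef L M (u (Suc i)) k = dcoef L M (u 0) k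
      + \<tau> * (\<Sum>j\<le>i. of_real (a (i + 2) (j + 1)) * rhs u j k)"
    and Z0: "\<And>i k. Suc i < n \<Longrightarrow> k \<in> modes M \<Longrightarrow> Z i k = 0"
    and r: "\<And>j. j < n \<Longrightarrow> (\<Sum>k\<in>modes M. (norm (r j k))\<^sup>2) \<le> \<rho>"
    and Z: "\<And>i. i < n \<Longrightarrow> (\<Sum>k\<in>modes M. (norm (Z i k))\<^sup>2) \<le> \<zeta>"
    and lip: "\<And>j. j < n \<Longrightarrow> E j \<le> 1 \<Longrightarrow> dnorm2_sq L M (\<lambda>z. f_kappa \<kappa> (w j z) - f_kappa \<kappa> (u j z)) \<le> Cf * E j"
    and "0 \<le> Cf" and K: "K < n" "\<forall>i\<le>K. E i \<le> 1"
  shows "E (Suc K) \<le> E 0 + \<tau> * (\<epsilon>\<^sup>2 * \<beta> * (\<Sum>i\<le>Suc K. E i) + bb * Cf * (\<Sum>i\<le>K. E i) / (\<epsilon>\<^sup>2 * \<beta>)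
     + 4 * n * (bb * \<rho> + \<zeta>) / (\<epsilon>\<^sup>2 * \<beta>))"
proof -
  let ?b = "stage_matrix a" and ?N = "Suc K" and ?\<delta> = "\<epsilon>\<^sup>2 * \<beta>"
  have \<delta>: "0 < ?\<delta>" using assms by simp
  define e where "e = (\<lambda>k i. dcoef L M (\<lambda>z. w i z - u i z) k)"
  define y where "y = (\<lambda>k i. (e k i + e k (Suc i)) / 2)"
  define g where "g = (\<lambda>k j. dcoef L M (\<lambda>z. f_kappa \<kappa> (w j z) - f_kappa \<kappa> (u j z)) k)"
  define G where "G = (\<lambda>k i. \<Sum>j<?N. of_real (?b i j) * g k j)"
  \<comment> \<open>The defect joins the residual and not \<open>G\<close>: it is controlled only
    without the weight.\<close>
  define R where "R = (\<lambda>k i. (\<Sum>j<?N. of_real (?b i j) * r j k) + Z i k)"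
  let ?W = "\<lambda>k. (1 + freq2 L k)\<^sup>2"
  have mode: "?W k * (norm (e k ?N))\<^sup>2 \<le> ?W k * (norm (e k 0))\<^sup>2 + \<tau> * (?\<delta> * (\<Sum>i\<le>?N. ?W k * (norm (e k i))\<^sup>2)
     + (\<Sum>i<?N. ?W k * (norm (G k i))\<^sup>2) / ?\<delta> + 2 * (\<Sum>i<?N. (norm (R k i))\<^sup>2) / ?\<delta>)" if k: "k \<in> modes M" for k
  proof (rule mode_energy[where b = ?b and \<mu> = "ch_symbol L \<epsilon> \<kappa> k" and lam = "freq2 L k" and y = "y k"])
    show "\<epsilon>\<^sup>2 * (freq2 L k)\<^sup>2 \<le> ch_symbol L \<epsilon> \<kappa> k"
      using \<open>0 \<le> \<kappa>\<close> by (simp add: ch_symbol_def power2_eq_square distrib_left mult_ac)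
    fix i assume i: "i < ?N"
    let ?R = "\<lambda>j. - of_real (ch_symbol L \<epsilon> \<kappa> k) * y k j + of_real (freq2 L k) * g k j + r j k"
    have rhs: "rhs w j k + r j k - rhs u j k = ?R j" for j
      by (simp add: rhs_def y_def e_def g_def dcoef_diff field_simps)
    have cum: "e k (Suc i) = e k 0 + \<tau> * (\<Sum>j\<le>i. of_real (a (i + 2) (j + 1)) * ?R j) + \<tau> * Z i k" if "i < n" for i
    proof -
      have S: "(\<Sum>j\<le>i. of_real (a (i + 2) (j + 1)) * ?R j) = (\<Sum>j\<le>i. of_real (a (i + 2) (j + 1)) * (rhs w j k + r j k)) - (\<Sum>j\<le>i. of_real (a (i + 2) (j + 1)) * rhs u j k)"
        unfolding rhs[symmetric] sum_subtractf[symmetric] right_diff_distrib ..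
      have lin: "x + t * W' + t * z - (x' + t * U) = (x - x') + t * (W' - U) + t * z" for x x' t W' U z :: complex
        by (simp add: algebra_simps)
      show ?thesis unfolding S unfolding e_def dcoef_diff w[OF that k] u[OF that k] by (rule lin)
    qed
    have "e k (Suc i) - e k i = \<tau> * (\<Sum>j<?N. of_real (?b i j) * ?R j) + \<tau> * Z i k"
      using stage_increment[of n "e k" \<tau> a ?R "\<lambda>i. Z i k" i ?N, OF cum Z0[OF _ k] i] K(1) by simp
    also have "(\<Sum>j<?N. of_real (?b i j) * ?R j) = (\<Sum>j<?N. of_real (?b i j) * (- of_real (ch_symbol L \<epsilon> \<kappa> k) * y k j)) + (of_real (freq2 L k) * G k i + (\<Sum>j<?N. of_real (?b i j) * r j k))"
      unfolding G_def sum_distrib_left sum.distrib[symmetric] by (intro sum.cong refl) (simp add: algebra_simps)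
    finally have "e k (Suc i) - e k i = \<tau> * (\<Sum>j<?N. of_real (?b i j) * (- of_real (ch_symbol L \<epsilon> \<kappa> k) * y k j)) + \<tau> * (of_real (freq2 L k) * G k i + R k i)"
      by (simp add: R_def distrib_left add.assoc)
    then show "e k (Suc i) - e k i = \<tau> * (\<Sum>j<?N. ?b i j * (- ch_symbol L \<epsilon> \<kappa> k * y k j)) + \<tau> * (freq2 L k * G k i + R k i)"
      by simp
  next
    show "\<beta> * (\<Sum>i<?N. (x i)\<^sup>2) \<le> (\<Sum>i<?N. \<Sum>j<?N. ?b i j * x i * x j)" for x
      using K(1) by (intro coer) simp
  qed (use assms(4-7) in \<open>simp_all add: y_def\<close>)
  have bsum: "(\<Sum>i<?N. \<Sum>j<?N. (?b i j)\<^sup>2) \<le> bb"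
  proof -
    have "(\<Sum>i<?N. \<Sum>j<?N. (?b i j)\<^sup>2) \<le> (\<Sum>i<?N. \<Sum>j<n. (?b i j)\<^sup>2)"
      using K(1) by (intro sum_mono sum_mono2) auto
    also have "\<dots> \<le> bb" unfolding bb_def using K(1) by (intro sum_mono2 sum_nonneg) auto
    finally show ?thesis .
  qed
  have mat: "(\<Sum>i<?N. (norm (\<Sum>j<?N. of_real (?b i j) * x j))\<^sup>2) \<le> bb * (\<Sum>j<?N. (norm (x j))\<^sup>2)" for x :: "nat \<Rightarrow> complex"
  proof -
    have "(norm (\<Sum>j<?N. of_real (?b i j) * x j))\<^sup>2 \<le> (\<Sum>j<?N. (?b i j)\<^sup>2) * (\<Sum>j<?N. (norm (x j))\<^sup>2)" for i
    proof -
      have "norm (\<Sum>j<?N. of_real (?b i j) * x j) \<le> (\<Sum>j<?N. \<bar>?b i j\<bar> * norm (x j))"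
        by (rule order_trans[OF norm_sum]) (simp add: norm_mult)
      then have "(norm (\<Sum>j<?N. of_real (?b i j) * x j))\<^sup>2 \<le> (\<Sum>j<?N. \<bar>?b i j\<bar> * norm (x j))\<^sup>2" by (rule power_mono) simp
      also have "\<dots> \<le> (\<Sum>j<?N. \<bar>?b i j\<bar>\<^sup>2) * (\<Sum>j<?N. (norm (x j))\<^sup>2)" by (rule Cauchy_Schwarz_ineq_sum)
      finally show ?thesis by simp
    qed
    then have "(\<Sum>i<?N. (norm (\<Sum>j<?N. of_real (?b i j) * x j))\<^sup>2) \<le> (\<Sum>i<?N. (\<Sum>j<?N. (?b i j)\<^sup>2) * (\<Sum>j<?N. (norm (x j))\<^sup>2))"
      by (rule sum_mono)
    also have "\<dots> = (\<Sum>i<?N. \<Sum>j<?N. (?b i j)\<^sup>2) * (\<Sum>j<?N. (norm (x j))\<^sup>2)" by (rule sum_distrib_right[symmetric])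
    also have "\<dots> \<le> bb * (\<Sum>j<?N. (norm (x j))\<^sup>2)" using bsum by (intro mult_right_mono sum_nonneg) auto
    finally show ?thesis .
  qed
  have bb0: "0 \<le> bb" unfolding bb_def by (intro sum_nonneg) auto
  have Gb: "(\<Sum>k\<in>modes M. \<Sum>i<?N. ?W k * (norm (G k i))\<^sup>2) \<le> bb * Cf * (\<Sum>i\<le>K. E i)"
  proof -
    have "(\<Sum>k\<in>modes M. \<Sum>i<?N. ?W k * (norm (G k i))\<^sup>2) \<le> (\<Sum>k\<in>modes M. ?W k * (bb * (\<Sum>j<?N. (norm (g k j))\<^sup>2)))"
      unfolding G_def sum_distrib_left[symmetric] by (intro sum_mono mult_left_mono mat) auto
    also have "\<dots> = bb * (\<Sum>k\<in>modes M. \<Sum>j<?N. ?W k * (norm (g k j))\<^sup>2)"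
      by (simp only: sum_distrib_left mult.left_commute[of bb])
    also have "(\<Sum>k\<in>modes M. \<Sum>j<?N. ?W k * (norm (g k j))\<^sup>2) = (\<Sum>j<?N. \<Sum>k\<in>modes M. ?W k * (norm (g k j))\<^sup>2)"
      by (rule sum.swap)
    also have "bb * (\<Sum>j<?N. \<Sum>k\<in>modes M. ?W k * (norm (g k j))\<^sup>2) \<le> bb * (\<Sum>j<?N. Cf * E j)"
    proof (intro mult_left_mono sum_mono bb0)
      fix j assume "j \<in> {..<?N}"
      then show "(\<Sum>k\<in>modes M. ?W k * (norm (g k j))\<^sup>2) \<le> Cf * E j"
        using lip[of j] K unfolding g_def dnorm2_sq_def by auto
    qed
    finally show ?thesis unfolding lessThan_Suc_atMost by (simp only: sum_distrib_left[symmetric] mult.assoc)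
  qed
  have Rb: "(\<Sum>k\<in>modes M. \<Sum>i<?N. (norm (R k i))\<^sup>2) \<le> 2 * n * (bb * \<rho> + \<zeta>)"
  proof -
    have \<rho>0: "0 \<le> \<rho>" and \<zeta>0: "0 \<le> \<zeta>" using r[OF K(1)] Z[OF K(1)] by (meson order_trans sum_nonneg zero_le_power2)+
    have "(\<Sum>k\<in>modes M. \<Sum>i<?N. (norm (R k i))\<^sup>2) \<le>
       (\<Sum>k\<in>modes M. \<Sum>i<?N. 2 * (norm (\<Sum>j<?N. of_real (?b i j) * r j k))\<^sup>2 + 2 * (norm (Z i k))\<^sup>2)"
      unfolding R_def by (intro sum_mono norm_add_sq_le)
    also have "\<dots> = 2 * (\<Sum>k\<in>modes M. \<Sum>i<?N. (norm (\<Sum>j<?N. of_real (?b i j) * r j k))\<^sup>2) + 2 * (\<Sum>k\<in>modes M. \<Sum>i<?N. (norm (Z i k))\<^sup>2)"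
      by (simp only: sum.distrib sum_distrib_left)
    also have "\<dots> \<le> 2 * (\<Sum>k\<in>modes M. bb * (\<Sum>j<?N. (norm (r j k))\<^sup>2)) + 2 * (\<Sum>k\<in>modes M. \<Sum>i<?N. (norm (Z i k))\<^sup>2)"
      by (intro add_right_mono mult_left_mono sum_mono mat) auto
    also have "\<dots> = 2 * (bb * (\<Sum>j<?N. \<Sum>k\<in>modes M. (norm (r j k))\<^sup>2)) + 2 * (\<Sum>i<?N. \<Sum>k\<in>modes M. (norm (Z i k))\<^sup>2)"
      by (simp only: sum_distrib_left[symmetric] sum.swap[of _ "modes M"])
    also have "\<dots> \<le> 2 * (bb * (\<Sum>j<?N. \<rho>)) + 2 * (\<Sum>i<?N. \<zeta>)"
      using K(1) by (intro add_mono mult_left_mono sum_mono r Z bb0) auto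
    also have "\<dots> = 2 * ?N * (bb * \<rho> + \<zeta>)" by (simp add: algebra_simps)
    also have "\<dots> \<le> 2 * n * (bb * \<rho> + \<zeta>)"
      using K(1) bb0 \<rho>0 \<zeta>0 by (intro mult_right_mono add_nonneg_nonneg mult_nonneg_nonneg) auto
    finally show ?thesis by simp
  qed
  have Ee: "E i = (\<Sum>k\<in>modes M. ?W k * (norm (e k i))\<^sup>2)" for i
    by (simp add: E_def dnorm2_sq_def e_def)
  have "E ?N \<le> (\<Sum>k\<in>modes M. ?W k * (norm (e k 0))\<^sup>2 + \<tau> * (?\<delta> * (\<Sum>i\<le>?N. ?W k * (norm (e k i))\<^sup>2)
     + (\<Sum>i<?N. ?W k * (norm (G k i))\<^sup>2) / ?\<delta> + 2 * (\<Sum>i<?N. (norm (R k i))\<^sup>2) / ?\<delta>))"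
    unfolding Ee[of ?N] by (intro sum_mono mode)
  also have "\<dots> = E 0 + \<tau> * (?\<delta> * (\<Sum>i\<le>?N. E i) + (\<Sum>k\<in>modes M. \<Sum>i<?N. ?W k * (norm (G k i))\<^sup>2) / ?\<delta>
      + 2 * (\<Sum>k\<in>modes M. \<Sum>i<?N. (norm (R k i))\<^sup>2) / ?\<delta>)"
  proof -
    have "(\<Sum>i\<le>?N. E i) = (\<Sum>k\<in>modes M. \<Sum>i\<le>?N. ?W k * (norm (e k i))\<^sup>2)"
      unfolding Ee by (rule sum.swap)
    then show ?thesis unfolding Ee[of 0]
      by (simp only: sum.distrib sum_distrib_left[symmetric] sum_divide_distrib[symmetric])
  qed
  also have "\<dots> \<le> E 0 + \<tau> * (?\<delta> * (\<Sum>i\<le>?N. E i) + bb * Cf * (\<Sum>i\<le>K. E i) / ?\<delta> + 2 * (2 * n * (bb * \<rho> + \<zeta>)) / ?\<delta>)"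
    using Gb Rb \<delta> \<open>0 \<le> \<tau>\<close> by (intro add_left_mono mult_left_mono add_mono divide_right_mono order_refl) auto
  finally show ?thesis by (simp add: mult.assoc)
qed

lemma sobolev_le_f_kappa:
  assumes "0 < L" and v: "continuous_on UNIV v" "periodic2 L v" "sobolev_le L q (fcoef L v) B" and q: "2 \<le> q"
  defines "A \<equiv> 2 * 4 ^ q * weight_sum L"
  shows "sobolev_le L q (fcoef L (\<lambda>z. f_kappa \<kappa> (v z))) (2 * (\<kappa>\<^sup>2 * B) + 2 * (2 * (A * B * (A * B * B)) + 2 * B))"
proof -
  have eq: "f_kappa \<kappa> (v z) = \<kappa> * v z + (- 1) * deriv F (v z)" for z by (simp add: f_kappa_def)
  have vL: "L2per L v" using assms(1) v(1,2) by (rule L2per_continuous)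
  note F = sobolev_le_deriv_F[OF assms(1) v q]
  have c: "fcoef L (\<lambda>z. f_kappa \<kappa> (v z)) k = of_real \<kappa> * fcoef L v k + of_real (- 1) * fcoef L (\<lambda>z. deriv F (v z)) k" for k
    unfolding eq fcoef_add[OF assms(1) L2per_cmult[OF vL] L2per_cmult[OF F(2)]] fcoef_cmult ..
  show ?thesis
    unfolding c[abs_def] A_def using sobolev_le_add[OF sobolev_le_cmult[OF v(3), of "of_real \<kappa>"] sobolev_le_cmult[OF F(1), of "of_real (- 1)"]]
    by simp
qed

lemma dcoef_half: "dcoef L M (half v j) k = (dcoef L M (v j) k + dcoef L M (v (Suc j)) k) / 2"
proof -
  have "half v j = (\<lambda>z. (1 / 2) * (v j z + v (Suc j) z))" by (auto simp: half_def)
  then show ?thesis by (simp only: dcoef_cmult dcoef_add) simp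
qed

lemma sum_from_1: "(\<Sum>j=1..Suc i. f j) = (\<Sum>j\<le>i. f (Suc j))"
  by (rule sum.reindex_bij_witness[of _ Suc "\<lambda>j. j - 1"]) auto

text \<open>The constant is produced before the grid, the time mesh, the step and the discrete
  solution are quantified; this order is the uniformity that the convergence result claims.
  \<open>\<eta>\<close> stands for the temporal accuracy, so
  \<open>((L / M)\<^sup>2) ^ m + \<eta>\<^sup>2\<close> has the size of the squared error.\<close>

lemma step_estimate:
  fixes L T \<epsilon> \<kappa> K2 :: real and m p s :: nat and a :: "nat \<Rightarrow> nat \<Rightarrow> real"
  assumes L: "0 < L" and \<epsilon>: "0 < \<epsilon>" "\<epsilon> < 1" and \<kappa>: "0 \<le> \<kappa>" and "1 \<le> m"
    and coeffs: "ierk_coeffs s a" and pd: "pos_def_mat (s - 1) (the (mat_inverse (D_R s a)))"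
    and \<Phi>: "\<And>t. t \<in> {0..T} \<Longrightarrow> continuous_on UNIV (\<Phi> t)" "\<And>t. t \<in> {0..T} \<Longrightarrow> periodic2 L (\<Phi> t)"
      "\<And>t. t \<in> {0..T} \<Longrightarrow> sobolev_le L (m + 6) (fcoef L (\<Phi> t)) B"
  shows "\<exists>C>0. \<forall>M t n u \<zeta> \<eta>. even M \<and> 0 < M \<and> 0 < step t n \<and> C * step t n \<le> 1 / 2 \<and> 0 \<le> \<eta> \<and>
     (\<forall>i\<in>{1..s}. t (n - 1) + abscissa a i * step t n \<in> {0..T}) \<and>
     (\<forall>i\<in>{1..s-1}. continuous_on UNIV (\<zeta> (i + 1)) \<and> periodic2 L (\<zeta> (i + 1)) \<and>
        (AE z in lborel. stage_exact a t \<Phi> n (i + 1) z = stage_exact a t \<Phi> n 1 z + step t n *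
           (\<Sum>j=1..i. a (i + 1) j *
              ch_rhs L \<epsilon> \<kappa> (half (stage_exact a t \<Phi> n) j) (stage_exact a t \<Phi> n j) z)
           + step t n * \<zeta> (i + 1) z)) \<and>
     (\<forall>i\<in>{1..<s-1}. \<forall>z. \<zeta> (i + 1) z = 0) \<and>
     dnorm L M (\<zeta> s) \<le> K2 * \<eta> \<and>
     (\<forall>z\<in>grid L M. \<forall>i\<in>{1..s-1}. u (i + 1) z = u 1 z + of_real (step t n) *
           (\<Sum>j=1..i. of_real (a (i + 1) j) * ch_rhs_h L M \<epsilon> \<kappa> (half u j) (u j) z)) \<and>
     4 ^ (s - 1) * (dnorm2_sq L M (\<lambda>z. of_real (stage_exact a t \<Phi> n 1 z) - u 1 z) + (((L / M)\<^sup>2) ^ m + \<eta>\<^sup>2)) \<le> 1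
     \<longrightarrow> dnorm2_sq L M (\<lambda>z. of_real (stage_exact a t \<Phi> n s z) - u s z) \<le>
         dnorm2_sq L M (\<lambda>z. of_real (stage_exact a t \<Phi> n 1 z) - u 1 z)
         + step t n * (C * (dnorm2_sq L M (\<lambda>z. of_real (stage_exact a t \<Phi> n 1 z) - u 1 z) + (((L / M)\<^sup>2) ^ m + \<eta>\<^sup>2)))"
proof -
  define N where "N = s - 1"
  have s: "s = Suc N" and N: "0 < N" using coeffs by (auto simp: ierk_coeffs_def N_def)
  obtain \<beta> where \<beta>: "0 < \<beta>" and coer: "\<And>k x. k \<le> N \<Longrightarrow>
     \<beta> * (\<Sum>i<k. (x i)\<^sup>2) \<le> (\<Sum>i<k. \<Sum>j<k. stage_matrix a i j * x i * x j)"
    using stage_matrix_coercive[OF coeffs pd] unfolding N_def by blast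
  define B' where "B' = max B 0"
  have B': "0 \<le> B'" "\<And>t. t \<in> {0..T} \<Longrightarrow> sobolev_le L (m + 6) (fcoef L (\<Phi> t)) B'"
    using \<Phi>(3) unfolding B'_def sobolev_le_def by (auto simp: le_max_iff_disj)
  define A where "A = 2 * 4 ^ (m + 4) * weight_sum L"
  define D where "D = 2 * (\<kappa>\<^sup>2 * B') + 2 * (2 * (A * B' * (A * B' * B')) + 2 * B')"
  have W: "0 < weight_sum L" using L by (rule weight_sum_pos)
  have A: "0 < A" using W by (simp add: A_def)
  have D0: "0 \<le> D" unfolding D_def using B'(1) A by (intro add_nonneg_nonneg mult_nonneg_nonneg) auto
  have f\<Phi>: "sobolev_le L (m + 4) (fcoef L (\<lambda>z. f_kappa \<kappa> (\<Phi> t z))) D" if "t \<in> {0..T}" for t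
    unfolding D_def A_def
    by (rule sobolev_le_f_kappa[OF L \<Phi>(1,2)[OF that] sobolev_le_weaken[OF B'(2)[OF that]]]) auto
  define Bw where "Bw = weight_sum L * B' + 1"
  have Bw: "0 < Bw" using W B'(1) by (simp add: Bw_def add_nonneg_pos)
  obtain Cf where Cf: "0 < Cf" and lip: "\<And>M u w. even M \<Longrightarrow> 0 < M \<Longrightarrow> dnorm2_sq L M w \<le> Bw \<Longrightarrow>
      dnorm2_sq L M (\<lambda>z. w z - u z) \<le> 1 \<Longrightarrow>
      dnorm2_sq L M (\<lambda>z. f_kappa \<kappa> (w z) - f_kappa \<kappa> (u z)) \<le> Cf * dnorm2_sq L M (\<lambda>z. w z - u z)"
    using dnorm2_sq_f_kappa_diff[OF L Bw, of \<kappa>] by blast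
  define bb where "bb = (\<Sum>i<N. \<Sum>j<N. (stage_matrix a i j)\<^sup>2)"
  have bb: "0 \<le> bb" unfolding bb_def by (intro sum_nonneg) auto
  define \<delta> where "\<delta> = \<epsilon>\<^sup>2 * \<beta>"
  have \<delta>: "0 < \<delta>" using \<epsilon> \<beta> by (simp add: \<delta>_def)
  define C\<rho> where "C\<rho> = weight_sum L * (2 * (1 + \<kappa>)\<^sup>2 * B' + 2 * D)"
  have C\<rho>: "0 \<le> C\<rho>" unfolding C\<rho>_def using W B'(1) D0 by (intro mult_nonneg_nonneg add_nonneg_nonneg) auto
  \<comment> \<open>The three coefficients of \<open>stage_energy\<close>, merged so that a single
    constant multiplies both the stage errors and \<open>H\<close>.\<close>
  define C1 where "C1 = \<delta> + bb * Cf / \<delta> + 4 * N * (bb * C\<rho> + K2\<^sup>2 / L\<^sup>2) / \<delta>"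
  have c: "0 \<le> bb * Cf / \<delta>" "0 \<le> 4 * N * (bb * C\<rho> + K2\<^sup>2 / L\<^sup>2) / \<delta>"
    using bb Cf \<delta> C\<rho> by (auto intro!: divide_nonneg_pos mult_nonneg_nonneg add_nonneg_nonneg)
  have C1: "0 < C1" unfolding C1_def using \<delta> c by linarith
  \<comment> \<open>The extra factor is that of \<open>stage_growth\<close>. As
    \<open>C1 \<le> C\<close>, the condition on \<open>C * step t n\<close> also controls the
    implicit part of the recursion.\<close>
  define C where "C = C1 * (N + 2) * 4 ^ N"
  have CC1: "C1 \<le> C"
  proof -
    have "1 * 1 \<le> (real N + 2) * 4 ^ N" by (intro mult_mono) auto
    then have "C1 * 1 \<le> C1 * ((real N + 2) * 4 ^ N)" using C1 by (intro mult_left_mono) auto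
    then show ?thesis by (simp add: C_def mult.assoc add.commute)
  qed
  have C0: "0 < C" using C1 CC1 by linarith
  show ?thesis
  proof (intro exI[of _ C] conjI C0 allI impI, elim conjE)
    fix M :: nat and t :: "nat \<Rightarrow> real" and n :: nat and u :: "nat \<Rightarrow> real \<times> real \<Rightarrow> complex"
      and \<zeta> :: "nat \<Rightarrow> real \<times> real \<Rightarrow> real" and \<eta> :: real
    assume M: "even M" "0 < M" and \<tau>: "0 < step t n" and small: "C * step t n \<le> 1 / 2" and \<eta>: "0 \<le> \<eta>"
      and times: "\<forall>i\<in>{1..s}. t (n - 1) + abscissa a i * step t n \<in> {0..T}"
      and defects: "\<forall>i\<in>{1..s-1}. continuous_on UNIV (\<zeta> (i + 1)) \<and> periodic2 L (\<zeta> (i + 1)) \<and>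
        (AE z in lborel. stage_exact a t \<Phi> n (i + 1) z = stage_exact a t \<Phi> n 1 z + step t n *
           (\<Sum>j=1..i. a (i + 1) j *
              ch_rhs L \<epsilon> \<kappa> (half (stage_exact a t \<Phi> n) j) (stage_exact a t \<Phi> n j) z)
           + step t n * \<zeta> (i + 1) z)"
      and \<zeta>0: "\<forall>i\<in>{1..<s-1}. \<forall>z. \<zeta> (i + 1) z = 0" and \<zeta>s: "dnorm L M (\<zeta> s) \<le> K2 * \<eta>"
      and scheme: "\<forall>z\<in>grid L M. \<forall>i\<in>{1..s-1}. u (i + 1) z = u 1 z + of_real (step t n) *
           (\<Sum>j=1..i. of_real (a (i + 1) j) * ch_rhs_h L M \<epsilon> \<kappa> (half u j) (u j) z)"
      and init: "4 ^ (s - 1) * (dnorm2_sq L M (\<lambda>z. of_real (stage_exact a t \<Phi> n 1 z) - u 1 z) + (((L / M)\<^sup>2) ^ m + \<eta>\<^sup>2)) \<le> 1"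
    define H where "H = ((L / M)\<^sup>2) ^ m + \<eta>\<^sup>2"
    have H: "0 \<le> H" by (simp add: H_def)
    define \<phi> where "\<phi> = (\<lambda>i. stage_exact a t \<Phi> n (Suc i))"
    define w where "w = (\<lambda>i z. complex_of_real (\<phi> i z))"
    define v where "v = (\<lambda>i. u (Suc i))"
    define E where "E = (\<lambda>i. dnorm2_sq L M (\<lambda>z. w i z - v i z))"
    have tm: "t (n - 1) + abscissa a (Suc i) * step t n \<in> {0..T}" if "i \<le> N" for i
      using times that by (auto simp: s)
    have \<phi>p: "continuous_on UNIV (\<phi> i)" "periodic2 L (\<phi> i)" "sobolev_le L (m + 6) (fcoef L (\<phi> i)) B'"
        "sobolev_le L (m + 4) (fcoef L (\<lambda>z. f_kappa \<kappa> (\<phi> i z))) D" if "i \<le> N" for i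
      unfolding \<phi>_def stage_exact_def using \<Phi>(1,2)[OF tm[OF that]] B'(2)[OF tm[OF that]] f\<Phi>[OF tm[OF that]] by blast+
    have hf: "half (stage_exact a t \<Phi> n) (Suc j) = (\<lambda>z. (\<phi> j z + \<phi> (Suc j) z) / 2)" for j
      by (auto simp: half_def \<phi>_def)
    have def': "continuous_on UNIV (\<zeta> (i + 2))" "periodic2 L (\<zeta> (i + 2))"
      "AE z in lborel. \<phi> (Suc i) z = \<phi> 0 z + step t n * (\<Sum>j\<le>i. a (i + 2) (j + 1) * ch_rhs L \<epsilon> \<kappa> (\<lambda>z. (\<phi> j z + \<phi> (Suc j) z) / 2) (\<phi> j) z) + step t n * \<zeta> (i + 2) z"
      if "i < N" for i
    proof -
      have "Suc i \<in> {1..s-1}" using that by (simp add: s)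
      note d = bspec[OF defects this]
      show "continuous_on UNIV (\<zeta> (i + 2))" "periodic2 L (\<zeta> (i + 2))" using d by simp_all
      have "AE z in lborel. stage_exact a t \<Phi> n (Suc i + 1) z = stage_exact a t \<Phi> n 1 z + step t n *
           (\<Sum>j=1..Suc i. a (Suc i + 1) j *
              ch_rhs L \<epsilon> \<kappa> (half (stage_exact a t \<Phi> n) j) (stage_exact a t \<Phi> n j) z)
           + step t n * \<zeta> (Suc i + 1) z" using d by blast
      then show "AE z in lborel. \<phi> (Suc i) z = \<phi> 0 z + step t n * (\<Sum>j\<le>i. a (i + 2) (j + 1) * ch_rhs L \<epsilon> \<kappa> (\<lambda>z. (\<phi> j z + \<phi> (Suc j) z) / 2) (\<phi> j) z) + step t n * \<zeta> (i + 2) z"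
        unfolding sum_from_1 hf by (simp add: \<phi>_def)
    qed
    obtain r where rb: "\<And>j. j < N \<Longrightarrow> (\<Sum>k\<in>modes M. (norm (r j k))\<^sup>2) \<le> weight_sum L * ((L / M)\<^sup>2) ^ m * (2 * (1 + \<kappa>)\<^sup>2 * B' + 2 * D)"
      and weq: "\<And>i k. i < N \<Longrightarrow> k \<in> modes M \<Longrightarrow> dcoef L M (w (Suc i)) k = dcoef L M (w 0) k
      + step t n * (\<Sum>j\<le>i. of_real (a (i + 2) (j + 1)) * (- of_real (ch_symbol L \<epsilon> \<kappa> k) * ((dcoef L M (w j) k + dcoef L M (w (Suc j)) k) / 2)
          + of_real (freq2 L k) * dcoef L M (\<lambda>z. f_kappa \<kappa> (w j z)) k + r j k))
      + step t n * dcoef L M (\<lambda>z. of_real (\<zeta> (i + 2) z)) k"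
      using exact_stage_equations[where \<phi> = \<phi> and \<zeta> = "\<lambda>i. \<zeta> (i + 2)" and n = N and \<alpha> = "\<lambda>i j. a (i + 2) (j + 1)",
          OF L M(2,1) \<epsilon> \<kappa> \<open>1 \<le> m\<close> \<tau> \<phi>p def'] unfolding w_def by blast
    have veq: "dcoef L M (v (Suc i)) k = dcoef L M (v 0) k
      + step t n * (\<Sum>j\<le>i. of_real (a (i + 2) (j + 1)) * (- of_real (ch_symbol L \<epsilon> \<kappa> k) * ((dcoef L M (v j) k + dcoef L M (v (Suc j)) k) / 2)
          + of_real (freq2 L k) * dcoef L M (\<lambda>z. f_kappa \<kappa> (v j z)) k))" if i: "i < N" and k: "k \<in> modes M" for i k
    proof -
      have "Suc i \<in> {1..s-1}" using i by (simp add: s)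
      then have "dcoef L M (u (Suc i + 1)) k = dcoef L M (\<lambda>z. u 1 z + of_real (step t n) *
           (\<Sum>j=1..Suc i. of_real (a (Suc i + 1) j) * ch_rhs_h L M \<epsilon> \<kappa> (half u j) (u j) z)) k"
        using scheme by (intro dcoef_cong) blast
      also have "\<dots> = dcoef L M (u 1) k + of_real (step t n) * (\<Sum>j\<le>i. of_real (a (Suc i + 1) (Suc j)) *
           dcoef L M (ch_rhs_h L M \<epsilon> \<kappa> (half u (Suc j)) (u (Suc j))) k)"
        unfolding sum_from_1 dcoef_add dcoef_cmult dcoef_sum ..
      finally show ?thesis
        unfolding dcoef_ch_rhs_h[OF L M(2,1) k] dcoef_half by (simp add: v_def)
    qed
    have Z0: "dcoef L M (\<lambda>z. of_real (\<zeta> (i + 2) z)) k = 0" if "Suc i < N" for i k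
    proof -
      have "Suc i \<in> {1..<s-1}" using that by (simp add: s)
      then have "\<zeta> (i + 2) z = 0" for z using \<zeta>0 by fastforce
      then show ?thesis by (simp add: dcoef_def)
    qed
    have Zb: "(\<Sum>k\<in>modes M. (norm (dcoef L M (\<lambda>z. of_real (\<zeta> (i + 2) z)) k))\<^sup>2) \<le> K2\<^sup>2 / L\<^sup>2 * \<eta>\<^sup>2" if i: "i < N" for i
    proof (cases "Suc i < N")
      case True
      then show ?thesis using Z0 by simp
    next
      case False
      then have si: "i + 2 = s" using i by (simp add: s)
      have dn: "dnorm L M (\<lambda>z. complex_of_real (\<zeta> s z)) = dnorm L M (\<zeta> s)" by (simp add: dnorm_def)
      have "0 \<le> dnorm L M (\<zeta> s)" unfolding dnorm_def by (intro real_sqrt_ge_zero mult_nonneg_nonneg sum_nonneg) auto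
      then have "(dnorm L M (\<zeta> s))\<^sup>2 \<le> (K2 * \<eta>)\<^sup>2" using \<zeta>s by (intro power_mono) auto
      then have "L\<^sup>2 * (\<Sum>k\<in>modes M. (norm (dcoef L M (\<lambda>z. of_real (\<zeta> s z)) k))\<^sup>2) \<le> (K2 * \<eta>)\<^sup>2"
        unfolding dnorm_eq[OF L M(2,1), symmetric] dn .
      then show ?thesis unfolding si using L by (simp add: power_mult_distrib field_simps)
    qed
    have wB: "dnorm2_sq L M (w j) \<le> Bw" if "j < N" for j
    proof -
      have j: "j \<le> N" using that by simp
      have "sobolev_le L 4 (fcoef L (\<phi> j)) B'" using \<phi>p(3)[OF j] by (rule sobolev_le_weaken) simp
      from dnorm2_sq_le_sobolev[OF L M(2,1) \<phi>p(1,2)[OF j] this] show ?thesis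
        unfolding w_def Bw_def by simp
    qed
    have lip': "dnorm2_sq L M (\<lambda>z. f_kappa \<kappa> (w j z) - f_kappa \<kappa> (v j z)) \<le> Cf * E j" if "j < N" "E j \<le> 1" for j
      using lip[OF M wB[OF that(1)]] that(2) unfolding E_def by blast
    have rec: "E (Suc K) \<le> E 0 + step t n * (C1 * ((\<Sum>i\<le>Suc K. E i) + H))" if K: "K < N" "\<forall>i\<le>K. E i \<le> 1" for K
    proof -
      let ?\<rho> = "weight_sum L * ((L / M)\<^sup>2) ^ m * (2 * (1 + \<kappa>)\<^sup>2 * B' + 2 * D)"
      let ?S = "\<Sum>i\<le>Suc K. E i"
      have E0: "0 \<le> E i" for i by (simp add: E_def)
      have S: "(\<Sum>i\<le>K. E i) \<le> ?S" "0 \<le> ?S" using E0[of "Suc K"] sum_nonneg[of "{..Suc K}" E] E0 by simp_all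
      have en: "E (Suc K) \<le> E 0 + step t n * (\<epsilon>\<^sup>2 * \<beta> * ?S + bb * Cf * (\<Sum>i\<le>K. E i) / (\<epsilon>\<^sup>2 * \<beta>)
         + 4 * N * (bb * ?\<rho> + K2\<^sup>2 / L\<^sup>2 * \<eta>\<^sup>2) / (\<epsilon>\<^sup>2 * \<beta>))"
        unfolding E_def bb_def
        by (rule stage_energy[where r = r and Z = "\<lambda>i. dcoef L M (\<lambda>z. of_real (\<zeta> (i + 2) z))"])
           (use \<epsilon> \<kappa> \<beta> \<tau> coer weq veq Z0 rb Zb lip' Cf K in \<open>auto simp: E_def\<close>)
      have "?\<rho> = C\<rho> * ((L / M)\<^sup>2) ^ m" by (simp add: C\<rho>_def)
      also have "\<dots> \<le> C\<rho> * H" using C\<rho> by (intro mult_left_mono) (auto simp: H_def)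
      finally have "bb * ?\<rho> + K2\<^sup>2 / L\<^sup>2 * \<eta>\<^sup>2 \<le> bb * (C\<rho> * H) + K2\<^sup>2 / L\<^sup>2 * H"
        using bb by (intro add_mono mult_left_mono) (auto simp: H_def)
      also have "\<dots> = (bb * C\<rho> + K2\<^sup>2 / L\<^sup>2) * H" by (simp add: algebra_simps)
      finally have q: "4 * N * (bb * ?\<rho> + K2\<^sup>2 / L\<^sup>2 * \<eta>\<^sup>2) / \<delta> \<le> 4 * N * ((bb * C\<rho> + K2\<^sup>2 / L\<^sup>2) * H) / \<delta>"
        using \<delta> by (intro divide_right_mono mult_left_mono) auto
      have p: "bb * Cf * (\<Sum>i\<le>K. E i) / \<delta> \<le> bb * Cf * ?S / \<delta>"
        using S bb Cf \<delta> by (intro divide_right_mono mult_left_mono) auto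
      have "\<delta> * ?S + bb * Cf * (\<Sum>i\<le>K. E i) / \<delta> + 4 * N * (bb * ?\<rho> + K2\<^sup>2 / L\<^sup>2 * \<eta>\<^sup>2) / \<delta> \<le>
          (\<delta> + bb * Cf / \<delta>) * ?S + (4 * N * (bb * C\<rho> + K2\<^sup>2 / L\<^sup>2) / \<delta>) * H"
        using p q by (simp add: distrib_right mult.assoc)
      also have "\<dots> \<le> C1 * ?S + C1 * H"
      proof (intro add_mono mult_right_mono S(2) H)
        show "\<delta> + bb * Cf / \<delta> \<le> C1" using c(2) by (simp add: C1_def)
        show "4 * N * (bb * C\<rho> + K2\<^sup>2 / L\<^sup>2) / \<delta> \<le> C1" using c(1) \<delta> by (simp add: C1_def)
      qed
      finally have fin: "\<delta> * ?S + bb * Cf * (\<Sum>i\<le>K. E i) / \<delta> + 4 * N * (bb * ?\<rho> + K2\<^sup>2 / L\<^sup>2 * \<eta>\<^sup>2) / \<delta> \<le> C1 * (?S + H)"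
        by (simp only: distrib_left)
      have "step t n * (\<delta> * ?S + bb * Cf * (\<Sum>i\<le>K. E i) / \<delta> + 4 * N * (bb * ?\<rho> + K2\<^sup>2 / L\<^sup>2 * \<eta>\<^sup>2) / \<delta>) \<le> step t n * (C1 * (?S + H))"
        using \<tau> by (intro mult_left_mono[OF fin]) simp
      with en show ?thesis unfolding \<delta>_def by linarith
    qed
    have "C1 * step t n \<le> C * step t n" using CC1 \<tau> by (intro mult_right_mono) auto
    then have small1: "C1 * step t n \<le> 1 / 2" using small by linarith
    have E0eq: "E 0 = dnorm2_sq L M (\<lambda>z. of_real (stage_exact a t \<Phi> n 1 z) - u 1 z)"
      by (simp add: E_def w_def v_def \<phi>_def)
    have ENeq: "E N = dnorm2_sq L M (\<lambda>z. of_real (stage_exact a t \<Phi> n s z) - u s z)"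
      by (simp add: E_def w_def v_def \<phi>_def s)
    have "E N \<le> E 0 + step t n * (C1 * (N + 2) * 4 ^ N * (E 0 + H))"
    proof (rule conjunct2[OF stage_growth[where n = N and \<delta> = H]])
      show "4 ^ N * (E 0 + H) \<le> 1" using init unfolding E0eq H_def by (simp add: s)
      show "E (Suc k) \<le> E 0 + step t n * (C1 * ((\<Sum>i\<le>Suc k. E i) + H))" if "k < N" "\<forall>i\<le>k. E i \<le> 1" for k
        using that by (rule rec)
    qed (use H C1 \<tau> small1 in \<open>auto simp: E_def\<close>)
    then show "dnorm2_sq L M (\<lambda>z. of_real (stage_exact a t \<Phi> n s z) - u s z) \<le>
         dnorm2_sq L M (\<lambda>z. of_real (stage_exact a t \<Phi> n 1 z) - u 1 z)
         + step t n * (C * (dnorm2_sq L M (\<lambda>z. of_real (stage_exact a t \<Phi> n 1 z) - u 1 z) + (((L / M)\<^sup>2) ^ m + \<eta>\<^sup>2)))"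
      unfolding ENeq E0eq H_def C_def .
  qed
qed

section \<open>Induction over the time steps and the choice of thresholds\<close>

text \<open>Converts bounds on the mesh width and the step size into a bound on the squared error
  scale, whatever the orders \<open>m\<close> and \<open>p\<close>.\<close>

lemma power_double_le:
  fixes x :: real
  assumes "0 \<le> x" and "x \<le> 1" and "1 \<le> m"
  shows "(x ^ m)\<^sup>2 \<le> x"
proof -
  have "(x ^ m)\<^sup>2 = x ^ (m * 2)" by (simp add: power_mult)
  also have "\<dots> \<le> x ^ 1" using assms by (intro power_decreasing) auto
  finally show ?thesis by simp
qed

theorem theorem4p3:
  fixes L T \<epsilon> \<kappa> C0 K1 K2 KT K\<phi> :: real
    and m p s :: nat
    and a :: "nat \<Rightarrow> nat \<Rightarrow> real"
    and \<Phi>0 :: "real \<times> real \<Rightarrow> real"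
    and \<Phi> :: "real \<Rightarrow> real \<times> real \<Rightarrow> real"
  assumes "0 < L" and "0 < T" and "0 < \<epsilon>" and "\<epsilon> < 1" and "0 \<le> \<kappa>"
    and "1 \<le> m" and "1 \<le> p" and "0 < C0"
    and "ch_solution L T \<epsilon> \<Phi>0 \<Phi>"
    and "ch_regular L T m p C0 \<Phi>0 \<Phi>"
    and "ierk_coeffs s a"
    and "pos_def_mat (s - 1) (D_R s a)"
    and "pos_def_mat (s - 1) (the (mat_inverse (D_R s a)))"
    and "\<forall>\<xi>::real. \<bar>\<xi>\<bar> \<le> (K\<phi> + \<epsilon>\<^sup>2) / \<epsilon>\<^sup>2 \<longrightarrow> \<bar>deriv (deriv F) \<xi>\<bar> \<le> \<kappa>"
  shows "\<exists>C>0. \<exists>h0>0. \<exists>\<tau>0>0. \<forall>M N t U \<zeta> u.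
    even M \<and> 0 < M \<and> time_mesh T N t \<and>
    L / real M \<le> h0 \<and> max_step N t \<le> \<tau>0 \<and>
    real N * max_step N t \<le> KT * T \<and>
    time_discrete L \<epsilon> \<kappa> s a N t \<Phi>0 U \<and>
    (\<forall>n\<in>{1..N}. \<forall>i\<in>{1..s}. dsup L M (proj L M (U n i)) \<le> K\<phi> / \<epsilon>\<^sup>2) \<and>
    stage_defects L T \<epsilon> \<kappa> s a N t \<Phi> \<zeta> \<and>
    (\<forall>n\<in>{1..N}. \<forall>i\<in>{1..s-1}. L2norm L (\<zeta> n (i + 1)) \<le> K1 * step t n) \<and>
    (\<forall>n\<in>{1..N}. \<forall>i\<in>{1..<s-1}. \<forall>z. \<zeta> n (i + 1) z = 0) \<and>
    (\<forall>n\<in>{1..N}. dnorm L M (\<zeta> n s) \<le> K2 * max_step N t ^ p) \<and>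
    fully_discrete L M \<epsilon> \<kappa> s a N t \<Phi>0 u
    \<longrightarrow> (\<forall>n\<in>{1..N}. dnorm L M (\<lambda>z. of_real (\<Phi> (t n) z) - u n s z)
           \<le> C * (max_step N t ^ p + (L / real M) ^ m))"
proof -
  note L = \<open>0 < L\<close>
  obtain B where B: "\<And>t. t \<in> {0..T} \<Longrightarrow> sobolev_le L (m + 6) (fcoef L (\<Phi> t)) B"
    using solution_regularity[OF assms(1-3,6,9,10)] by blast
  have \<Phi>c: "continuous_on UNIV (\<Phi> t)" "periodic2 L (\<Phi> t)" if "t \<in> {0..T}" for t
    using assms(9) that unfolding ch_solution_def by auto
  have \<Phi>0: "\<Phi> 0 = \<Phi>0" using assms(9) unfolding ch_solution_def by blast
  have T0: "0 \<in> {0..T}" using \<open>0 < T\<close> by simp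
  have B0: "0 \<le> B" using B[OF T0] by (rule sobolev_le_nonneg)
  note step_est = step_estimate[where \<Phi> = \<Phi> and T = T and B = B and ?K2.0 = K2, OF L assms(3,4,5,6,11,13) \<Phi>c B]
  define s1 where "s1 = s - 1"
  obtain C where C: "0 < C" and one: "\<forall>M t n u \<zeta> \<eta>. even M \<and> 0 < M \<and> 0 < step t n \<and> C * step t n \<le> 1 / 2 \<and> 0 \<le> \<eta> \<and>
     (\<forall>i\<in>{1..s}. t (n - 1) + abscissa a i * step t n \<in> {0..T}) \<and>
     (\<forall>i\<in>{1..s-1}. continuous_on UNIV (\<zeta> (i + 1)) \<and> periodic2 L (\<zeta> (i + 1)) \<and>
        (AE z in lborel. stage_exact a t \<Phi> n (i + 1) z = stage_exact a t \<Phi> n 1 z + step t n *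
           (\<Sum>j=1..i. a (i + 1) j *
              ch_rhs L \<epsilon> \<kappa> (half (stage_exact a t \<Phi> n) j) (stage_exact a t \<Phi> n j) z)
           + step t n * \<zeta> (i + 1) z)) \<and>
     (\<forall>i\<in>{1..<s-1}. \<forall>z. \<zeta> (i + 1) z = 0) \<and>
     dnorm L M (\<zeta> s) \<le> K2 * \<eta> \<and>
     (\<forall>z\<in>grid L M. \<forall>i\<in>{1..s-1}. u (i + 1) z = u 1 z + of_real (step t n) *
           (\<Sum>j=1..i. of_real (a (i + 1) j) * ch_rhs_h L M \<epsilon> \<kappa> (half u j) (u j) z)) \<and>
     4 ^ (s - 1) * (dnorm2_sq L M (\<lambda>z. of_real (stage_exact a t \<Phi> n 1 z) - u 1 z) + (((L / M)\<^sup>2) ^ m + \<eta>\<^sup>2)) \<le> 1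
     \<longrightarrow> dnorm2_sq L M (\<lambda>z. of_real (stage_exact a t \<Phi> n s z) - u s z) \<le>
         dnorm2_sq L M (\<lambda>z. of_real (stage_exact a t \<Phi> n 1 z) - u 1 z)
         + step t n * (C * (dnorm2_sq L M (\<lambda>z. of_real (stage_exact a t \<Phi> n 1 z) - u 1 z) + (((L / M)\<^sup>2) ^ m + \<eta>\<^sup>2)))"
    using step_est by blast
  \<comment> \<open>The size that the squared error plus \<open>H\<close> may have at the start of a
    step so that it stays below 1 in all stages.\<close>
  define \<theta> where "\<theta> = 1 / (4::real) ^ s1"
  have \<theta>: "0 < \<theta>" by (simp add: \<theta>_def)
  \<comment> \<open>\<open>C3 * H\<close> bounds the initial quantity \<open>X 0\<close>: the first
    summand is the interpolation error of the initial data, the 1 accounts for \<open>H\<close>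
    itself.\<close>
  define C3 where "C3 = weight_sum L * B + 1"
  have C3: "0 < C3" using weight_sum_pos[OF L] B0 by (simp add: C3_def add_nonneg_pos)
  define eC where "eC = exp (C * T)"
  have eC: "0 < eC" by (simp add: eC_def)
  \<comment> \<open>Mesh width and step size below \<open>x0\<close> give
    \<open>H \<le> 2 * x0\<close>, hence \<open>eC * C3 * H \<le> \<theta>\<close>, which is the
    smallness needed up to time \<open>T\<close>. The cap 1 is for
    \<open>power_double_le\<close>.\<close>
  define x0 where "x0 = min 1 (\<theta> / (2 * (eC * C3)))"
  have x0: "0 < x0" "x0 \<le> 1" "eC * C3 * (2 * x0) \<le> \<theta>"
  proof -
    show "0 < x0" "x0 \<le> 1" using \<theta> eC C3 by (simp_all add: x0_def)
    have "x0 \<le> \<theta> / (2 * (eC * C3))" by (simp add: x0_def)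
    then have "x0 * (2 * (eC * C3)) \<le> \<theta>" using eC C3 by (subst (asm) pos_le_divide_eq) auto
    then show "eC * C3 * (2 * x0) \<le> \<theta>" by (simp add: mult_ac)
  qed
  define \<tau>0 where "\<tau>0 = min x0 (1 / (2 * C))"
  have \<tau>0: "0 < \<tau>0" "\<tau>0 \<le> x0" "C * \<tau>0 \<le> 1 / 2"
  proof -
    show "0 < \<tau>0" "\<tau>0 \<le> x0" using x0 C by (simp_all add: \<tau>0_def)
    have "C * \<tau>0 \<le> C * (1 / (2 * C))" using C by (intro mult_left_mono) (auto simp: \<tau>0_def)
    then show "C * \<tau>0 \<le> 1 / 2" using C by simp
  qed
  \<comment> \<open>The root undoes the squares, and \<open>L\<close> comes from comparing
    \<open>dnorm\<close> with \<open>dnorm2_sq\<close>.\<close>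
  define Cend where "Cend = L * sqrt (eC * C3)"
  have Cend: "0 < Cend" using L eC C3 by (simp add: Cend_def)
  show ?thesis
  proof (rule exI[of _ Cend], intro conjI Cend, rule exI[of _ x0], intro conjI x0(1), rule exI[of _ \<tau>0], intro conjI \<tau>0(1) allI impI ballI, elim conjE)
    fix M N :: nat and t :: "nat \<Rightarrow> real" and U \<zeta> :: "nat \<Rightarrow> nat \<Rightarrow> real \<times> real \<Rightarrow> real"
      and u :: "nat \<Rightarrow> nat \<Rightarrow> real \<times> real \<Rightarrow> complex" and nf :: nat
    assume nf: "nf \<in> {1..N}" and M: "even M" "0 < M" and mesh: "time_mesh T N t"
      and h: "L / real M \<le> x0" and \<tau>m: "max_step N t \<le> \<tau>0"
      and defects: "stage_defects L T \<epsilon> \<kappa> s a N t \<Phi> \<zeta>"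
      and \<zeta>0: "\<forall>n\<in>{1..N}. \<forall>i\<in>{1..<s-1}. \<forall>z. \<zeta> n (i + 1) z = 0"
      and \<zeta>s: "\<forall>n\<in>{1..N}. dnorm L M (\<zeta> n s) \<le> K2 * max_step N t ^ p"
      and scheme: "fully_discrete L M \<epsilon> \<kappa> s a N t \<Phi>0 u"
    define \<tau> where "\<tau> = max_step N t"
    define \<eta> where "\<eta> = \<tau> ^ p"
    define H where "H = ((L / M)\<^sup>2) ^ m + \<eta>\<^sup>2"
    have ierk: "2 \<le> s" "abscissa a s = 1" "\<And>i. i \<in> {2..s-1} \<Longrightarrow> 0 < abscissa a i"
      using assms(11) unfolding ierk_coeffs_def by auto
    have abs1: "abscissa a 1 = 0" by (simp add: abscissa_def)
    have absc: "0 \<le> abscissa a i" if i: "i \<in> {1..s}" for i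
    proof -
      have "i = 1 \<or> i = s \<or> i \<in> {2..s-1}" using i by auto
      then show ?thesis using ierk(2) ierk(3)[of i] abs1 by (auto simp del: One_nat_def)
    qed
    have t0: "t 0 = 0" and tN: "t N = T" and tlt: "\<And>k. k < N \<Longrightarrow> t k < t (Suc k)"
      using mesh unfolding time_mesh_def by auto
    have tmono: "t i \<le> t j" if "i \<le> j" "j \<le> N" for i j
      using that
    proof (induction j rule: dec_induct)
      case (step k)
      then show ?case using tlt[of k] by fastforce
    qed simp
    have tT: "t k \<in> {0..T}" if "k \<le> N" for k
      using tmono[of 0 k] tmono[of k N] that t0 tN by auto
    have st: "step t (Suc k) = t (Suc k) - t k" for k by (simp add: step_def)
    have step_pos: "0 < step t (Suc k)" if "k < N" for k using tlt[OF that] by (simp add: st)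
    have step_le: "step t (Suc k) \<le> \<tau>" if "k < N" for k
      unfolding \<tau>_def max_step_def using that by (intro Max_ge) auto
    have N: "0 < N" using nf by auto
    have \<tau>pos: "0 \<le> \<tau>" using step_pos[OF N] step_le[OF N] by linarith
    have \<eta>: "0 \<le> \<eta>" using \<tau>pos by (simp add: \<eta>_def)
    have H0: "0 \<le> H" by (simp add: H_def)
    have Hx: "H \<le> 2 * x0"
    proof -
      have "((L / M)\<^sup>2) ^ m = ((L / M) ^ m)\<^sup>2" by (simp only: power_mult[symmetric] mult.commute)
      also have "\<dots> \<le> L / M" using L h x0(2) assms(6) by (intro power_double_le) auto
      finally have 1: "((L / M)\<^sup>2) ^ m \<le> x0" using h by linarith
      have "\<eta>\<^sup>2 \<le> \<tau>" unfolding \<eta>_def using \<tau>pos \<tau>m \<tau>0(2) x0(2) assms(7) by (intro power_double_le) (auto simp: \<tau>_def)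
      then have 2: "\<eta>\<^sup>2 \<le> x0" using \<tau>m \<tau>0(2) by (simp add: \<tau>_def)
      from 1 2 show ?thesis by (simp add: H_def)
    qed
    \<comment> \<open>There is no step 0, so \<open>k = 0\<close> refers to the start value
      \<open>u 1 1\<close>. For \<open>0 < k < N\<close> the last stage of step \<open>k\<close> is,
      on the grid, the first stage of step \<open>k + 1\<close>.\<close>
    define err where "err = (\<lambda>k. dnorm2_sq L M (\<lambda>z. of_real (\<Phi> (t k) z) - (if k = 0 then u 1 1 z else u k s z)))"
    \<comment> \<open>Adding \<open>H\<close> makes the recursion homogeneous, as
      \<open>discrete_growth\<close> requires, and gives the quantity that the threshold of
      \<open>step_estimate\<close> is about.\<close>
    define X where "X = (\<lambda>k. err k + H)"
    have X0: "0 \<le> X k" for k using H0 by (simp add: X_def err_def)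
    have uinit: "\<And>z. z \<in> grid L M \<Longrightarrow> u 1 1 z = proj L M \<Phi>0 z"
      and unext: "\<And>z n. z \<in> grid L M \<Longrightarrow> n \<in> {1..<N} \<Longrightarrow> u (n + 1) 1 z = u n s z"
      and ustage: "\<And>z n i. z \<in> grid L M \<Longrightarrow> n \<in> {1..N} \<Longrightarrow> i \<in> {1..s-1} \<Longrightarrow> u n (i + 1) z = u n 1 z + of_real (step t n) *
           (\<Sum>j=1..i. of_real (a (i + 1) j) * ch_rhs_h L M \<epsilon> \<kappa> (half (u n) j) (u n j) z)"
      using scheme unfolding fully_discrete_def by blast+
    have err0: "err 0 \<le> weight_sum L * B * H"
    proof -
      have c: "dcoef L M (\<lambda>z. of_real (\<Phi>0 z) - u 1 1 z) k = dcoef L M (\<lambda>z. of_real (\<Phi>0 z)) k - fcoef L \<Phi>0 k" if "k \<in> modes M" for k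
      proof -
        have "dcoef L M (u 1 1) k = dcoef L M (\<lambda>z. \<Sum>q\<in>modes M. fcoef L \<Phi>0 q * emode L q z) k"
          using uinit by (intro dcoef_cong) (simp add: proj_def)
        also have "\<dots> = fcoef L \<Phi>0 k" by (rule dcoef_trig_poly[OF L M(2,1) that])
        finally show ?thesis unfolding dcoef_diff by simp
      qed
      have "sobolev_le L (m + 4) (fcoef L \<Phi>0) B" using B[OF T0] unfolding \<Phi>0 by (rule sobolev_le_weaken) simp
      from dcoef_minus_fcoef_bound[OF L M(2,1) \<Phi>c[OF T0, unfolded \<Phi>0] this]
      have "err 0 \<le> weight_sum L * ((L / M)\<^sup>2) ^ m * B"
        unfolding err_def t0 \<Phi>0 dnorm2_sq_def using c by (simp cong: sum.cong)
      also have "\<dots> = weight_sum L * B * ((L / M)\<^sup>2) ^ m" by (simp only: mult_ac)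
      also have "\<dots> \<le> weight_sum L * B * H"
        using weight_sum_pos[OF L] B0 by (intro mult_left_mono) (auto simp: H_def)
      finally show ?thesis .
    qed
    have rec: "X (Suc k) \<le> (1 + C * (t (Suc k) - t k)) * X k" if k: "k < N" and small: "X k \<le> \<theta>" for k
    proof -
      let ?n = "Suc k"
      have n: "?n \<in> {1..N}" using k by simp
      have e0: "dnorm2_sq L M (\<lambda>z. of_real (stage_exact a t \<Phi> ?n 1 z) - u ?n 1 z) = err k"
        unfolding err_def
      proof (rule dnorm2_sq_cong)
        fix z assume z: "z \<in> grid L M"
        have "stage_exact a t \<Phi> ?n 1 = \<Phi> (t k)" unfolding stage_exact_def abs1 by simp
        moreover have "u ?n 1 z = (if k = 0 then u 1 1 z else u k s z)"
          using unext[OF z, of k] k by auto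
        ultimately show "of_real (stage_exact a t \<Phi> ?n 1 z) - u ?n 1 z = of_real (\<Phi> (t k) z) - (if k = 0 then u 1 1 z else u k s z)"
          by simp
      qed
      have e1: "dnorm2_sq L M (\<lambda>z. of_real (stage_exact a t \<Phi> ?n s z) - u ?n s z) = err ?n"
        by (simp add: err_def stage_exact_def ierk(2) st)
      have "C * step t ?n \<le> C * \<tau>0" using step_le[OF k] \<tau>m C by (intro mult_left_mono) (auto simp: \<tau>_def)
      then have small\<tau>: "C * step t ?n \<le> 1 / 2" using \<tau>0(3) by linarith
      \<comment> \<open>The upper bound is the first clause of \<open>stage_defects\<close>; the
        lower one holds because the abscissae are nonnegative.\<close>
      have times: "t (?n - 1) + abscissa a i * step t ?n \<in> {0..T}" if i: "i \<in> {1..s}" for i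
      proof -
        have "t (?n - 1) + abscissa a i * step t ?n \<le> T"
          using defects n i unfolding stage_defects_def by blast
        moreover have "0 \<le> abscissa a i * step t ?n" using absc[OF i] step_pos[OF k] by simp
        moreover have "0 \<le> t k" using tT[of k] k by simp
        ultimately show ?thesis by simp
      qed
      have "4 ^ s1 * (err k + H) \<le> 4 ^ s1 * \<theta>" using small unfolding X_def by (intro mult_left_mono) auto
      then have init: "4 ^ (s - 1) * (err k + H) \<le> 1" by (simp add: \<theta>_def s1_def)
      have "dnorm2_sq L M (\<lambda>z. of_real (stage_exact a t \<Phi> ?n s z) - u ?n s z) \<le>
         dnorm2_sq L M (\<lambda>z. of_real (stage_exact a t \<Phi> ?n 1 z) - u ?n 1 z)
         + step t ?n * (C * (dnorm2_sq L M (\<lambda>z. of_real (stage_exact a t \<Phi> ?n 1 z) - u ?n 1 z) + (((L / M)\<^sup>2) ^ m + \<eta>\<^sup>2)))"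
      proof (rule mp[OF one[THEN spec[of _ M], THEN spec[of _ t], THEN spec[of _ ?n], THEN spec[of _ "u ?n"], THEN spec[of _ "\<zeta> ?n"], THEN spec[of _ \<eta>]]], intro conjI)
        show "\<forall>i\<in>{1..s-1}. continuous_on UNIV (\<zeta> ?n (i + 1)) \<and> periodic2 L (\<zeta> ?n (i + 1)) \<and>
          (AE z in lborel. stage_exact a t \<Phi> ?n (i + 1) z = stage_exact a t \<Phi> ?n 1 z + step t ?n *
           (\<Sum>j=1..i. a (i + 1) j *
              ch_rhs L \<epsilon> \<kappa> (half (stage_exact a t \<Phi> ?n) j) (stage_exact a t \<Phi> ?n j) z)
           + step t ?n * \<zeta> ?n (i + 1) z)"
          using defects n unfolding stage_defects_def by blast
        show "dnorm L M (\<zeta> ?n s) \<le> K2 * \<eta>" using \<zeta>s n unfolding \<eta>_def \<tau>_def by blast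
        show "4 ^ (s - 1) * (dnorm2_sq L M (\<lambda>z. of_real (stage_exact a t \<Phi> ?n 1 z) - u ?n 1 z) + (((L / M)\<^sup>2) ^ m + \<eta>\<^sup>2)) \<le> 1"
          using init unfolding e0 H_def .
        show "\<forall>i\<in>{1..<s-1}. \<forall>z. \<zeta> ?n (i + 1) z = 0" using \<zeta>0 n by blast
        show "\<forall>z\<in>grid L M. \<forall>i\<in>{1..s-1}. u ?n (i + 1) z = u ?n 1 z + of_real (step t ?n) *
           (\<Sum>j=1..i. of_real (a (i + 1) j) * ch_rhs_h L M \<epsilon> \<kappa> (half (u ?n) j) (u ?n j) z)"
          using ustage n by blast
        show "\<forall>i\<in>{1..s}. t (?n - 1) + abscissa a i * step t ?n \<in> {0..T}" using times by blast
        show "even M" "0 < M" by (rule M)+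
        show "0 < step t ?n" by (rule step_pos[OF k])
        show "C * step t ?n \<le> 1 / 2" by (rule small\<tau>)
        show "0 \<le> \<eta>" by (rule \<eta>)
      qed
      then have "err ?n \<le> err k + step t ?n * (C * X k)" unfolding e0 e1 X_def H_def .
      then show ?thesis by (simp add: X_def st algebra_simps)
    qed
    have X0le: "X 0 \<le> C3 * H" using err0 by (simp add: X_def C3_def algebra_simps)
    have growth: "X k \<le> exp (C * (t k - t 0)) * X 0" if "k \<le> N" for k
    proof (rule discrete_growth[where N = N and \<theta> = \<theta>])
      have "exp (C * (t N - t 0)) * X 0 \<le> eC * (C3 * H)"
        unfolding t0 tN using X0le eC by (simp add: eC_def)
      also have "\<dots> \<le> eC * (C3 * (2 * x0))" using Hx eC C3 by (intro mult_left_mono) auto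
      also have "\<dots> \<le> \<theta>" using x0(3) by (simp only: mult.assoc)
      finally show "exp (C * (t N - t 0)) * X 0 \<le> \<theta>" .
      show "0 \<le> C" using C by simp
      show "t j \<le> t (Suc j)" if "j < N" for j using tlt[OF that] by simp
      show "X (Suc j) \<le> (1 + C * (t (Suc j) - t j)) * X j" if "j < N" "X j \<le> \<theta>" for j using that by (rule rec)
      show "0 \<le> X 0" by (rule X0)
      show "0 \<le> X j" for j by (rule X0)
    qed (rule that)
    have nfN: "nf \<le> N" "nf \<noteq> 0" using nf by auto
    have "(dnorm L M (\<lambda>z. of_real (\<Phi> (t nf) z) - u nf s z))\<^sup>2 \<le> L\<^sup>2 * err nf"
      unfolding err_def using dnorm_le_dnorm2_sq[OF L M(2,1), of "\<lambda>z. of_real (\<Phi> (t nf) z) - u nf s z"] nfN(2) by simp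
    also have "\<dots> \<le> L\<^sup>2 * X nf" using H0 by (intro mult_left_mono) (auto simp: X_def)
    also have "\<dots> \<le> L\<^sup>2 * (eC * (C3 * H))"
    proof (intro mult_left_mono)
      have "C * (t nf - t 0) \<le> C * T" using tT[OF nfN(1)] C t0 by (intro mult_left_mono) auto
      then have "exp (C * (t nf - t 0)) * X 0 \<le> eC * (C3 * H)"
        unfolding eC_def using X0le X0[of 0] by (intro mult_mono) auto
      then show "X nf \<le> eC * (C3 * H)" using growth[OF nfN(1)] by linarith
    qed simp
    also have "\<dots> = Cend\<^sup>2 * H"
    proof -
      have "Cend\<^sup>2 = L\<^sup>2 * (eC * C3)"
        unfolding Cend_def power_mult_distrib using eC C3 by (subst real_sqrt_pow2) auto
      then show ?thesis by (simp only: mult.assoc)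
    qed
    also have "\<dots> \<le> Cend\<^sup>2 * (\<tau> ^ p + (L / M) ^ m)\<^sup>2"
    proof (intro mult_left_mono)
      have "((L / M)\<^sup>2) ^ m = ((L / M) ^ m)\<^sup>2" by (simp only: power_mult[symmetric] mult.commute)
      then show "H \<le> (\<tau> ^ p + (L / M) ^ m)\<^sup>2"
        using mult_nonneg_nonneg[OF zero_le_power[OF \<tau>pos, of p] zero_le_power[of "L / M" m]] L
        unfolding H_def \<eta>_def power2_sum by simp
    qed simp
    finally have "(dnorm L M (\<lambda>z. of_real (\<Phi> (t nf) z) - u nf s z))\<^sup>2 \<le> (Cend * (\<tau> ^ p + (L / M) ^ m))\<^sup>2"
      by (simp only: power_mult_distrib)
    then show "dnorm L M (\<lambda>z. of_real (\<Phi> (t nf) z) - u nf s z) \<le> Cend * (max_step N t ^ p + (L / real M) ^ m)"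
      unfolding \<tau>_def[symmetric]
    proof (rule power2_le_imp_le)
      show "0 \<le> Cend * (\<tau> ^ p + (L / M) ^ m)"
        using Cend \<tau>pos L by (intro mult_nonneg_nonneg add_nonneg_nonneg zero_le_power) auto
    qed
  qed
qed

end
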